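(* For every $p>1$, the $W^{1,p}$ regularity of the source and target densities does not imply the $W^{1,p}$ regularity of the transport density. That is, for every $p\in(1,\infty)$ there exist an integer $d\ge 1$, a compact convex set $\Omega\subset\mathbb{R}^d$ with nonempty interior, and nonnegative functions $f^+,f^-\in W^{1,p}(\Omega)$ with $\int_\Omega f^+\,\mathrm{d}x=\int_\Omega f^-\,\mathrm{d}x$, such that the transport density $\sigma$ between $f^+$ and $f^-$ does not belong to $W^{1,p}(\Omega)$.
   Context: Let $\Omega\subset\mathbb{R}^d$ be compact and convex with nonempty interior; function spaces on $\Omega$ are understood on its interior. Let $f^\pm$ be nonnegative functions in $L^1(\Omega)$ of equal total mass, identified with the measures $f^\pm\,\mathrm{d}x$. An optimal transport plan (for the Monge–Kantorovich problem with Euclidean cost) is a nonnegative Borel measure $\lambda$ on $\Omega\times\Omega$ with first marginal $f^+$ and second marginal $f^-$ that minimizes $\int_{\Omega\times\Omega}|x-y|\,\mathrm{d}\lambda(x,y)$ among all nonnegative Borel measures with these marginals. The transport density $\sigma$ between $f^+$ and $f^-$ is the nonnegative measure on $\Omega$ defined by $$\langle\sigma,\varphi\rangle=\int_{\Omega\times\Omega}\mathrm{d}\lambda(x,y)\int_0^1\varphi((1-t)x+ty)\,|x-y|\,\mathrm{d}t\qquad\text{for all }\varphi\in C(\Omega).$$ It is a known fact that, since $f^\pm$ are absolutely continuous with respect to Lebesgue measure, $\sigma$ does not depend on the choice of the optimal plan $\lambda$ and is absolutely continuous with respect to Lebesgue measure; $\sigma$ is identified with its Lebesgue density. *)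

theory Defs
  imports "HOL-Analysis.Analysis"
begin

text \<open>
  The dimension \<open>d\<close> is a quantified variable of the statement, so \<open>\<real>\<^sup>d\<close> is the carrier of the library
  topology \<^const>\<open>Euclidean_space\<close> \<open>d\<close>: the sequences \<open>x :: nat \<Rightarrow> real\<close> with \<open>x i = 0\<close> for \<open>i \<ge> d\<close>.
  Functions on a subset of \<open>\<real>\<^sup>d\<close> are total functions; only their values on that subset matter.
\<close>

type_synonym point = "nat \<Rightarrow> real"

abbreviation Rn :: "nat \<Rightarrow> point set"
  where "Rn d \<equiv> topspace (Euclidean_space d)"

definition euclid_dist :: "nat \<Rightarrow> point \<Rightarrow> point \<Rightarrow> real"
  where "euclid_dist d x y = L2_set (\<lambda>i. x i - y i) {..<d}"

definition segment_point :: "point \<Rightarrow> point \<Rightarrow> real \<Rightarrow> point"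
  where "segment_point x y t = (\<lambda>i. (1 - t) * x i + t * y i)"

definition convex_set :: "point set \<Rightarrow> bool"
  where "convex_set S \<longleftrightarrow> (\<forall>x\<in>S. \<forall>y\<in>S. \<forall>t\<in>{0..1}. segment_point x y t \<in> S)"

text \<open>
  Lebesgue measure on the Borel sets of \<open>\<real>\<^sup>d\<close>. The completion is not needed: every class of
  a.e.-equal Lebesgue measurable functions has a Borel representative.
\<close>

definition leb :: "nat \<Rightarrow> point measure"
  where "leb d = distr (\<Pi>\<^sub>M i\<in>{..<d}. lborel) (restrict_space borel (Rn d))
                   (\<lambda>x i. if i < d then x i else 0)"

lemma measurable_extend_zero:
  "(\<lambda>x i. if i < d then x i else 0)
     \<in> measurable (\<Pi>\<^sub>M i\<in>{..<d}. (lborel :: real measure)) (restrict_space borel (Rn d))"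
proof (rule measurable_restrict_space2)
  show "(\<lambda>x i. if i < d then x i else 0) \<in> space (\<Pi>\<^sub>M i\<in>{..<d}. (lborel :: real measure)) \<rightarrow> Rn d"
    by (auto simp: topspace_Euclidean_space)
  have "(\<lambda>x i. if i < d then x i else (0::real))
          \<in> measurable (\<Pi>\<^sub>M i\<in>{..<d}. lborel) (\<Pi>\<^sub>M i\<in>UNIV. borel)"
  proof (rule measurable_PiM_single')
    fix i :: nat
    show "(\<lambda>x. if i < d then x i else (0::real)) \<in> borel_measurable (\<Pi>\<^sub>M i\<in>{..<d}. lborel)"
    proof (cases "i < d")
      case True
      then have "(\<lambda>x. x i) \<in> measurable (\<Pi>\<^sub>M i\<in>{..<d}. (lborel :: real measure)) lborel"
        by (intro measurable_component_singleton) auto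
      then show ?thesis using True by simp
    qed simp
  qed (auto simp: space_PiM)
  then show "(\<lambda>x i. if i < d then x i else (0::real)) \<in> borel_measurable (\<Pi>\<^sub>M i\<in>{..<d}. lborel)"
    using sets_PiM_equal_borel measurable_cong_sets by blast
qed

lemma sets_leb: "sets (leb d) = sets (restrict_space borel (Rn d))"
  by (simp add: leb_def)

lemma emeasure_leb_box:
  assumes "\<And>i. i < d \<Longrightarrow> a i \<le> b i"
  shows "emeasure (leb d) {x \<in> Rn d. \<forall>i<d. x i \<in> {a i..b i}} = ennreal (\<Prod>i<d. b i - a i)"
proof -
  let ?B = "{x \<in> Rn d. \<forall>i<d. x i \<in> {a i..b i}}"
  interpret product_sigma_finite "\<lambda>_::nat. lborel :: real measure" ..
  have "closed {x :: point. \<forall>i<d. x i \<in> {a i..b i}}"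
  proof -
    have "closed {x :: point. a i \<le> x i \<and> x i \<le> b i}" for i
      by (intro closed_Collect_conj closed_Collect_le continuous_on_const continuous_on_product_coordinates)
    moreover have "{x :: point. \<forall>i<d. x i \<in> {a i..b i}} = (\<Inter>i\<in>{..<d}. {x. a i \<le> x i \<and> x i \<le> b i})"
      by auto
    ultimately show ?thesis by auto
  qed
  then have "?B \<in> sets (restrict_space borel (Rn d))"
    unfolding sets_restrict_space
    by (intro image_eqI[of _ _ "{x. \<forall>i<d. x i \<in> {a i..b i}}"]) auto
  then have "emeasure (leb d) ?B = emeasure (\<Pi>\<^sub>M i\<in>{..<d}. (lborel :: real measure))
      ((\<lambda>x i. if i < d then x i else 0) -` ?B \<inter> space (\<Pi>\<^sub>M i\<in>{..<d}. (lborel :: real measure)))"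
    unfolding leb_def by (rule emeasure_distr[OF measurable_extend_zero])
  also have "(\<lambda>x i. if i < d then x i else 0) -` ?B \<inter> space (\<Pi>\<^sub>M i\<in>{..<d}. (lborel :: real measure))
      = (\<Pi>\<^sub>E i\<in>{..<d}. {a i..b i})"
    by (intro set_eqI) (simp add: space_PiM topspace_Euclidean_space PiE_iff Ball_def)
  also have "emeasure (\<Pi>\<^sub>M i\<in>{..<d}. (lborel :: real measure)) (\<Pi>\<^sub>E i\<in>{..<d}. {a i..b i})
      = (\<Prod>i<d. emeasure lborel {a i..b i})"
    by (rule emeasure_PiM) auto
  also have "\<dots> = (\<Prod>i<d. ennreal (b i - a i))"
    using assms by (intro prod.cong) auto
  also have "\<dots> = ennreal (\<Prod>i<d. b i - a i)"
    using assms by (intro prod_ennreal) auto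
  finally show ?thesis .
qed


section \<open>Sobolev spaces\<close>

definition Lp :: "nat \<Rightarrow> point set \<Rightarrow> real \<Rightarrow> (point \<Rightarrow> real) set"
  where "Lp d U p =
    {f. set_borel_measurable (leb d) U f \<and> set_integrable (leb d) U (\<lambda>x. \<bar>f x\<bar> powr p)}"

definition partial :: "nat \<Rightarrow> (point \<Rightarrow> real) \<Rightarrow> point \<Rightarrow> real"
  where "partial i \<phi> x = deriv (\<lambda>h. \<phi> (x(i := h))) (x i)"

text \<open>
  \<open>C\<^sup>\<infinity>\<close> on \<open>\<real>\<^sup>d\<close>: all iterated partial derivatives exist and are continuous. The existence clause is
  needed because \<^const>\<open>deriv\<close> is total.
\<close>

definition smooth :: "nat \<Rightarrow> (point \<Rightarrow> real) \<Rightarrow> bool"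
  where "smooth d \<phi> \<longleftrightarrow> (\<forall>is. set is \<subseteq> {..<d} \<longrightarrow>
    continuous_map (Euclidean_space d) euclideanreal (foldr partial is \<phi>) \<and>
    (\<forall>i<d. \<forall>x\<in>Rn d. (\<lambda>h. foldr partial is \<phi> (x(i := h))) differentiable (at (x i))))"

text \<open>\<open>C\<^sub>c\<^sup>\<infinity>(U)\<close>, with functions extended by zero from \<open>U\<close> to \<open>\<real>\<^sup>d\<close>.\<close>

definition test_functions :: "nat \<Rightarrow> point set \<Rightarrow> (point \<Rightarrow> real) set"
  where "test_functions d U = {\<phi>. smooth d \<phi> \<and>
    compactin (Euclidean_space d) (Euclidean_space d closure_of {x \<in> Rn d. \<phi> x \<noteq> 0}) \<and>
    Euclidean_space d closure_of {x \<in> Rn d. \<phi> x \<noteq> 0} \<subseteq> U}"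

definition weak_partial :: "nat \<Rightarrow> point set \<Rightarrow> nat \<Rightarrow> (point \<Rightarrow> real) \<Rightarrow> (point \<Rightarrow> real) \<Rightarrow> bool"
  where "weak_partial d U i f g \<longleftrightarrow> (\<forall>\<phi>\<in>test_functions d U.
    (LINT x:U|leb d. f x * partial i \<phi> x) = - (LINT x:U|leb d. g x * \<phi> x))"

definition W1p :: "nat \<Rightarrow> point set \<Rightarrow> real \<Rightarrow> (point \<Rightarrow> real) set"
  where "W1p d U p = {f \<in> Lp d U p. \<forall>i<d. \<exists>g\<in>Lp d U p. weak_partial d U i f g}"


section \<open>Optimal transport\<close>

definition density_on :: "nat \<Rightarrow> point set \<Rightarrow> (point \<Rightarrow> real) \<Rightarrow> point measure"
  where "density_on d \<Omega> f = density (restrict_space (leb d) \<Omega>) (\<lambda>x. ennreal (f x))"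

definition transport_plan ::
    "nat \<Rightarrow> point set \<Rightarrow> (point \<Rightarrow> real) \<Rightarrow> (point \<Rightarrow> real) \<Rightarrow> (point \<times> point) measure \<Rightarrow> bool"
  where "transport_plan d \<Omega> f g \<gamma> \<longleftrightarrow>
    sets \<gamma> = sets (restrict_space borel (\<Omega> \<times> \<Omega>)) \<and>
    distr \<gamma> (restrict_space borel \<Omega>) fst = density_on d \<Omega> f \<and>
    distr \<gamma> (restrict_space borel \<Omega>) snd = density_on d \<Omega> g"

definition transport_cost :: "nat \<Rightarrow> (point \<times> point) measure \<Rightarrow> ennreal"
  where "transport_cost d \<gamma> = (\<integral>\<^sup>+ (x, y). ennreal (euclid_dist d x y) \<partial>\<gamma>)"

definition optimal_plan ::
    "nat \<Rightarrow> point set \<Rightarrow> (point \<Rightarrow> real) \<Rightarrow> (point \<Rightarrow> real) \<Rightarrow> (point \<times> point) measure \<Rightarrow> bool"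
  where "optimal_plan d \<Omega> f g \<gamma> \<longleftrightarrow> transport_plan d \<Omega> f g \<gamma> \<and>
    (\<forall>\<gamma>'. transport_plan d \<Omega> f g \<gamma>' \<longrightarrow> transport_cost d \<gamma> \<le> transport_cost d \<gamma>')"

definition transport_measure ::
    "nat \<Rightarrow> point set \<Rightarrow> (point \<Rightarrow> real) \<Rightarrow> (point \<Rightarrow> real) \<Rightarrow> point measure \<Rightarrow> bool"
  where "transport_measure d \<Omega> f g \<mu> \<longleftrightarrow>
    sets \<mu> = sets (restrict_space borel \<Omega>) \<and> finite_measure \<mu> \<and>
    (\<exists>\<gamma>. optimal_plan d \<Omega> f g \<gamma> \<and>
      (\<forall>\<phi>. continuous_on \<Omega> \<phi> \<longrightarrow>
        (LINT x|\<mu>. \<phi> x) =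
        (LINT (x, y)|\<gamma>. (LINT t:{0..1}|lborel. \<phi> (segment_point x y t) * euclid_dist d x y))))"

text \<open>The transport density as a function: a Borel Lebesgue density of the transport measure.\<close>

definition transport_density ::
    "nat \<Rightarrow> point set \<Rightarrow> (point \<Rightarrow> real) \<Rightarrow> (point \<Rightarrow> real) \<Rightarrow> (point \<Rightarrow> real) \<Rightarrow> bool"
  where "transport_density d \<Omega> f g \<sigma> \<longleftrightarrow>
    \<sigma> \<in> borel_measurable (restrict_space (leb d) \<Omega>) \<and> (\<forall>x\<in>\<Omega>. 0 \<le> \<sigma> x) \<and>
    transport_measure d \<Omega> f g (density_on d \<Omega> \<sigma>)"

end

theory Submission
  imports Defs
begin

text \<open>
  The example is planar. The rays are the lines \<open>y = A s + x * s\<close>, \<open>s \<in> {0..1}\<close>, with \<open>A\<close> strictly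
  increasing; they never cross for \<open>x \<ge> 0\<close>, and their directions are the gradient of the potential
  \<open>max\<^sub>s ((x + s * y) / sqrt (1 + s\<^sup>2) - G s)\<close> for a suitable \<open>G\<close>. This potential is 1-Lipschitz, so any
  plan moving mass along rays is optimal and every optimal plan does so; hence the transport density
  is determined ray by ray: in the coordinates \<open>(s, x)\<close>, with area element
  \<open>(A' s + x) ds dx\<close>, it is the flux through the ray divided by \<open>A' s + x\<close>, up to the factor
  \<open>sqrt (1 + s\<^sup>2)\<close>.

  Take \<open>A' s = s ^ k * (2 + sin (1 / s ^ (4 * k - 1)))\<close>, put the source near the tips \<open>x \<le> s ^ k\<close> of
  the rays and the target at \<open>x \<ge> 1\<close>. At \<open>x \<ge> 1\<close> the oscillation of \<open>A'\<close> is seen at its own scale,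
  and the target is small enough there to have bounded derivatives; at \<open>x\<close> of order
  \<open>s ^ k\<close> the rays are compressed by the factor \<open>s ^ k\<close>, so the transport density oscillates faster by
  the factor \<open>s ^ (- k)\<close>. Its \<open>L\<^sup>p\<close> gradient norm on the \<open>n\<close>-th oscillation, to the power \<open>p\<close>, is at least
  of order \<open>1 / n\<close> once \<open>2 * k * (p - 1) \<ge> 1\<close>.
\<close>

section \<open>Smooth step functions and test functions\<close>

text \<open>The exponents come from a scaling count. Put \<open>B = s ^ k\<close>. A source of
  height \<open>B ^ 2\<close> on a tip of length \<open>B\<close>, where the Jacobian is of order
  \<open>B\<close>, gives a ray mass of order \<open>B ^ 4\<close>, and the derivative of that mass
  stays bounded as long as \<open>m + 1 \<le> 4 * k\<close>. At the limit exponent one period of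
  \<open>1 / s ^ m\<close> has length of order \<open>B ^ 4\<close> in \<open>s\<close>, so at
  \<open>x\<close> of order \<open>B\<close> it is a cell of area \<open>B ^ 6\<close> and height
  \<open>B ^ 5\<close>. The density jumps there by \<open>B ^ 3\<close>, its gradient is of order
  \<open>B ^ (-2)\<close>, and the cell contributes
  \<open>B ^ (6 - 2 * p) = B ^ 4 * B ^ (-2 * (p - 1))\<close>. Since \<open>B ^ 4\<close> is
  \<open>s\<close> divided by the phase, the harmonic series appears as soon as
  \<open>s ^ (-2 * k * (p - 1))\<close> beats \<open>1 / s\<close>; this is why \<open>k\<close>
  must grow as \<open>p\<close> approaches 1. The delicate point is that the mass oscillates in
  phase with the Jacobian. The quotient nevertheless varies: with \<open>v\<close> the sine and
  \<open>c = s ^ k\<close> it is proportional to \<open>(9 + 4 * v) / (c * (2 + v) + x)\<close>,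
  which increases in \<open>v\<close> when \<open>4 * x > c\<close>.\<close>

definition exp_tail :: "real poly \<Rightarrow> real \<Rightarrow> real"
  where "exp_tail P t = (if t > 0 then poly P (1 / t) * exp (- (1 / t)) else 0)"

lemma poly_times_exp_neg_tendsto_0:
  "((\<lambda>u::real. poly P u * exp (- u)) \<longlongrightarrow> 0) at_top"
proof -
  have "((\<lambda>u::real. \<Sum>i\<le>degree P. coeff P i * (u ^ i / exp u)) \<longlongrightarrow> (\<Sum>i\<le>degree P. coeff P i * 0)) at_top"
    by (intro tendsto_intros tendsto_power_div_exp_0)
  then show ?thesis
    by (simp add: poly_altdef sum_divide_distrib sum_distrib_right exp_minus field_simps)
qed

text \<open>In the variable \<open>u = 1 / t\<close> the derivative in \<open>t\<close> is
  \<open>- u ^ 2\<close> times the derivative in \<open>u\<close>, so the functions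
  \<open>P u * exp (- u)\<close> form a family closed under differentiation. At \<open>t = 0\<close>
  both one-sided difference quotients tend to 0.\<close>

lemma exp_tail_has_derivative:
  "(exp_tail P has_real_derivative exp_tail (monom 1 2 * (P - pderiv P)) t) (at t)"
proof -
  consider "t > 0" | "t < 0" | "t = 0" by linarith
  then show ?thesis
  proof cases
    case 1
    have "((\<lambda>t. poly P (1 / t) * exp (- (1 / t))) has_real_derivative
        exp_tail (monom 1 2 * (P - pderiv P)) t) (at t)"
      using 1 by (auto intro!: derivative_eq_intros
          simp: exp_tail_def poly_monom field_simps power2_eq_square)
    then show ?thesis
      by (rule has_field_derivative_transform_within_open[of _ _ _ "{0<..}"])
        (use 1 in \<open>auto simp: exp_tail_def\<close>)
  next
    case 2
    have "((\<lambda>t. 0) has_real_derivative exp_tail (monom 1 2 * (P - pderiv P)) t) (at t)"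
      using 2 by (auto simp: exp_tail_def)
    then show ?thesis
      by (rule has_field_derivative_transform_within_open[of _ _ _ "{..<0}"])
        (use 2 in \<open>auto simp: exp_tail_def\<close>)
  next
    case 3
    have "((\<lambda>h. exp_tail P h / h) \<longlongrightarrow> 0) (at 0)"
    proof (rule filterlim_split_at)
      have "((\<lambda>h. 0) \<longlongrightarrow> (0::real)) (at_left 0)" by simp
      then show "((\<lambda>h. exp_tail P h / h) \<longlongrightarrow> 0) (at_left 0)"
        by (rule Lim_transform_eventually)
          (auto simp: exp_tail_def eventually_at_filter)
      \<comment> \<open>Dividing by \<open>h\<close> multiplies the polynomial by its variable
        \<open>1 / h\<close>, which is \<open>pCons 0 P\<close>, so the limit at infinity proved
        above applies.\<close>
      have "((\<lambda>h. poly (pCons 0 P) (inverse h) * exp (- inverse h)) \<longlongrightarrow> 0) (at_right (0::real))"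
        by (rule filterlim_compose[OF poly_times_exp_neg_tendsto_0 filterlim_inverse_at_top_right])
      then show "((\<lambda>h. exp_tail P h / h) \<longlongrightarrow> 0) (at_right 0)"
        by (rule Lim_transform_eventually)
          (auto simp: exp_tail_def eventually_at_filter field_simps)
    qed
    then show ?thesis
      using 3 by (simp add: DERIV_def exp_tail_def)
  qed
qed

lemma exp_tail_nonneg: "exp_tail 1 t \<ge> 0"
  by (simp add: exp_tail_def)

definition bump :: "real \<Rightarrow> real"
  where "bump t = exp_tail 1 t * exp_tail 1 (1 - t)"

lemma isCont_bump: "isCont bump t"
proof -
  have "isCont (\<lambda>t. exp_tail 1 (1 - t)) t"
    by (rule isCont_o2[OF _ DERIV_isCont[OF exp_tail_has_derivative]]) simp
  then show ?thesis
    unfolding bump_def by (intro isCont_mult DERIV_isCont[OF exp_tail_has_derivative])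
qed

lemma bump_nonneg: "bump t \<ge> 0"
  by (simp add: bump_def exp_tail_nonneg)

lemma bump_eq_0: "t \<notin> {0<..<1} \<Longrightarrow> bump t = 0"
  by (auto simp: bump_def exp_tail_def)

lemma bump_pos: "t \<in> {0<..<1} \<Longrightarrow> bump t > 0"
  by (auto simp: bump_def exp_tail_def)

text \<open>An antiderivative of \<open>bump\<close> is constant to the left of 0 and to the right
  of 1, and strictly larger on the right; subtracting and dividing normalizes it.\<close>

lemma smooth_step_exists:
  "\<exists>h. \<exists>c>0. (\<forall>t. (h has_real_derivative c * bump t) (at t)) \<and>
     (\<forall>t\<le>0. h t = 0) \<and> (\<forall>t\<ge>1. h t = 1)"
proof -
  obtain H where H: "\<And>t. (H has_real_derivative bump t) (at t)"
    using einterval_antiderivative[of "-\<infinity>" "\<infinity>" bump] isCont_bump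
    by (auto simp: has_real_derivative_iff_has_vector_derivative)
  have cont: "continuous_on S H" for S
    using H by (meson DERIV_continuous continuous_at_imp_continuous_on)
  have left: "H t = H 0" if "t \<le> 0" for t
  proof (cases "t = 0")
    case False
    then show ?thesis
      using that by (intro DERIV_isconst_end[symmetric] cont)
        (auto intro!: derivative_eq_intros H[THEN DERIV_cong] simp: bump_eq_0)
  qed simp
  have right: "H t = H 1" if "t \<ge> 1" for t
  proof (cases "t = 1")
    case False
    then show ?thesis
      using that by (intro DERIV_isconst_end cont)
        (auto intro!: derivative_eq_intros H[THEN DERIV_cong] simp: bump_eq_0)
  qed simp
  have pos: "H 0 < H 1"
    by (rule DERIV_pos_imp_increasing_open[OF _ _ cont]) (auto intro!: exI H bump_pos)
  define h where "h t = (H t - H 0) / (H 1 - H 0)" for t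
  have "(h has_real_derivative (1 / (H 1 - H 0)) * bump t) (at t)" for t
    unfolding h_def using pos by (auto intro!: derivative_eq_intros H)
  moreover have "h t = 0" if "t \<le> 0" for t
    using left[OF that] by (simp add: h_def)
  moreover have "h t = 1" if "t \<ge> 1" for t
    using right[OF that] pos by (simp add: h_def)
  ultimately show ?thesis
    using pos by (intro exI[of _ h] exI[of _ "1 / (H 1 - H 0)"]) simp
qed

definition smooth_step :: "real \<Rightarrow> real"
  where "smooth_step = (SOME h. \<exists>c>0. (\<forall>t. (h has_real_derivative c * bump t) (at t)) \<and>
     (\<forall>t\<le>0. h t = 0) \<and> (\<forall>t\<ge>1. h t = 1))"

text \<open>The reciprocal of the integral of \<open>bump\<close> over the unit interval, named so
  that the derivative of \<open>smooth_step\<close> is an explicit expression.\<close>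

definition step_scale :: real
  where "step_scale = (SOME c. 0 < c \<and> (\<forall>t. (smooth_step has_real_derivative c * bump t) (at t)))"

lemma smooth_step_props:
  "\<exists>c>0. (\<forall>t. (smooth_step has_real_derivative c * bump t) (at t)) \<and>
     (\<forall>t\<le>0. smooth_step t = 0) \<and> (\<forall>t\<ge>1. smooth_step t = 1)"
  unfolding smooth_step_def by (rule someI_ex[OF smooth_step_exists])

lemma step_scale_props:
  "0 < step_scale \<and> (\<forall>t. (smooth_step has_real_derivative step_scale * bump t) (at t))"
  unfolding step_scale_def proof (rule someI_ex)
  show "\<exists>c>0. \<forall>t. (smooth_step has_real_derivative c * bump t) (at t)"
    using smooth_step_props by meson
qed

lemma smooth_step_has_derivative:
  "(smooth_step has_real_derivative step_scale * bump t) (at t)"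
  and step_scale_pos: "0 < step_scale"
  and smooth_step_eq_0: "t \<le> 0 \<Longrightarrow> smooth_step t = 0"
  and smooth_step_eq_1: "t \<ge> 1 \<Longrightarrow> smooth_step t = 1"
  using step_scale_props smooth_step_props by auto

lemma smooth_step_mono: "s \<le> t \<Longrightarrow> smooth_step s \<le> smooth_step t"
  by (rule DERIV_nonneg_imp_nondecreasing)
    (use smooth_step_has_derivative mult_nonneg_nonneg[OF less_imp_le[OF step_scale_pos] bump_nonneg] in blast)+

lemma smooth_step_bounds: "0 \<le> smooth_step t" "smooth_step t \<le> 1"
  using smooth_step_mono[of "min t 0" t] smooth_step_mono[of t "max t 1"]
    smooth_step_eq_0[of "min t 0"] smooth_step_eq_1[of "max t 1"] by auto

lemma continuous_on_smooth_step [continuous_intros]: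
  "continuous_on S f \<Longrightarrow> continuous_on S (\<lambda>x. smooth_step (f x))"
  by (rule continuous_on_compose2[OF DERIV_continuous_on[OF has_field_derivative_at_within[OF smooth_step_has_derivative]], of S f UNIV])
    auto

lemma continuous_on_exp_tail [continuous_intros]:
  "continuous_on S f \<Longrightarrow> continuous_on S (\<lambda>x. exp_tail P (f x))"
  by (rule continuous_on_compose2[OF DERIV_continuous_on[OF has_field_derivative_at_within[OF exp_tail_has_derivative]], of S f UNIV])
    auto

text \<open>\<open>smooth\<close> quantifies over all iterated partial derivatives. This algebra of
  continuous functions is stable under \<open>partial\<close>, so smoothness becomes an induction on
  the list of derivatives. The constructor \<open>tail\<close> is there because differentiating
  \<open>smooth_step\<close> produces values of \<open>exp_tail\<close>.\<close>

inductive_set smooth_algebra :: "(point \<Rightarrow> real) set" where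
  const: "(\<lambda>_. c) \<in> smooth_algebra"
| coord: "(\<lambda>x. x i) \<in> smooth_algebra"
| add: "f \<in> smooth_algebra \<Longrightarrow> g \<in> smooth_algebra \<Longrightarrow> (\<lambda>x. f x + g x) \<in> smooth_algebra"
| mult: "f \<in> smooth_algebra \<Longrightarrow> g \<in> smooth_algebra \<Longrightarrow> (\<lambda>x. f x * g x) \<in> smooth_algebra"
| tail: "f \<in> smooth_algebra \<Longrightarrow> (\<lambda>x. exp_tail P (f x)) \<in> smooth_algebra"
| step: "f \<in> smooth_algebra \<Longrightarrow> (\<lambda>x. smooth_step (f x)) \<in> smooth_algebra"

lemma smooth_algebra_derivative:
  assumes "f \<in> smooth_algebra"
  shows "\<exists>f'\<in>smooth_algebra. \<forall>x. ((\<lambda>h. f (x(i := h))) has_real_derivative f' x) (at (x i))"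
  using assms
proof induction
  case (const c)
  show ?case by (rule bexI[OF _ smooth_algebra.const[of 0]]) auto
next
  case (coord j)
  show ?case
    by (rule bexI[OF _ smooth_algebra.const[of "if i = j then 1 else 0"]]) (auto intro: derivative_eq_intros)
next
  case (add f g)
  then obtain f' g' where d: "f' \<in> smooth_algebra" "g' \<in> smooth_algebra"
    "\<And>x. ((\<lambda>h. f (x(i := h))) has_real_derivative f' x) (at (x i))"
    "\<And>x. ((\<lambda>h. g (x(i := h))) has_real_derivative g' x) (at (x i))" by blast
  show ?case
    by (rule bexI[OF _ smooth_algebra.add[OF d(1,2)]]) (intro allI DERIV_add d)
next
  case (mult f g)
  then obtain f' g' where d: "f' \<in> smooth_algebra" "g' \<in> smooth_algebra"
    "\<And>x. ((\<lambda>h. f (x(i := h))) has_real_derivative f' x) (at (x i))"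
    "\<And>x. ((\<lambda>h. g (x(i := h))) has_real_derivative g' x) (at (x i))" by blast
  have "((\<lambda>h. f (x(i := h)) * g (x(i := h))) has_real_derivative f' x * g x + g' x * f x) (at (x i))" for x
    using DERIV_mult[OF d(3)[of x] d(4)[of x]] by (simp only: fun_upd_triv)
  then show ?case
    by (intro bexI[OF _ smooth_algebra.add[OF smooth_algebra.mult[OF d(1) mult.hyps(2)]
            smooth_algebra.mult[OF d(2) mult.hyps(1)]]]) blast
next
  case (tail f P)
  then obtain f' where d: "f' \<in> smooth_algebra"
    "\<And>x. ((\<lambda>h. f (x(i := h))) has_real_derivative f' x) (at (x i))" by blast
  have "((\<lambda>h. exp_tail P (f (x(i := h)))) has_real_derivative
      exp_tail (monom 1 2 * (P - pderiv P)) (f x) * f' x) (at (x i))" for x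
    using DERIV_chain2[OF exp_tail_has_derivative d(2)[of x]] by (simp only: fun_upd_triv)
  then show ?case
    by (intro bexI[OF _ smooth_algebra.mult[OF smooth_algebra.tail[OF tail.hyps] d(1)]]) blast
next
  case (step f)
  then obtain f' where d: "f' \<in> smooth_algebra"
    "\<And>x. ((\<lambda>h. f (x(i := h))) has_real_derivative f' x) (at (x i))" by blast
  \<comment> \<open>The derivative of \<open>smooth_step\<close>, with \<open>bump\<close> unfolded
    and the difference \<open>1 - f x\<close> written with the constructors for sums, products and
    constants.\<close>
  have b: "(\<lambda>x. step_scale * (exp_tail 1 (f x) * exp_tail 1 (1 + (-1) * f x))) \<in> smooth_algebra"
    by (intro smooth_algebra.intros step.hyps)
  have "((\<lambda>h. smooth_step (f (x(i := h)))) has_real_derivative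
      step_scale * (exp_tail 1 (f x) * exp_tail 1 (1 + (-1) * f x)) * f' x) (at (x i))" for x
    using DERIV_chain2[OF smooth_step_has_derivative d(2)[of x]]
    by (simp only: fun_upd_triv bump_def diff_conv_add_uminus mult_minus1)
  then show ?case
    by (intro bexI[OF _ smooth_algebra.mult[OF b d(1)]]) blast
qed

lemma smooth_algebra_continuous: "f \<in> smooth_algebra \<Longrightarrow> continuous_on UNIV f"
  by (induction rule: smooth_algebra.induct)
    (auto intro!: continuous_intros continuous_on_product_coordinates)

lemma smooth_algebra_partial:
  assumes "f \<in> smooth_algebra"
  shows "partial i f \<in> smooth_algebra"
proof -
  obtain f' where f': "f' \<in> smooth_algebra"
    "\<And>x. ((\<lambda>h. f (x(i := h))) has_real_derivative f' x) (at (x i))"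
    using smooth_algebra_derivative[OF assms] by blast
  have "partial i f = f'"
    unfolding partial_def by (rule ext, rule DERIV_imp_deriv, rule f'(2))
  with f' show ?thesis by simp
qed

lemma Euclidean_space_eq_top_of_set: "Euclidean_space d = top_of_set {x. \<forall>i\<ge>d. x i = 0}"
  by (simp add: Euclidean_space_def euclidean_product_topology)

lemma smooth_algebra_smooth:
  assumes "f \<in> smooth_algebra"
  shows "smooth d f"
  unfolding smooth_def
proof (intro allI impI conjI ballI)
  fix l :: "nat list"
  have mem: "foldr partial l f \<in> smooth_algebra"
    by (induction l) (simp_all add: assms smooth_algebra_partial)
  show "continuous_map (Euclidean_space d) euclideanreal (foldr partial l f)"
    using continuous_on_subset[OF smooth_algebra_continuous[OF mem]]
    by (auto simp: Euclidean_space_eq_top_of_set)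
  fix i x
  obtain f' where "\<And>x. ((\<lambda>h. foldr partial l f (x(i := h))) has_real_derivative f' x) (at (x i))"
    using smooth_algebra_derivative[OF mem] by blast
  then show "(\<lambda>h. foldr partial l f (x(i := h))) differentiable at (x i)"
    unfolding real_differentiable_def by blast
qed

section \<open>Ray coordinates in the plane\<close>

text \<open>Stated for bounded measurable derivatives because the integrands below contain
  \<open>width'\<close>, which has no limit at \<open>s = 0\<close>. The gauge-integral form of the
  fundamental theorem gives the value, boundedness gives Lebesgue integrability.\<close>

lemma LINT_deriv:
  fixes f f' :: "real \<Rightarrow> real"
  assumes ab: "a \<le> b" and cont: "continuous_on {a..b} f"
    and deriv: "\<And>x. x \<in> {a<..<b} \<Longrightarrow> (f has_real_derivative f' x) (at x)"
    and meas: "set_borel_measurable lborel {a..b} f'"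
    and bdd: "\<And>x. x \<in> {a..b} \<Longrightarrow> \<bar>f' x\<bar> \<le> B"
  shows "set_integrable lborel {a..b} f'" "(LINT x:{a..b}|lborel. f' x) = f b - f a"
proof -
  show int: "set_integrable lborel {a..b} f'"
    unfolding set_integrable_def
    by (rule integrableI_bounded_set[where A = "{a..b}" and B = B])
      (use meas bdd in \<open>auto simp: set_borel_measurable_def emeasure_lborel_Icc_eq split: split_indicator\<close>)
  have "(f' has_integral (f b - f a)) {a..b}"
    by (rule fundamental_theorem_of_calculus_interior[OF ab cont])
      (use deriv in \<open>simp add: has_real_derivative_iff_has_vector_derivative\<close>)
  then show "(LINT x:{a..b}|lborel. f' x) = f b - f a"
    using set_borel_integral_eq_integral(2)[OF int] by (simp add: integral_unique)
qed

section \<open>Coordinates and Lebesgue measure in the plane\<close>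

definition pt :: "real \<Rightarrow> real \<Rightarrow> point"
  where "pt x y = (\<lambda>i. if i = 0 then x else if i = 1 then y else 0)"

lemma pt_simps [simp]: "pt x y 0 = x" "pt x y (Suc 0) = y" "i \<ge> 2 \<Longrightarrow> pt x y i = 0"
  by (auto simp: pt_def)

lemma Rn2_iff: "P \<in> Rn 2 \<longleftrightarrow> P = pt (P 0) (P 1)"
proof
  assume "P \<in> Rn 2"
  then have z: "P i = 0" if "i \<ge> 2" for i
    using that by (simp add: topspace_Euclidean_space)
  show "P = pt (P 0) (P 1)"
  proof
    fix i :: nat
    show "P i = pt (P 0) (P 1) i"
      using z[of i] by (cases "i \<ge> 2") (auto simp: pt_def less_2_cases_iff not_le)
  qed
next
  assume "P = pt (P 0) (P 1)"
  then have "P i = 0" if "i \<ge> 2" for i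
    using that by (metis pt_simps(3))
  then show "P \<in> Rn 2"
    by (simp add: topspace_Euclidean_space)
qed

lemma pt_in_Rn2 [simp]: "pt x y \<in> Rn 2"
  by (simp add: topspace_Euclidean_space)

lemma pt_eq_iff [simp]: "pt x y = pt x' y' \<longleftrightarrow> x = x' \<and> y = y'"
  by (metis pt_simps(1,2))

lemma pt_update: "(pt x y)(0 := h) = pt h y" "(pt x y)(Suc 0 := h) = pt x h"
  by (auto simp: pt_def)

lemma continuous_on_pt [continuous_intros]:
  assumes "continuous_on S f" "continuous_on S g"
  shows "continuous_on S (\<lambda>z. pt (f z) (g z))"
proof (rule continuous_on_coordinatewise_then_product)
  fix i :: nat
  show "continuous_on S (\<lambda>z. pt (f z) (g z) i)"
    unfolding pt_def using assms by (cases "i = 0"; cases "i = 1") auto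
qed

lemma closed_Rn: "closed (Rn d)"
  using closedin_Euclidean_space_iff[of d "Rn d"] by auto

lemma nn_integral_leb2:
  assumes [measurable]: "f \<in> borel_measurable (leb 2)"
  shows "(\<integral>\<^sup>+ P. f P \<partial>leb 2) = (\<integral>\<^sup>+ x. \<integral>\<^sup>+ y. f (pt x y) \<partial>lborel \<partial>lborel)"
proof -
  interpret product_sigma_finite "\<lambda>_::nat. lborel :: real measure" ..
  let ?e = "\<lambda>(x::point) i. if i < 2 then x i else (0::real)"
  have f': "f \<in> borel_measurable (restrict_space borel (Rn 2))"
    using assms by (simp add: leb_def)
  have m: "(\<lambda>x. f (?e x)) \<in> borel_measurable (\<Pi>\<^sub>M i\<in>{..<2}. lborel)"
    by (rule measurable_compose[OF measurable_extend_zero f'])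
  have two: "{..<2::nat} = insert 0 {1}" by auto
  have m2: "(\<lambda>x. f (?e (x(0 := t)))) \<in> borel_measurable (\<Pi>\<^sub>M i\<in>{1}. lborel)" for t
  proof (rule measurable_compose[OF _ m])
    show "(\<lambda>x. x(0 := t)) \<in> measurable (\<Pi>\<^sub>M i\<in>{1}. lborel) (\<Pi>\<^sub>M i\<in>{..<2::nat}. (lborel :: real measure))"
      unfolding two by measurable
  qed
  have "(\<integral>\<^sup>+ P. f P \<partial>leb 2) = (\<integral>\<^sup>+ x. f (?e x) \<partial>(\<Pi>\<^sub>M i\<in>{..<2}. lborel))"
    unfolding leb_def by (rule nn_integral_distr[OF measurable_extend_zero assms[unfolded leb_def]])
  also have "\<dots> = (\<integral>\<^sup>+ t. \<integral>\<^sup>+ x. f (?e (x(0 := t))) \<partial>(\<Pi>\<^sub>M i\<in>{1}. lborel) \<partial>lborel)"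
    unfolding two using m unfolding two by (intro product_nn_integral_insert_rev) auto
  also have "\<dots> = (\<integral>\<^sup>+ t. \<integral>\<^sup>+ y. \<integral>\<^sup>+ x. f (?e (x(1 := y, 0 := t))) \<partial>(\<Pi>\<^sub>M i\<in>{}. lborel) \<partial>lborel \<partial>lborel)"
    using m2 by (intro nn_integral_cong product_nn_integral_insert_rev) auto
  also have "\<dots> = (\<integral>\<^sup>+ x. \<integral>\<^sup>+ y. f (pt x y) \<partial>lborel \<partial>lborel)"
  proof (intro nn_integral_cong)
    fix t y :: real
    \<comment> \<open>The product over the empty index set is counting measure on the single
      function \<open>\<lambda>_. undefined\<close>; after the two updates, truncation to indices
      below 2 leaves the planar point.\<close>
    have "?e ((\<lambda>_. undefined)(1 := y, 0 := t)) = pt t y"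
      by (auto simp: pt_def fun_eq_iff)
    then show "(\<integral>\<^sup>+ x. f (?e (x(1 := y, 0 := t))) \<partial>(\<Pi>\<^sub>M i\<in>{}. lborel)) = f (pt t y)"
      by (simp only: PiM_empty) (simp add: nn_integral_count_space_finite)
  qed
  finally show ?thesis .
qed

section \<open>Geometry of a fan of rays\<close>

locale fan =
  fixes A a :: "real \<Rightarrow> real"
  assumes A_deriv: "\<And>s. (A has_real_derivative a s) (at s)"
    and a_cont: "continuous_on UNIV a"
    and a_pos: "\<And>s. 0 < s \<Longrightarrow> 0 < a s"
    and a_0: "a 0 = 0" and A_0: "A 0 = 0"
begin

definition K :: "(real \<times> real) set" where "K = {0..1} \<times> {0..2}"

definition \<Phi> :: "real \<times> real \<Rightarrow> point"
  where "\<Phi> z = pt (snd z) (A (fst z) + snd z * fst z)"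

text \<open>The Jacobian of \<open>\<Phi>\<close>: since \<open>\<Phi>\<close> keeps the abscissa,
  it is the derivative of the height of the ray in \<open>s\<close> at fixed \<open>x\<close>. On
  \<open>K\<close> it vanishes only at \<open>(0, 0)\<close>, the corner where the oscillations will
  accumulate.\<close>

definition dil :: "real \<times> real \<Rightarrow> real" where "dil z = a (fst z) + snd z"

definition \<Omega> :: "point set" where "\<Omega> = \<Phi> ` K"

definition \<Psi> :: "point \<Rightarrow> real \<times> real" where "\<Psi> = inv_into K \<Phi>"

lemma a_nonneg: "0 \<le> s \<Longrightarrow> 0 \<le> a s"
  using a_pos[of s] a_0 by (cases "s = 0") auto

lemma dil_nonneg: "z \<in> K \<Longrightarrow> 0 \<le> dil z"
  unfolding dil_def by (intro add_nonneg_nonneg a_nonneg) (auto simp: K_def)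

lemma dil_pos: "0 \<le> s \<Longrightarrow> 0 \<le> x \<Longrightarrow> (s, x) \<noteq> (0, 0) \<Longrightarrow> 0 < dil (s, x)"
  using a_nonneg[of s] a_pos[of s] by (cases "s = 0") (auto simp: dil_def)

lemma continuous_on_A [continuous_intros]:
  "continuous_on S f \<Longrightarrow> continuous_on S (\<lambda>x. A (f x))"
  by (rule continuous_on_compose2[OF DERIV_continuous_on[OF has_field_derivative_at_within[OF A_deriv]], of S f UNIV])
    auto

lemma continuous_on_a [continuous_intros]:
  "continuous_on S f \<Longrightarrow> continuous_on S (\<lambda>x. a (f x))"
  by (rule continuous_on_compose2[OF a_cont]) auto

lemma continuous_on_dil: "continuous_on S dil"
  unfolding dil_def by (intro continuous_intros)

lemma measurable_a [measurable]: "a \<in> borel_measurable borel"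
  using a_cont by (rule borel_measurable_continuous_onI)

lemma measurable_dil [measurable]: "dil \<in> borel_measurable borel"
  by (rule borel_measurable_continuous_onI) (rule continuous_on_dil)

lemma continuous_on_Phi: "continuous_on S \<Phi>"
  unfolding \<Phi>_def by (intro continuous_intros)

lemma ray_deriv: "((\<lambda>s. A s + x * s) has_real_derivative dil (s, x)) (at s)"
  unfolding dil_def by (auto intro!: derivative_eq_intros A_deriv)

lemma ray_strict_mono:
  assumes "0 \<le> s" "s < t" "0 \<le> x"
  shows "A s + x * s < A t + x * t"
proof (rule DERIV_pos_imp_increasing_open[OF assms(2)])
  fix r assume "s < r" "r < t"
  then have "0 < dil (r, x)"
    using assms by (intro dil_pos) auto
  then show "\<exists>y. ((\<lambda>s. A s + x * s) has_real_derivative y) (at r) \<and> 0 < y"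
    using ray_deriv by blast
qed (intro continuous_intros)

lemma ray_mono:
  assumes "0 \<le> s" "s \<le> t" "0 \<le> x"
  shows "A s + x * s \<le> A t + x * t"
  using ray_strict_mono[of s t x] assms by (cases "s = t") auto

lemma ray_le_iff:
  assumes "0 \<le> s" "0 \<le> t" "0 \<le> x"
  shows "A s + x * s \<le> A t + x * t \<longleftrightarrow> s \<le> t"
  using ray_strict_mono[of t s x] ray_mono[of s t x] assms by (meson leD leI)

lemma ray_less_iff:
  assumes "0 \<le> s" "0 \<le> t" "0 \<le> x"
  shows "A s + x * s < A t + x * t \<longleftrightarrow> s < t"
  using ray_le_iff[of t s x] assms by linarith

lemma inj_on_Phi: "inj_on \<Phi> K"
proof (rule inj_onI)
  fix z z' assume *: "z \<in> K" "z' \<in> K" "\<Phi> z = \<Phi> z'"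
  then have "snd z = snd z'" "A (fst z) + snd z * fst z = A (fst z') + snd z * fst z'"
    by (auto simp: \<Phi>_def)
  moreover from this have "fst z = fst z'"
    using ray_strict_mono[of "fst z" "fst z'" "snd z"] ray_strict_mono[of "fst z'" "fst z" "snd z"] *
    by (cases "fst z" "fst z'" rule: linorder_cases) (auto simp: K_def)
  ultimately show "z = z'" by (simp add: prod_eq_iff)
qed

lemma Psi_Phi [simp]: "z \<in> K \<Longrightarrow> \<Psi> (\<Phi> z) = z"
  by (simp add: \<Psi>_def inv_into_f_f inj_on_Phi)

lemma Phi_Psi [simp]: "P \<in> \<Omega> \<Longrightarrow> \<Phi> (\<Psi> P) = P"
  by (simp add: \<Psi>_def \<Omega>_def f_inv_into_f)

lemma Psi_in_K: "P \<in> \<Omega> \<Longrightarrow> \<Psi> P \<in> K"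
  by (simp add: \<Psi>_def \<Omega>_def inv_into_into)

lemma compact_K: "compact K"
  by (simp add: K_def compact_Times)

lemma compact_Omega: "compact \<Omega>"
  unfolding \<Omega>_def by (intro compact_continuous_image continuous_on_Phi compact_K)

lemma closed_Omega: "closed \<Omega>"
  using compact_Omega by (rule compact_imp_closed)

lemma continuous_on_Psi: "continuous_on \<Omega> \<Psi>"
  unfolding \<Omega>_def by (rule continuous_on_inv) (auto intro: continuous_on_Phi compact_K)

lemma Omega_subset: "\<Omega> \<subseteq> Rn 2"
  by (auto simp: \<Omega>_def \<Phi>_def)

lemma ray_between:
  assumes "0 \<le> x" "0 \<le> y" "y \<le> A 1 + x"
  obtains s where "0 \<le> s" "s \<le> 1" "y = A s + x * s"
proof -
  have "\<exists>s\<ge>0. s \<le> 1 \<and> A s + x * s = y"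
    by (rule IVT') (use assms A_0 in \<open>auto intro!: continuous_intros\<close>)
  then show ?thesis using that by blast
qed

text \<open>At each abscissa the ray heights sweep continuously and monotonically from 0 to
  \<open>A 1 + x\<close>, so \<open>\<Omega>\<close> is a trapezoid although it is parametrized by
  curved coordinates. Convexity and the interior are read off from this.\<close>

lemma Omega_iff: "P \<in> \<Omega> \<longleftrightarrow> P \<in> Rn 2 \<and> 0 \<le> P 0 \<and> P 0 \<le> 2 \<and> 0 \<le> P 1 \<and> P 1 \<le> A 1 + P 0"
proof
  assume "P \<in> \<Omega>"
  then obtain s x where sx: "(s, x) \<in> K" "P = \<Phi> (s, x)"
    by (auto simp: \<Omega>_def)
  then show "P \<in> Rn 2 \<and> 0 \<le> P 0 \<and> P 0 \<le> 2 \<and> 0 \<le> P 1 \<and> P 1 \<le> A 1 + P 0"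
    using ray_mono[of 0 s x] ray_mono[of s 1 x] A_0 by (auto simp: K_def \<Phi>_def)
next
  assume *: "P \<in> Rn 2 \<and> 0 \<le> P 0 \<and> P 0 \<le> 2 \<and> 0 \<le> P 1 \<and> P 1 \<le> A 1 + P 0"
  then obtain s where "0 \<le> s" "s \<le> 1" "P 1 = A s + P 0 * s"
    using ray_between[of "P 0" "P 1"] by blast
  then have "(s, P 0) \<in> K" "P = \<Phi> (s, P 0)"
    using * Rn2_iff[of P] by (auto simp: K_def \<Phi>_def)
  then show "P \<in> \<Omega>" by (auto simp: \<Omega>_def)
qed

lemma convex_Omega: "convex_set \<Omega>"
  unfolding convex_set_def
proof (intro ballI)
  fix P Q and t :: real assume P: "P \<in> \<Omega>" and Q: "Q \<in> \<Omega>" and t: "t \<in> {0..1}"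
  let ?c = "\<lambda>u v. (1 - t) * u + t * v :: real"
  have mono: "?c u v \<le> ?c u' v'" if "u \<le> u'" "v \<le> v'" for u v u' v'
    using t that by (intro add_mono mult_left_mono) auto
  have c: "?c u u = u" for u by (simp add: algebra_simps)
  have "?c (P 1) (Q 1) \<le> ?c (A 1 + P 0) (A 1 + Q 0)"
    using P Q by (intro mono) (auto simp: Omega_iff)
  also have "\<dots> = A 1 + ?c (P 0) (Q 0)" by (simp add: algebra_simps)
  finally show "segment_point P Q t \<in> \<Omega>"
    using P Q mono[of 0 "P 0" 0 "Q 0"] mono[of "P 0" 2 "Q 0" 2] mono[of 0 "P 1" 0 "Q 1"] c[of 2]
    by (auto simp: Omega_iff segment_point_def topspace_Euclidean_space)
qed

definition U :: "point set" where "U = Euclidean_space 2 interior_of \<Omega>"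

text \<open>An interior point can be moved a little in both directions along both axes without
  leaving \<open>\<Omega>\<close>, which makes each inequality of the trapezoid strict; the converse
  inclusion is openness of strict inequalities.\<close>

lemma U_eq: "U = {P \<in> Rn 2. 0 < P 0 \<and> P 0 < 2 \<and> 0 < P 1 \<and> P 1 < A 1 + P 0}" (is "_ = ?V")
proof -
  have op: "openin (Euclidean_space 2) ?V"
  proof -
    have "open {P :: point. 0 < P 0 \<and> P 0 < 2 \<and> 0 < P 1 \<and> P 1 < A 1 + P 0}"
      by (intro open_Collect_conj open_Collect_less continuous_intros continuous_on_product_coordinates)
    then have "openin (top_of_set (Rn 2)) (Rn 2 \<inter> {P :: point. 0 < P 0 \<and> P 0 < 2 \<and> 0 < P 1 \<and> P 1 < A 1 + P 0})"
      by (rule openin_open_Int)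
    also have "Rn 2 \<inter> {P :: point. 0 < P 0 \<and> P 0 < 2 \<and> 0 < P 1 \<and> P 1 < A 1 + P 0} = ?V" by auto
    finally show ?thesis
      by (simp add: Euclidean_space_eq_top_of_set[of 2] topspace_Euclidean_space)
  qed
  have "?V \<subseteq> U"
    unfolding U_def by (rule interior_of_maximal[OF _ op]) (auto simp: Omega_iff)
  moreover have "P \<in> ?V" if "P \<in> U" for P
  proof -
    have "openin (Euclidean_space 2) U" "U \<subseteq> \<Omega>"
      by (auto simp: U_def interior_of_subset)
    then obtain T where T: "open T" "U = Rn 2 \<inter> T"
      by (auto simp: Euclidean_space_eq_top_of_set[of 2] topspace_Euclidean_space openin_open)
    have PO: "P \<in> \<Omega>" using that \<open>U \<subseteq> \<Omega>\<close> by auto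
    have near: "\<exists>\<delta>>0. \<forall>e. \<bar>e\<bar> \<le> \<delta> \<longrightarrow> pt (P 0 + e * c) (P 1 + e * d) \<in> \<Omega>" for c d
    proof -
      let ?g = "\<lambda>e::real. pt (P 0 + e * c) (P 1 + e * d)"
      have "open (?g -` T)"
        by (rule open_vimage[OF T(1)]) (intro continuous_intros)
      moreover have "0 \<in> ?g -` T"
        using that PO T(2) Rn2_iff[of P] Omega_subset by auto
      ultimately obtain \<delta> where "\<delta> > 0" "cball 0 \<delta> \<subseteq> ?g -` T"
        by (meson open_contains_cball)
      then show ?thesis
        using T(2) \<open>U \<subseteq> \<Omega>\<close> by (intro exI[of _ \<delta>]) (auto simp: subset_iff mem_cball dist_real_def)
    qed
    obtain \<delta> where \<delta>: "\<delta> > 0" "\<And>e. \<bar>e\<bar> \<le> \<delta> \<Longrightarrow> pt (P 0 + e) (P 1) \<in> \<Omega>"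
      using near[of 1 0] by auto
    obtain \<delta>' where \<delta>': "\<delta>' > 0" "\<And>e. \<bar>e\<bar> \<le> \<delta>' \<Longrightarrow> pt (P 0) (P 1 + e) \<in> \<Omega>"
      using near[of 0 1] by auto
    have "0 < P 0" "P 0 < 2" "0 < P 1" "P 1 < A 1 + P 0"
      using \<delta>(1) \<delta>'(1) \<delta>(2)[of \<delta>] \<delta>(2)[of "- \<delta>"] \<delta>'(2)[of \<delta>'] \<delta>'(2)[of "- \<delta>'"]
      by (auto simp: Omega_iff)
    then show ?thesis using PO Omega_subset by auto
  qed
  ultimately show ?thesis by blast
qed

lemma U_subset: "U \<subseteq> \<Omega>"
  by (simp add: U_def interior_of_subset)

lemma Phi_in_U_iff:
  assumes "(s, x) \<in> K"
  shows "\<Phi> (s, x) \<in> U \<longleftrightarrow> 0 < s \<and> s < 1 \<and> 0 < x \<and> x < 2"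
  using assms ray_less_iff[of 0 s x] ray_less_iff[of s 1 x] A_0
  by (auto simp: U_eq \<Phi>_def K_def)

lemma U_nonempty: "U \<noteq> {}"
  using Phi_in_U_iff[of "1/2" 1] by (auto simp: K_def)

lemma openin_U: "openin (Euclidean_space 2) U"
  by (simp add: U_def)

section \<open>Change of variables to ray coordinates\<close>

definition leb\<Omega> :: "point measure" where "leb\<Omega> = restrict_space (leb 2) \<Omega>"

definition lebK :: "(real \<times> real) measure"
  where "lebK = density (restrict_space lborel K) (\<lambda>z. ennreal (dil z))"

lemma Omega_sets [measurable]: "\<Omega> \<in> sets (leb 2)"
  using closed_Omega Omega_subset closed_Rn
  by (auto simp: sets_leb sets_restrict_space intro!: image_eqI[of _ _ \<Omega>])

lemma space_leb [simp]: "space (leb d) = Rn d"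
  by (simp add: leb_def space_restrict_space)

lemma sets_leb_Omega: "sets leb\<Omega> = sets (restrict_space borel \<Omega>)"
proof -
  have "\<Omega> \<inter> Rn 2 = \<Omega>" using Omega_subset by auto
  have "sets leb\<Omega> = sets (restrict_space (restrict_space borel (Rn 2)) \<Omega>)"
    unfolding leb\<Omega>_def by (rule sets_restrict_space_cong[OF sets_leb])
  also have "\<dots> = sets (restrict_space borel (Rn 2 \<inter> \<Omega>))"
    using closed_Rn by (subst sets_restrict_restrict_space) simp
  also have "Rn 2 \<inter> \<Omega> = \<Omega>" using Omega_subset by auto
  finally show ?thesis .
qed

lemma space_leb_Omega [simp]: "space leb\<Omega> = \<Omega>"
  using Omega_subset by (auto simp: leb\<Omega>_def space_restrict_space)

lemma K_sets [measurable]: "K \<in> sets borel"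
  using compact_K by (simp add: borel_closed compact_imp_closed)

lemma measurable_Phi [measurable]: "\<Phi> \<in> measurable (restrict_space borel K) (restrict_space borel \<Omega>)"
  by (rule measurable_restrict_space3[where f = \<Phi>, simplified])
    (auto simp: \<Omega>_def intro!: borel_measurable_continuous_onI continuous_on_Phi)

lemma measurable_Psi [measurable]: "\<Psi> \<in> measurable (restrict_space borel \<Omega>) (restrict_space borel K)"
  by (rule measurable_restrict_space2)
    (auto simp: Psi_in_K space_restrict_space intro!: borel_measurable_continuous_on_restrict continuous_on_Psi)

text \<open>\<open>\<Phi>\<close> preserves vertical lines, so Fubini reduces the planar change of
  variables to the substitution \<open>y = A s + x * s\<close> on each line, whose derivative
  \<open>dil\<close> is continuous and nonnegative.\<close>

lemma nn_integral_leb_Omega: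
  assumes g: "g \<in> borel_measurable (restrict_space borel \<Omega>)"
  shows "(\<integral>\<^sup>+ P. g P \<partial>leb\<Omega>) = (\<integral>\<^sup>+ z. g (\<Phi> z) \<partial>lebK)"
proof -
  have gm: "g \<in> borel_measurable (restrict_space (leb 2) \<Omega>)"
    using g measurable_cong_sets[OF sets_leb_Omega refl] by (auto simp: leb\<Omega>_def)
  have [measurable]: "(\<lambda>P. g P * indicator \<Omega> P) \<in> borel_measurable (leb 2)"
    using gm Omega_sets Omega_subset
    by (subst borel_measurable_restrict_space_iff_ennreal[symmetric]) (auto simp: Int_absorb2)
  have pt_m: "(\<lambda>z. pt (fst z) (snd z)) \<in> measurable (lborel \<Otimes>\<^sub>M lborel) (leb 2)"
  proof -
    have "(\<lambda>z. pt (fst z) (snd z)) \<in> measurable borel (restrict_space borel (Rn 2))"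
      by (rule measurable_restrict_space2[OF _ borel_measurable_continuous_onI
            [OF continuous_on_pt[OF continuous_on_fst[OF continuous_on_id] continuous_on_snd[OF continuous_on_id]]]])
        auto
    moreover have "sets (lborel \<Otimes>\<^sub>M lborel) = sets (borel :: (real \<times> real) measure)"
      by (simp only: lborel_prod sets_lborel)
    ultimately show ?thesis
      by (subst measurable_cong_sets[OF _ sets_leb]) auto
  qed
  have pt_m2: "(\<lambda>y. pt x y) \<in> measurable borel (leb 2)" for x
    using measurable_compose[OF measurable_Pair1' pt_m, of x] by (simp add: )
  have gK: "(\<lambda>z. g (\<Phi> z) * indicator K z) \<in> borel_measurable borel"
    by (subst borel_measurable_restrict_space_iff_ennreal[symmetric])
      (auto intro: measurable_compose[OF measurable_Phi g])
  have gmK: "(\<lambda>z. g (\<Phi> z)) \<in> borel_measurable (restrict_space lborel K)"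
    using measurable_compose[OF measurable_Phi g]
      measurable_cong_sets[OF sets_restrict_space_cong[OF sets_lborel] refl] by blast
  let ?h = "\<lambda>z. g (\<Phi> z) * indicator K z * ennreal (dil z)"
  have inner: "(\<integral>\<^sup>+ y. g (pt x y) * indicator \<Omega> (pt x y) \<partial>lborel) = (\<integral>\<^sup>+ s. ?h (s, x) \<partial>lborel)" for x
  proof (cases "x \<in> {0..2}")
    case True
    have "(\<integral>\<^sup>+ y. g (pt x y) * indicator \<Omega> (pt x y) \<partial>lborel)
        = (\<integral>\<^sup>+ y. (g (pt x y) * indicator \<Omega> (pt x y)) * indicator {A 0 + x * 0..A 1 + x * 1} y \<partial>lborel)"
      using True A_0 by (intro nn_integral_cong) (auto simp: Omega_iff split: split_indicator)
    also have "\<dots> = (\<integral>\<^sup>+ s. (g (pt x (A s + x * s)) * indicator \<Omega> (pt x (A s + x * s))) * ennreal (dil (s, x))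
        * indicator {0..1} s \<partial>lborel)"
    proof (rule nn_integral_substitution_aux)
      show "(\<lambda>y. g (pt x y) * indicator \<Omega> (pt x y)) \<in> borel_measurable borel"
        using measurable_compose[OF pt_m2[of x], of "\<lambda>P. g P * indicator \<Omega> P" borel] by simp
      show "continuous_on {0..1} (\<lambda>s. dil (s, x))"
        unfolding dil_def by (simp, intro continuous_intros)
      show "0 \<le> dil (s, x)" if "s \<in> {0..1}" for s
        using that True by (intro dil_nonneg) (auto simp: K_def)
    qed (use ray_deriv in auto)
    also have "\<dots> = (\<integral>\<^sup>+ s. ?h (s, x) \<partial>lborel)"
      using True
      by (intro nn_integral_cong) (auto simp: \<Omega>_def \<Phi>_def K_def image_iff split: split_indicator)
    finally show ?thesis .
  next
    case False
    then show ?thesis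
      by (intro nn_integral_cong) (auto simp: Omega_iff K_def split: split_indicator)
  qed
  have "(\<integral>\<^sup>+ P. g P \<partial>leb\<Omega>) = (\<integral>\<^sup>+ P. g P * indicator \<Omega> P \<partial>leb 2)"
    unfolding leb\<Omega>_def by (subst nn_integral_restrict_space) (use Omega_subset in \<open>auto simp: Int_absorb2\<close>)
  also have "\<dots> = (\<integral>\<^sup>+ x. \<integral>\<^sup>+ y. g (pt x y) * indicator \<Omega> (pt x y) \<partial>lborel \<partial>lborel)"
    by (subst nn_integral_leb2) auto
  also have "\<dots> = (\<integral>\<^sup>+ x. \<integral>\<^sup>+ s. ?h (s, x) \<partial>lborel \<partial>lborel)"
    by (simp only: inner)
  also have "\<dots> = (\<integral>\<^sup>+ z. ?h z \<partial>(lborel \<Otimes>\<^sub>M lborel))"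
    by (subst lborel_pair.nn_integral_snd) (use gK in \<open>auto simp: lborel_prod\<close>)
  also have "\<dots> = (\<integral>\<^sup>+ z. g (\<Phi> z) * ennreal (dil z) \<partial>restrict_space lborel K)"
    unfolding lborel_prod by (subst nn_integral_restrict_space) (auto intro!: nn_integral_cong simp: mult_ac)
  also have "\<dots> = (\<integral>\<^sup>+ z. g (\<Phi> z) \<partial>lebK)"
    unfolding lebK_def
    by (subst nn_integral_density) (use gmK in \<open>auto simp: mult_ac intro!: measurable_restrict_space1\<close>)
  finally show ?thesis .
qed

lemma space_lebK [simp]: "space lebK = K"
  by (simp add: lebK_def space_restrict_space)

lemma sets_lebK: "sets lebK = sets (restrict_space borel K)"
  unfolding lebK_def by (simp add: sets_restrict_space_cong[OF sets_lborel])

lemma measurable_lborelK: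
  "h \<in> borel_measurable (restrict_space lborel K) \<longleftrightarrow> h \<in> borel_measurable (restrict_space borel K)"
  by (rule arg_cong[where f = "\<lambda>S. h \<in> S"],
      rule measurable_cong_sets[OF sets_restrict_space_cong[OF sets_lborel] refl])

lemma measurable_leb_Omega:
  "h \<in> borel_measurable leb\<Omega> \<longleftrightarrow> h \<in> borel_measurable (restrict_space borel \<Omega>)"
  by (rule arg_cong[where f = "\<lambda>S. h \<in> S"], rule measurable_cong_sets[OF sets_leb_Omega refl])

lemma measurable_K_continuous: "continuous_on K h \<Longrightarrow> h \<in> borel_measurable (restrict_space borel K)"
  by (rule borel_measurable_continuous_on_restrict)

lemma measurable_Phi_lebK: "\<Phi> \<in> measurable lebK (restrict_space borel \<Omega>)"
  using measurable_Phi measurable_cong_sets[OF sets_lebK refl] by blast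

lemma leb_Omega_eq: "leb\<Omega> = distr lebK (restrict_space borel \<Omega>) \<Phi>"
proof (rule measure_eqI)
  show "sets leb\<Omega> = sets (distr lebK (restrict_space borel \<Omega>) \<Phi>)"
    by (simp add: sets_leb_Omega)
  fix X assume X: "X \<in> sets leb\<Omega>"
  then have X': "X \<in> sets (restrict_space borel \<Omega>)" by (simp add: sets_leb_Omega)
  have "emeasure leb\<Omega> X = (\<integral>\<^sup>+ P. indicator X P \<partial>leb\<Omega>)"
    using X by simp
  also have "\<dots> = (\<integral>\<^sup>+ z. indicator X (\<Phi> z) \<partial>lebK)"
    using X' by (intro nn_integral_leb_Omega) auto
  also have "\<dots> = (\<integral>\<^sup>+ P. indicator X P \<partial>distr lebK (restrict_space borel \<Omega>) \<Phi>)"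
    using X' by (subst nn_integral_distr[OF measurable_Phi_lebK]) auto
  also have "\<dots> = emeasure (distr lebK (restrict_space borel \<Omega>) \<Phi>) X"
    using X' by simp
  finally show "emeasure leb\<Omega> X = emeasure (distr lebK (restrict_space borel \<Omega>) \<Phi>) X" .
qed

lemma integral_lebK:
  fixes h :: "real \<times> real \<Rightarrow> real"
  assumes "h \<in> borel_measurable (restrict_space borel K)"
  shows "(LINT z|lebK. h z) = (LINT z:K|lborel. dil z * h z)"
proof -
  have "(LINT z|lebK. h z) = (LINT z|restrict_space lborel K. dil z * h z)"
    unfolding lebK_def
    by (subst integral_density)
      (use assms dil_nonneg in \<open>auto simp: measurable_lborelK intro!: AE_I2 measurable_restrict_space1 simp: space_restrict_space\<close>)
  also have "\<dots> = (LINT z:K|lborel. dil z * h z)"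
    by (subst integral_restrict_space) (auto simp: set_lebesgue_integral_def)
  finally show ?thesis .
qed

lemma integral_leb_Omega:
  fixes f :: "point \<Rightarrow> real"
  assumes f: "f \<in> borel_measurable (restrict_space borel \<Omega>)"
  shows "(LINT P|leb\<Omega>. f P) = (LINT z:K|lborel. dil z * f (\<Phi> z))"
  unfolding leb_Omega_eq integral_distr[OF measurable_Phi_lebK f]
  by (rule integral_lebK) (rule measurable_compose[OF measurable_Phi f])

lemma set_integral_leb_Omega:
  fixes f :: "point \<Rightarrow> real"
  shows "(LINT P:\<Omega>|leb 2. f P) = (LINT P|leb\<Omega>. f P)"
  unfolding leb\<Omega>_def set_lebesgue_integral_def
  by (subst integral_restrict_space) (auto simp: Int_absorb2 Omega_subset)

lemma set_integrable_leb_Omega: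
  fixes f :: "point \<Rightarrow> real"
  shows "set_integrable (leb 2) \<Omega> f \<longleftrightarrow> integrable leb\<Omega> f"
  unfolding leb\<Omega>_def set_integrable_def
  by (subst integrable_restrict_space) (auto simp: Int_absorb2 Omega_subset)

lemma emeasure_K: "emeasure lborel K < \<infinity>"
  by (rule emeasure_bounded_finite[OF compact_imp_bounded[OF compact_K]])

lemma set_integrable_K:
  fixes h :: "real \<times> real \<Rightarrow> real"
  assumes "h \<in> borel_measurable (restrict_space borel K)" "\<And>z. z \<in> K \<Longrightarrow> \<bar>h z\<bar> \<le> B"
  shows "set_integrable lborel K h"
  unfolding set_integrable_def
proof (rule integrableI_bounded_set[where A = K and B = B])
  show "(\<lambda>z. indicat_real K z *\<^sub>R h z) \<in> borel_measurable lborel"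
    using assms(1) by (subst (asm) borel_measurable_restrict_space_iff) auto
qed (use assms emeasure_K in \<open>auto split: split_indicator\<close>)

lemma dil_bounded: "\<exists>B. \<forall>z\<in>K. \<bar>dil z\<bar> \<le> B"
  using compact_imp_bounded[OF compact_continuous_image[OF continuous_on_dil compact_K]]
  by (auto simp: bounded_iff)

lemma finite_measure_lebK: "finite_measure lebK"
proof
  obtain B where B: "\<And>z. z \<in> K \<Longrightarrow> \<bar>dil z\<bar> \<le> B" using dil_bounded by blast
  have "emeasure lebK (space lebK) = (\<integral>\<^sup>+ z. ennreal (dil z) * indicator K z \<partial>restrict_space lborel K)"
    unfolding space_lebK unfolding lebK_def
    by (subst emeasure_density) (auto intro!: measurable_restrict_space1 simp: sets_restrict_space)
  also have "\<dots> = (\<integral>\<^sup>+ z. ennreal (dil z) * indicator K z \<partial>lborel)"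
    by (subst nn_integral_restrict_space) (auto intro!: nn_integral_cong split: split_indicator)
  also have "\<dots> \<le> (\<integral>\<^sup>+ z. ennreal B * indicator K z \<partial>lborel)"
    using B by (intro nn_integral_mono) (auto split: split_indicator intro!: ennreal_leI dest!: abs_le_D1)
  also have "\<dots> < \<infinity>"
    using emeasure_K by (simp add: nn_integral_cmult_indicator ennreal_mult_less_top)
  finally show "emeasure lebK (space lebK) \<noteq> \<infinity>" by simp
qed

lemma finite_measure_leb_Omega: "finite_measure leb\<Omega>"
  unfolding leb_Omega_eq
  by (rule finite_measure.finite_measure_distr[OF finite_measure_lebK measurable_Phi_lebK])

lemma integrable_leb_Omega:
  fixes f :: "point \<Rightarrow> real"
  assumes "f \<in> borel_measurable (restrict_space borel \<Omega>)" "\<And>P. P \<in> \<Omega> \<Longrightarrow> \<bar>f P\<bar> \<le> B"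
  shows "integrable leb\<Omega> f"
proof -
  interpret finite_measure leb\<Omega> by (rule finite_measure_leb_Omega)
  show ?thesis
    by (rule integrable_const_bound[where B = B]) (use assms in \<open>auto simp: measurable_leb_Omega\<close>)
qed

lemma LINT_K:
  fixes h :: "real \<times> real \<Rightarrow> real"
  assumes "set_integrable lborel K h"
  shows "(LINT z:K|lborel. h z) = (LINT s:{0..1}|lborel. LINT x:{0..2}|lborel. h (s, x))"
    and "(LINT z:K|lborel. h z) = (LINT x:{0..2}|lborel. LINT s:{0..1}|lborel. h (s, x))"
proof -
  have i: "integrable (lborel \<Otimes>\<^sub>M lborel) (\<lambda>z. indicat_real K z *\<^sub>R h z)"
    using assms by (simp add: lborel_prod set_integrable_def)
  have e: "indicat_real K (s, x) = indicator {0..1} s * indicator {0..2} x" for s x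
    by (auto simp: K_def split: split_indicator)
  have "(LINT z:K|lborel. h z) = (LINT s|lborel. LINT x|lborel. indicat_real K (s, x) *\<^sub>R h (s, x))"
    unfolding set_lebesgue_integral_def lborel_prod[symmetric] by (rule lborel_pair.integral_fst'[OF i, symmetric])
  also have "\<dots> = (LINT s:{0..1}|lborel. LINT x:{0..2}|lborel. h (s, x))"
    unfolding set_lebesgue_integral_def by (simp add: e mult.assoc)
  finally show "(LINT z:K|lborel. h z) = (LINT s:{0..1}|lborel. LINT x:{0..2}|lborel. h (s, x))" .
  have "(LINT z:K|lborel. h z) = (LINT x|lborel. LINT s|lborel. indicat_real K (s, x) *\<^sub>R h (s, x))"
    unfolding set_lebesgue_integral_def lborel_prod[symmetric]
    using lborel_pair.integral_snd[of "\<lambda>s x. indicat_real K (s, x) *\<^sub>R h (s, x)"] i by (simp add: case_prod_beta')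
  also have "\<dots> = (LINT x:{0..2}|lborel. LINT s:{0..1}|lborel. h (s, x))"
  proof -
    have "(LINT s|lborel. indicat_real K (s, x) *\<^sub>R h (s, x))
        = (LINT s|lborel. indicat_real {0..2} x * (indicat_real {0..1} s * h (s, x)))" for x
      by (simp add: e mult_ac)
    then show ?thesis
      by (simp add: set_lebesgue_integral_def)
  qed
  finally show "(LINT z:K|lborel. h z) = (LINT x:{0..2}|lborel. LINT s:{0..1}|lborel. h (s, x))" .
qed

lemma measurable_K_sections:
  fixes h :: "real \<times> real \<Rightarrow> real"
  assumes "h \<in> borel_measurable (restrict_space borel K)"
  shows "x \<in> {0..2} \<Longrightarrow> set_borel_measurable lborel {0..1} (\<lambda>s. h (s, x))"
    and "s \<in> {0..1} \<Longrightarrow> set_borel_measurable lborel {0..2} (\<lambda>x. h (s, x))"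
proof -
  have m: "(\<lambda>z. indicat_real K z *\<^sub>R h z) \<in> borel_measurable borel"
    using assms by (subst (asm) borel_measurable_restrict_space_iff) auto
  have p: "(\<lambda>s. (s, x)) \<in> measurable borel borel" "(\<lambda>x. (s, x)) \<in> measurable borel borel" for s x :: real
    by (auto intro!: borel_measurable_continuous_onI continuous_intros)
  show "set_borel_measurable lborel {0..1} (\<lambda>s. h (s, x))" if "x \<in> {0..2}"
    using measurable_compose[OF p(1)[of x] m] that by (simp add: set_borel_measurable_def K_def indicator_times)
  show "set_borel_measurable lborel {0..2} (\<lambda>x. h (s, x))" if "s \<in> {0..1}"
    using measurable_compose[OF p(2)[of s] m] that by (simp add: set_borel_measurable_def K_def indicator_times)
qed

lemma continuous_K_bounded: "continuous_on K (h :: _ \<Rightarrow> real) \<Longrightarrow> \<exists>B. \<forall>z\<in>K. \<bar>h z\<bar> \<le> B"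
  using compact_imp_bounded[OF compact_continuous_image[OF _ compact_K]] by (fastforce simp: bounded_iff)

lemma measurable_comp_Psi:
  fixes F :: "real \<times> real \<Rightarrow> real"
  assumes "F \<in> borel_measurable (restrict_space borel K)"
  shows "(\<lambda>P. F (\<Psi> P)) \<in> borel_measurable (restrict_space borel \<Omega>)"
  by (rule measurable_compose[OF measurable_Psi assms])

lemma U_sets: "U \<in> sets (leb 2)"
proof -
  obtain T where "open T" "U = Rn 2 \<inter> T"
    using openin_U by (auto simp: Euclidean_space_eq_top_of_set[of 2] topspace_Euclidean_space openin_open)
  then show ?thesis
    by (auto simp: sets_leb sets_restrict_space intro!: image_eqI[of _ _ T])
qed

lemma bounded_in_Lp:
  fixes f :: "point \<Rightarrow> real"
  assumes f: "f \<in> borel_measurable (restrict_space borel \<Omega>)"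
    and B: "\<And>P. P \<in> \<Omega> \<Longrightarrow> \<bar>f P\<bar> \<le> B" and p: "0 \<le> p"
  shows "f \<in> Lp 2 U p"
proof -
  have f': "f \<in> borel_measurable (restrict_space (leb 2) \<Omega>)"
    using f measurable_leb_Omega[of f] unfolding leb\<Omega>_def by blast
  have m: "(\<lambda>P. indicat_real U P *\<^sub>R g P) \<in> borel_measurable (leb 2)"
    if "g \<in> borel_measurable (restrict_space (leb 2) \<Omega>)" for g :: "point \<Rightarrow> real"
  proof -
    have "(\<lambda>P. indicat_real \<Omega> P *\<^sub>R g P) \<in> borel_measurable (leb 2)"
      using that by (subst (asm) borel_measurable_restrict_space_iff) (auto simp: Int_absorb2 Omega_subset)
    then have "(\<lambda>P. indicat_real U P *\<^sub>R (indicat_real \<Omega> P *\<^sub>R g P)) \<in> borel_measurable (leb 2)"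
      using U_sets by measurable
    also have "(\<lambda>P. indicat_real U P *\<^sub>R (indicat_real \<Omega> P *\<^sub>R g P)) = (\<lambda>P. indicat_real U P *\<^sub>R g P)"
      using U_subset by (auto simp: fun_eq_iff split: split_indicator)
    finally show ?thesis .
  qed
  have fin: "emeasure (leb 2) U < \<infinity>"
  proof -
    have "emeasure (leb 2) U \<le> emeasure (leb 2) \<Omega>"
      by (rule emeasure_mono[OF U_subset]) simp
    also have "\<dots> = emeasure leb\<Omega> \<Omega>"
      unfolding leb\<Omega>_def by (subst emeasure_restrict_space) (auto simp: Int_absorb2 Omega_subset)
    also have "\<dots> < \<infinity>"
      using finite_measure.emeasure_finite[OF finite_measure_leb_Omega, of \<Omega>] by (simp add: top.not_eq_extremum)
    finally show ?thesis .
  qed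
  have "set_integrable (leb 2) U (\<lambda>P. \<bar>f P\<bar> powr p)"
    unfolding set_integrable_def
  proof (rule integrableI_bounded_set[where A = U and B = "B powr p"])
    show "(\<lambda>P. indicat_real U P *\<^sub>R \<bar>f P\<bar> powr p) \<in> borel_measurable (leb 2)"
      using f' by (intro m) measurable
    show "AE P in leb 2. P \<in> U \<longrightarrow> norm (indicat_real U P *\<^sub>R \<bar>f P\<bar> powr p) \<le> B powr p"
      using B U_subset p by (intro AE_I2) (auto intro!: powr_mono2)
  qed (use U_sets fin in \<open>auto split: split_indicator\<close>)
  then show ?thesis
    using m[OF f'] by (simp add: Lp_def set_borel_measurable_def)
qed

lemma test_function_props:
  assumes "\<phi> \<in> test_functions 2 U"
  shows "continuous_on (Rn 2) \<phi>" "i < 2 \<Longrightarrow> continuous_on (Rn 2) (partial i \<phi>)"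
    and "((\<lambda>h. \<phi> (pt h y)) has_real_derivative partial 0 \<phi> (pt x y)) (at x)"
    and "((\<lambda>h. \<phi> (pt x h)) has_real_derivative partial 1 \<phi> (pt x y)) (at y)"
    and "P \<in> Rn 2 - U \<Longrightarrow> \<phi> P = 0" "i < 2 \<Longrightarrow> P \<in> Rn 2 - U \<Longrightarrow> partial i \<phi> P = 0"
proof -
  have sm: "smooth 2 \<phi>" and cl: "Euclidean_space 2 closure_of {x \<in> Rn 2. \<phi> x \<noteq> 0} \<subseteq> U"
    using assms by (auto simp: test_functions_def)
  have top: "top_of_set (Rn 2) = Euclidean_space 2"
    by (simp add: Euclidean_space_eq_top_of_set topspace_Euclidean_space)
  have cm: "continuous_map (Euclidean_space 2) euclideanreal f \<longleftrightarrow> continuous_on (Rn 2) f" for f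
    using continuous_map_iff_continuous[of "Rn 2" f] unfolding top by simp
  show c: "continuous_on (Rn 2) \<phi>"
    using sm[unfolded smooth_def, rule_format, of "[]"] by (simp add: cm)
  show c': "continuous_on (Rn 2) (partial i \<phi>)" if "i < 2" for i
    using sm[unfolded smooth_def, rule_format, of "[i]"] that by (simp add: cm)
  have d: "(\<lambda>h. \<phi> (P(i := h))) differentiable at (P i)" if "i < 2" "P \<in> Rn 2" for i P
    using sm[unfolded smooth_def, rule_format, of "[]"] that by simp
  have d': "((\<lambda>h. \<phi> (P(i := h))) has_real_derivative partial i \<phi> P) (at (P i))" if "i < 2" "P \<in> Rn 2" for i P
    using d[OF that] unfolding partial_def
    by (metis DERIV_deriv_iff_real_differentiable)
  show "((\<lambda>h. \<phi> (pt h y)) has_real_derivative partial 0 \<phi> (pt x y)) (at x)"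
    using d'[of 0 "pt x y"] by (simp add: pt_update)
  show "((\<lambda>h. \<phi> (pt x h)) has_real_derivative partial 1 \<phi> (pt x y)) (at y)"
    using d'[of 1 "pt x y"] by (simp add: pt_update)
  show z: "\<phi> P = 0" if "P \<in> Rn 2 - U" for P
    using cl closure_of_subset[of "{x \<in> Rn 2. \<phi> x \<noteq> 0}" "Euclidean_space 2"] that by auto
  show "partial i \<phi> P = 0" if i: "i < 2" and P: "P \<in> Rn 2 - U" for i P
  proof -
    \<comment> \<open>Off the closed support the function vanishes near \<open>P\<close> on the
      coordinate line, which forces its derivative there to be 0.\<close>
    let ?C = "Euclidean_space 2 closure_of {x \<in> Rn 2. \<phi> x \<noteq> 0}"
    have "closed ?C" "?C \<subseteq> Rn 2"
      using closedin_Euclidean_space_iff[of 2 ?C] by (auto simp: closedin_closure_of)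
    moreover have "continuous_on UNIV (\<lambda>h. (P(i := h)) j)" for j
      by (cases "j = i") auto
    ultimately have "open ((\<lambda>h. P(i := h)) -` (- ?C))"
      by (intro open_vimage continuous_on_coordinatewise_then_product) auto
    moreover have "P i \<in> (\<lambda>h. P(i := h)) -` (- ?C)"
      using P cl by auto
    moreover have "\<phi> (P(i := h)) = 0" if "h \<in> (\<lambda>h. P(i := h)) -` (- ?C)" for h
    proof -
      have "P(i := h) \<in> Rn 2" using P i by (auto simp: topspace_Euclidean_space)
      then show ?thesis
        using that closure_of_subset[of "{x \<in> Rn 2. \<phi> x \<noteq> 0}" "Euclidean_space 2"] by auto
    qed
    ultimately have "((\<lambda>h. \<phi> (P(i := h))) has_real_derivative 0) (at (P i))"
      using has_field_derivative_transform_within_open[of "\<lambda>_. 0" 0 "P i" "(\<lambda>h. P(i := h)) -` (- ?C)" "\<lambda>h. \<phi> (P(i := h))"]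
      by auto
    then show ?thesis unfolding partial_def by (rule DERIV_imp_deriv)
  qed
qed

text \<open>The \<open>s\<close> formula is the one-variable chain rule, because \<open>x\<close> is
  fixed. Moving along a ray changes both coordinates and calls for total differentiability, which
  follows from the two partial derivatives and continuity of the vertical one.\<close>

lemma test_function_ray_derivs:
  assumes \<phi>: "\<phi> \<in> test_functions 2 U"
  shows "((\<lambda>s. \<phi> (\<Phi> (s, x))) has_real_derivative partial 1 \<phi> (\<Phi> (s, x)) * dil (s, x)) (at s)"
    and "((\<lambda>x. \<phi> (\<Phi> (s, x))) has_real_derivative
           partial 0 \<phi> (\<Phi> (s, x)) + s * partial 1 \<phi> (\<Phi> (s, x))) (at x)"
proof -
  note props = test_function_props[OF \<phi>]
  show "((\<lambda>s. \<phi> (\<Phi> (s, x))) has_real_derivative partial 1 \<phi> (\<Phi> (s, x)) * dil (s, x)) (at s)"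
    using DERIV_chain2[OF props(4)[of x "A s + x * s"] ray_deriv] by (simp add: \<Phi>_def)
  let ?y = "A s + x * s"
  let ?q = "\<lambda>x y. partial 1 \<phi> (pt x y)"
  have "((\<lambda>(x, y). \<phi> (pt x y)) has_derivative
      (\<lambda>(tx, ty). partial 0 \<phi> (pt x ?y) * tx + blinfun_apply (blinfun_scaleR_left (?q x ?y)) ty))
      (at (x, ?y) within UNIV \<times> UNIV)"
  proof (rule has_derivative_partialsI)
    show "((\<lambda>x. \<phi> (pt x ?y)) has_derivative (\<lambda>tx. partial 0 \<phi> (pt x ?y) * tx)) (at x within UNIV)"
      using props(3)[of ?y x] by (simp add: has_field_derivative_def)
    show "((\<lambda>y. \<phi> (pt x y)) has_derivative blinfun_apply (blinfun_scaleR_left (?q x y))) (at y within UNIV)" for x y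
      using props(4)[of x y] by (simp add: has_field_derivative_def mult_commute_abs)
    have "continuous_on UNIV (\<lambda>z. partial 1 \<phi> (pt (fst z) (snd z)))"
      by (rule continuous_on_compose2[OF props(2)[of 1] continuous_on_pt[OF continuous_on_fst[OF continuous_on_id] continuous_on_snd[OF continuous_on_id]]]) auto
    then have "continuous_on UNIV (\<lambda>z. blinfun_scaleR_left (?q (fst z) (snd z)))"
      by (rule bounded_linear.continuous_on[OF bounded_linear_blinfun_scaleR_left])
    then show "continuous (at (x, ?y) within UNIV \<times> UNIV) (\<lambda>(x, y). blinfun_scaleR_left (?q x y))"
      by (simp add: continuous_on_eq_continuous_at case_prod_unfold)
  qed auto
  then have total: "((\<lambda>z. \<phi> (pt (fst z) (snd z))) has_derivative
      (\<lambda>t. partial 0 \<phi> (pt x ?y) * fst t + snd t * ?q x ?y)) (at (x, ?y))"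
    by (simp add: case_prod_unfold)
  have "((\<lambda>x. (x, A s + x * s)) has_derivative (\<lambda>t. (t, t * s))) (at x)"
    by (auto intro!: derivative_eq_intros)
  from has_derivative_compose[OF this total]
  have "((\<lambda>x. \<phi> (pt x (A s + x * s))) has_derivative
      (\<lambda>t. partial 0 \<phi> (pt x ?y) * t + t * s * partial 1 \<phi> (pt x ?y))) (at x)"
    by (simp del: One_nat_def)
  also have "(\<lambda>t. partial 0 \<phi> (pt x ?y) * t + t * s * partial 1 \<phi> (pt x ?y))
      = (*) (partial 0 \<phi> (pt x ?y) + s * partial 1 \<phi> (pt x ?y))"
    by (simp add: fun_eq_iff algebra_simps)
  finally show "((\<lambda>x. \<phi> (\<Phi> (s, x))) has_real_derivative
           partial 0 \<phi> (\<Phi> (s, x)) + s * partial 1 \<phi> (\<Phi> (s, x))) (at x)"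
    by (simp add: has_field_derivative_def \<Phi>_def)
qed

end

section \<open>Sobolev functions in ray coordinates\<close>

context fan
begin

lemma set_integral_test:
  assumes "\<phi> \<in> test_functions 2 U"
  shows "(LINT P:U|leb 2. f P * \<phi> P) = (LINT P|leb\<Omega>. f P * \<phi> P)"
    and "i < 2 \<Longrightarrow> (LINT P:U|leb 2. f P * partial i \<phi> P) = (LINT P|leb\<Omega>. f P * partial i \<phi> P)"
proof -
  have *: "(LINT P:U|leb 2. f P * g P) = (LINT P|leb\<Omega>. f P * g P)"
    if "\<And>P. P \<in> Rn 2 - U \<Longrightarrow> g P = 0" for g
    unfolding set_integral_leb_Omega[symmetric] set_lebesgue_integral_def
    using that U_subset by (intro Bochner_Integration.integral_cong) (auto split: split_indicator)
  show "(LINT P:U|leb 2. f P * \<phi> P) = (LINT P|leb\<Omega>. f P * \<phi> P)"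
    by (rule *) (rule test_function_props(5)[OF assms])
  show "(LINT P:U|leb 2. f P * partial i \<phi> P) = (LINT P|leb\<Omega>. f P * partial i \<phi> P)" if "i < 2"
    by (rule *) (rule test_function_props(6)[OF assms that])
qed

lemma LINT_K_eq_0:
  fixes h :: "real \<times> real \<Rightarrow> real"
  assumes m: "h \<in> borel_measurable (restrict_space borel K)" and B: "\<And>z. z \<in> K \<Longrightarrow> \<bar>h z\<bar> \<le> B"
  shows "(\<And>x. x \<in> {0..2} \<Longrightarrow> (LINT s:{0..1}|lborel. h (s, x)) = 0) \<Longrightarrow> (LINT z:K|lborel. h z) = 0"
    and "(\<And>s. s \<in> {0..1} \<Longrightarrow> (LINT x:{0..2}|lborel. h (s, x)) = 0) \<Longrightarrow> (LINT z:K|lborel. h z) = 0"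
proof -
  have i: "set_integrable lborel K h" by (rule set_integrable_K[OF m B])
  show "(LINT z:K|lborel. h z) = 0" if "\<And>x. x \<in> {0..2} \<Longrightarrow> (LINT s:{0..1}|lborel. h (s, x)) = 0"
    unfolding LINT_K(2)[OF i]
    using set_lebesgue_integral_cong[of "{0..2}" lborel "\<lambda>x. LINT s:{0..1}|lborel. h (s, x)" "\<lambda>_. 0"] that
    by (auto simp: set_lebesgue_integral_def)
  show "(LINT z:K|lborel. h z) = 0" if "\<And>s. s \<in> {0..1} \<Longrightarrow> (LINT x:{0..2}|lborel. h (s, x)) = 0"
    unfolding LINT_K(1)[OF i]
    using set_lebesgue_integral_cong[of "{0..1}" lborel "\<lambda>s. LINT x:{0..2}|lborel. h (s, x)" "\<lambda>_. 0"] that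
    by (auto simp: set_lebesgue_integral_def)
qed

lemma LINT_K_deriv_s:
  fixes H h :: "real \<times> real \<Rightarrow> real"
  assumes m: "h \<in> borel_measurable (restrict_space borel K)" and B: "\<And>z. z \<in> K \<Longrightarrow> \<bar>h z\<bar> \<le> B"
    and cont: "continuous_on K H"
    and deriv: "\<And>s x. 0 < s \<Longrightarrow> s < 1 \<Longrightarrow> x \<in> {0..2} \<Longrightarrow> ((\<lambda>s. H (s, x)) has_real_derivative h (s, x)) (at s)"
    and bdry: "\<And>x. x \<in> {0..2} \<Longrightarrow> H (0, x) = H (1, x)"
  shows "(LINT z:K|lborel. h z) = 0"
proof (rule LINT_K_eq_0(1)[OF m B])
  fix x :: real assume x: "x \<in> {0..2}"
  have "(LINT s:{0..1}|lborel. h (s, x)) = H (1, x) - H (0, x)"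
  proof (rule LINT_deriv(2))
    show "continuous_on {0..1} (\<lambda>s. H (s, x))"
      using x by (intro continuous_on_compose2[OF cont] continuous_intros) (auto simp: K_def)
    show "\<bar>h (s, x)\<bar> \<le> B" if "s \<in> {0..1}" for s
      using that x by (intro B) (auto simp: K_def)
  qed (use deriv x measurable_K_sections(1)[OF m] in auto)
  then show "(LINT s:{0..1}|lborel. h (s, x)) = 0" using bdry[OF x] by simp
qed

lemma LINT_K_deriv_x:
  fixes H h :: "real \<times> real \<Rightarrow> real"
  assumes m: "h \<in> borel_measurable (restrict_space borel K)" and B: "\<And>z. z \<in> K \<Longrightarrow> \<bar>h z\<bar> \<le> B"
    and cont: "continuous_on K H"
    and deriv: "\<And>s x. s \<in> {0..1} \<Longrightarrow> 0 < x \<Longrightarrow> x < 2 \<Longrightarrow> ((\<lambda>x. H (s, x)) has_real_derivative h (s, x)) (at x)"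
    and bdry: "\<And>s. s \<in> {0..1} \<Longrightarrow> H (s, 0) = H (s, 2)"
  shows "(LINT z:K|lborel. h z) = 0"
proof (rule LINT_K_eq_0(2)[OF m B])
  fix s :: real assume s: "s \<in> {0..1}"
  have "(LINT x:{0..2}|lborel. h (s, x)) = H (s, 2) - H (s, 0)"
  proof (rule LINT_deriv(2))
    show "continuous_on {0..2} (\<lambda>x. H (s, x))"
      using s by (intro continuous_on_compose2[OF cont] continuous_intros) (auto simp: K_def)
    show "\<bar>h (s, x)\<bar> \<le> B" if "x \<in> {0..2}" for x
      using that s by (intro B) (auto simp: K_def)
  qed (use deriv s measurable_K_sections(2)[OF m] in auto)
  then show "(LINT x:{0..2}|lborel. h (s, x)) = 0" using bdry[OF s] by simp
qed

text \<open>A class of integrable functions on \<open>K\<close> that contains the continuous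
  functions and the weak derivatives of interest and is stable under sums and products; it settles
  the integrability of all integrands in the integrations by parts.\<close>

definition bddK :: "(real \<times> real \<Rightarrow> real) \<Rightarrow> bool"
  where "bddK h \<longleftrightarrow> h \<in> borel_measurable (restrict_space borel K) \<and> (\<exists>B. \<forall>z\<in>K. \<bar>h z\<bar> \<le> B)"

lemma bddK_cont: "continuous_on K h \<Longrightarrow> bddK h"
  by (simp add: bddK_def measurable_K_continuous continuous_K_bounded)

lemma bddK_add: "bddK f \<Longrightarrow> bddK g \<Longrightarrow> bddK (\<lambda>z. f z + g z)"
  unfolding bddK_def
proof safe
  fix B C assume "\<forall>z\<in>K. \<bar>f z\<bar> \<le> B" "\<forall>z\<in>K. \<bar>g z\<bar> \<le> C"
  then show "\<exists>B. \<forall>z\<in>K. \<bar>f z + g z\<bar> \<le> B"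
    by (intro exI[of _ "B + C"] ballI order_trans[OF abs_triangle_ineq] add_mono) auto
qed auto

lemma bddK_mult: "bddK f \<Longrightarrow> bddK g \<Longrightarrow> bddK (\<lambda>z. f z * g z)"
  unfolding bddK_def
proof safe
  fix B C assume B: "\<forall>z\<in>K. \<bar>f z\<bar> \<le> B" "\<forall>z\<in>K. \<bar>g z\<bar> \<le> C"
  then show "\<exists>B. \<forall>z\<in>K. \<bar>f z * g z\<bar> \<le> B"
    by (intro exI[of _ "\<bar>B\<bar> * \<bar>C\<bar>"]) (force simp: abs_mult intro!: mult_mono)
qed auto

lemma bddK_integrable: "bddK h \<Longrightarrow> set_integrable lborel K h"
  unfolding bddK_def using set_integrable_K by blast

text \<open>By the chain rule the vertical derivative is \<open>Fs / dil\<close> and the horizontal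
  one \<open>Fx - s * Fs / dil\<close>. The bound of \<open>Fs\<close> by \<open>dil\<close> keeps
  these quotients bounded near the degenerate corner. That they are weak derivatives is integration
  by parts over \<open>K\<close>, without boundary terms because test functions vanish on the image
  of the boundary.\<close>

lemma W1p_of_ray_coordinates:
  assumes F: "continuous_on K F"
    and Fs: "\<And>s x. 0 < s \<Longrightarrow> s < 1 \<Longrightarrow> x \<in> {0..2} \<Longrightarrow> ((\<lambda>s. F (s, x)) has_real_derivative Fs (s, x)) (at s)"
    and Fx: "\<And>s x. s \<in> {0..1} \<Longrightarrow> 0 < x \<Longrightarrow> x < 2 \<Longrightarrow> ((\<lambda>x. F (s, x)) has_real_derivative Fx (s, x)) (at x)"
    and mFs: "Fs \<in> borel_measurable (restrict_space borel K)"
    and mFx: "Fx \<in> borel_measurable (restrict_space borel K)"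
    and BFs: "\<And>z. z \<in> K \<Longrightarrow> \<bar>Fs z\<bar> \<le> B * dil z"
    and BFx: "\<And>z. z \<in> K \<Longrightarrow> \<bar>Fx z\<bar> \<le> B"
    and p: "0 \<le> p"
  shows "(\<lambda>P. F (\<Psi> P)) \<in> W1p 2 U p"
proof -
  \<comment> \<open>Where \<open>dil\<close> is 0 the bound makes \<open>Fs\<close> vanish too, so
    division by zero is harmless and \<open>dil * q = Fs\<close> holds throughout
    \<open>K\<close>.\<close>
  define q where "q z = Fs z / dil z" for z
  have dq: "dil z * q z = Fs z" if "z \<in> K" for z
    using BFs[OF that] by (auto simp: q_def)
  have mq: "q \<in> borel_measurable (restrict_space borel K)"
    unfolding q_def by (intro borel_measurable_divide mFs measurable_restrict_space1 measurable_dil)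
  have B0: "0 \<le> B" using BFx[of "(0,0)"] by (force simp: K_def)
  have Bq: "\<bar>q z\<bar> \<le> B" if "z \<in> K" for z
  proof (cases "dil z = 0")
    case False
    then have "0 < dil z" using dil_nonneg[OF that] by simp
    then show ?thesis using BFs[OF that] by (simp add: q_def abs_divide divide_le_eq)
  qed (use B0 in \<open>auto simp: q_def\<close>)
  have bF: "bddK F" "bddK dil" "bddK fst" "bddK snd"
    by (auto intro!: bddK_cont F continuous_on_dil continuous_intros)
  have bd: "bddK q" "bddK Fx"
    unfolding bddK_def using mq Bq mFx BFx by blast+
  then have "bddK (\<lambda>z. dil z * q z)" by (intro bddK_mult bF)
  then have bFs: "bddK Fs"
    using mFs dq by (auto simp: bddK_def)
  define g where "g z = Fx z + (-1) * (fst z * q z)" for z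
  have bg: "bddK g"
    unfolding g_def by (intro bddK_add bddK_mult bd bF bddK_cont continuous_intros)
  have inLp: "(\<lambda>P. h (\<Psi> P)) \<in> Lp 2 U p" if h: "bddK h" for h
  proof -
    obtain C where "\<forall>z\<in>K. \<bar>h z\<bar> \<le> C" "h \<in> borel_measurable (restrict_space borel K)"
      using h by (auto simp: bddK_def)
    then show ?thesis
      by (intro bounded_in_Lp[of _ C] measurable_comp_Psi p) (auto dest: Psi_in_K)
  qed
  have parts: "weak_partial 2 U 1 (\<lambda>P. F (\<Psi> P)) (\<lambda>P. q (\<Psi> P))"
    "weak_partial 2 U 0 (\<lambda>P. F (\<Psi> P)) (\<lambda>P. g (\<Psi> P))"
  proof -
    {
      fix \<phi> assume \<phi>: "\<phi> \<in> test_functions 2 U"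
      note props = test_function_props[OF \<phi>] note rd = test_function_ray_derivs[OF \<phi>]
      define \<psi> \<psi>0 \<psi>1 where "\<psi> z = \<phi> (\<Phi> z)" and "\<psi>0 z = partial 0 \<phi> (\<Phi> z)" and "\<psi>1 z = partial 1 \<phi> (\<Phi> z)" for z
      have PR: "\<Phi> ` K \<subseteq> Rn 2" by (auto simp: \<Phi>_def)
      have c: "continuous_on K \<psi>" "continuous_on K \<psi>0" "continuous_on K \<psi>1"
        unfolding \<psi>_def \<psi>0_def \<psi>1_def
        by (auto intro!: continuous_on_compose2[OF _ continuous_on_Phi PR] props)
      note b = bddK_cont[OF c(1)] bddK_cont[OF c(2)] bddK_cont[OF c(3)]
      have z: "\<psi> (0, x) = 0" "\<psi> (1, x) = 0" if "x \<in> {0..2}" for x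
        using that Phi_in_U_iff[of 0 x] Phi_in_U_iff[of 1 x]
        by (auto simp: \<psi>_def K_def \<Phi>_def intro!: props(5))
      have z': "\<psi> (s, 0) = 0" "\<psi> (s, 2) = 0" if "s \<in> {0..1}" for s
        using that Phi_in_U_iff[of s 0] Phi_in_U_iff[of s 2]
        by (auto simp: \<psi>_def K_def \<Phi>_def intro!: props(5))
      have trans: "(LINT P|leb\<Omega>. h (\<Psi> P) * k P) = (LINT z:K|lborel. dil z * (h z * k (\<Phi> z)))"
        if "bddK h" "continuous_on (Rn 2) k" for h k
      proof -
        have "(\<lambda>P. h (\<Psi> P) * k P) \<in> borel_measurable (restrict_space borel \<Omega>)"
          using that(1) by (intro borel_measurable_times measurable_comp_Psi
              borel_measurable_continuous_on_restrict[OF continuous_on_subset[OF that(2) Omega_subset]])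
            (simp add: bddK_def)
        from integral_leb_Omega[OF this] show ?thesis
          by (simp, intro set_lebesgue_integral_cong) auto
      qed
      note intg = bddK_integrable bddK_add bddK_mult bd bF bFs bg b
      \<comment> \<open>Three exact derivatives are integrated: of \<open>F * \<psi>\<close> and
        \<open>s * F * \<psi>\<close> in \<open>s\<close>, and of \<open>dil * F * \<psi>\<close> in
        \<open>x\<close>. The last two both produce a stray \<open>F * \<psi>\<close>, since
        \<open>s\<close> and \<open>dil\<close> have derivative 1, and it cancels in the difference
        that yields the horizontal derivative.\<close>
      have s1: "(LINT z:K|lborel. Fs z * \<psi> z + F z * (\<psi>1 z * dil z)) = 0"
      proof -
        have "bddK (\<lambda>z. Fs z * \<psi> z + F z * (\<psi>1 z * dil z))" by (intro intg)
        then obtain C where C: "\<forall>z\<in>K. \<bar>Fs z * \<psi> z + F z * (\<psi>1 z * dil z)\<bar> \<le> C"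
          and m: "(\<lambda>z. Fs z * \<psi> z + F z * (\<psi>1 z * dil z)) \<in> borel_measurable (restrict_space borel K)"
          by (auto simp: bddK_def)
        show ?thesis
        proof (rule LINT_K_deriv_s[OF m, where H = "\<lambda>z. F z * \<psi> z" and B = C])
          show "((\<lambda>s. F (s, x) * \<psi> (s, x)) has_real_derivative
            Fs (s, x) * \<psi> (s, x) + F (s, x) * (\<psi>1 (s, x) * dil (s, x))) (at s)"
            if "0 < s" "s < 1" "x \<in> {0..2}" for s x
            using DERIV_mult[OF Fs[OF that] rd(1)[of x s]] by (simp add: \<psi>_def \<psi>1_def mult_ac)
        qed (use C z in \<open>auto intro!: continuous_intros F c\<close>)
      qed
      have s2: "(LINT z:K|lborel. F z * \<psi> z + fst z * (Fs z * \<psi> z + F z * (\<psi>1 z * dil z))) = 0"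
        (is "(LINT z:K|lborel. ?h z) = 0")
      proof -
        have "bddK ?h" by (intro intg)
        then obtain C where C: "\<forall>z\<in>K. \<bar>?h z\<bar> \<le> C"
          and m: "?h \<in> borel_measurable (restrict_space borel K)"
          by (auto simp: bddK_def)
        show ?thesis
        proof (rule LINT_K_deriv_s[OF m, where H = "\<lambda>z. fst z * (F z * \<psi> z)" and B = C])
          fix s x :: real assume sx: "0 < s" "s < 1" "x \<in> {0..2}"
          have "((\<lambda>s. F (s, x) * \<psi> (s, x)) has_real_derivative
            Fs (s, x) * \<psi> (s, x) + F (s, x) * (\<psi>1 (s, x) * dil (s, x))) (at s)"
            using DERIV_mult[OF Fs[OF sx] rd(1)[of x s]] by (simp add: \<psi>_def \<psi>1_def mult_ac)
          from DERIV_mult[OF DERIV_ident this]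
          show "((\<lambda>s. fst (s, x) * (F (s, x) * \<psi> (s, x))) has_real_derivative ?h (s, x)) (at s)"
            by (simp add: algebra_simps)
        qed (use C z in \<open>auto intro!: continuous_intros F c\<close>)
      qed
      have s3: "(LINT z:K|lborel. F z * \<psi> z + dil z * (Fx z * \<psi> z + F z * (\<psi>0 z + fst z * \<psi>1 z))) = 0"
        (is "(LINT z:K|lborel. ?h z) = 0")
      proof -
        have "bddK ?h" by (intro intg)
        then obtain C where C: "\<forall>z\<in>K. \<bar>?h z\<bar> \<le> C"
          and m: "?h \<in> borel_measurable (restrict_space borel K)"
          by (auto simp: bddK_def)
        show ?thesis
        proof (rule LINT_K_deriv_x[OF m, where H = "\<lambda>z. dil z * (F z * \<psi> z)" and B = C])
          fix s x :: real assume sx: "s \<in> {0..1}" "0 < x" "x < 2"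
          have 1: "((\<lambda>x. F (s, x) * \<psi> (s, x)) has_real_derivative
            Fx (s, x) * \<psi> (s, x) + F (s, x) * (\<psi>0 (s, x) + s * \<psi>1 (s, x))) (at x)"
            using DERIV_mult[OF Fx[OF sx] rd(2)[of s x]] by (simp add: \<psi>_def \<psi>0_def \<psi>1_def mult_ac)
          have 2: "((\<lambda>x. dil (s, x)) has_real_derivative 1) (at x)"
            unfolding dil_def by (auto intro!: derivative_eq_intros)
          from DERIV_mult[OF 2 1]
          show "((\<lambda>x. dil (s, x) * (F (s, x) * \<psi> (s, x))) has_real_derivative ?h (s, x)) (at x)"
            by (simp add: algebra_simps)
        qed (use C z' in \<open>auto intro!: continuous_intros F c continuous_on_dil\<close>)
      qed
      have "(LINT P:U|leb 2. F (\<Psi> P) * partial 1 \<phi> P) + (LINT P:U|leb 2. q (\<Psi> P) * \<phi> P)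
          = (LINT z:K|lborel. dil z * (F z * \<psi>1 z)) + (LINT z:K|lborel. dil z * (q z * \<psi> z))"
        by (simp add: set_integral_test[OF \<phi>] trans bF bd props \<psi>_def \<psi>1_def del: One_nat_def)
      also have "\<dots> = (LINT z:K|lborel. dil z * (F z * \<psi>1 z) + dil z * (q z * \<psi> z))"
        by (rule set_integral_add(2)[symmetric]; intro intg)
      also have "\<dots> = (LINT z:K|lborel. Fs z * \<psi> z + F z * (\<psi>1 z * dil z))"
      proof (rule set_lebesgue_integral_cong, simp, intro allI impI)
        fix z assume "z \<in> K"
        show "dil z * (F z * \<psi>1 z) + dil z * (q z * \<psi> z) = Fs z * \<psi> z + F z * (\<psi>1 z * dil z)"
          unfolding dq[OF \<open>z \<in> K\<close>, symmetric] by (simp add: algebra_simps)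
      qed
      finally have e1: "(LINT P:U|leb 2. F (\<Psi> P) * partial 1 \<phi> P) = - (LINT P:U|leb 2. q (\<Psi> P) * \<phi> P)"
        using s1 by simp
      have "(LINT P:U|leb 2. F (\<Psi> P) * partial 0 \<phi> P) + (LINT P:U|leb 2. g (\<Psi> P) * \<phi> P)
          = (LINT z:K|lborel. dil z * (F z * \<psi>0 z)) + (LINT z:K|lborel. dil z * (g z * \<psi> z))"
        by (simp add: set_integral_test[OF \<phi>] trans bF bg props \<psi>_def \<psi>0_def del: One_nat_def)
      also have "\<dots> = (LINT z:K|lborel. dil z * (F z * \<psi>0 z) + dil z * (g z * \<psi> z))"
        by (rule set_integral_add(2)[symmetric]; intro intg)
      also have "\<dots> = (LINT z:K|lborel.
          (F z * \<psi> z + dil z * (Fx z * \<psi> z + F z * (\<psi>0 z + fst z * \<psi>1 z)))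
          - (F z * \<psi> z + fst z * (Fs z * \<psi> z + F z * (\<psi>1 z * dil z))))"
      proof (rule set_lebesgue_integral_cong, simp, intro allI impI)
        fix z assume "z \<in> K"
        show "dil z * (F z * \<psi>0 z) + dil z * (g z * \<psi> z) =
          (F z * \<psi> z + dil z * (Fx z * \<psi> z + F z * (\<psi>0 z + fst z * \<psi>1 z)))
          - (F z * \<psi> z + fst z * (Fs z * \<psi> z + F z * (\<psi>1 z * dil z)))"
          unfolding g_def dq[OF \<open>z \<in> K\<close>, symmetric] by (simp add: algebra_simps)
      qed
      also have "\<dots> = (LINT z:K|lborel. F z * \<psi> z + dil z * (Fx z * \<psi> z + F z * (\<psi>0 z + fst z * \<psi>1 z)))
          - (LINT z:K|lborel. F z * \<psi> z + fst z * (Fs z * \<psi> z + F z * (\<psi>1 z * dil z)))"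
        by (rule set_integral_diff(2); intro intg)
      finally have e0: "(LINT P:U|leb 2. F (\<Psi> P) * partial 0 \<phi> P) = - (LINT P:U|leb 2. g (\<Psi> P) * \<phi> P)"
        using s2 s3 by simp
      note e1 e0
    }
    then show "weak_partial 2 U 1 (\<lambda>P. F (\<Psi> P)) (\<lambda>P. q (\<Psi> P))"
      "weak_partial 2 U 0 (\<lambda>P. F (\<Psi> P)) (\<lambda>P. g (\<Psi> P))"
      unfolding weak_partial_def by blast+
  qed
  have "\<exists>h\<in>Lp 2 U p. weak_partial 2 U i (\<lambda>P. F (\<Psi> P)) h" if "i < 2" for i
    using less_2_cases[OF that] parts inLp[OF bd(1)] inLp[OF bg] by auto
  then show ?thesis
    using inLp[OF bF(1)] by (simp add: W1p_def)
qed

end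

section \<open>The Kantorovich potential of a fan of rays\<close>

lemma euclid_dist_2: "euclid_dist 2 P Q = sqrt ((P 0 - Q 0)\<^sup>2 + (P 1 - Q 1)\<^sup>2)"
proof -
  have "{..<2::nat} = {0, 1}" by auto
  then show ?thesis by (simp add: euclid_dist_def L2_set_def)
qed

text \<open>Cauchy-Schwarz for the direction \<open>(1, s)\<close>: the difference of the squared
  sides is the square of \<open>(Q 1 - P 1) - s * (Q 0 - P 0)\<close>.\<close>

lemma directional_le_euclid_dist:
  "(Q 0 - P 0) + s * (Q 1 - P 1) \<le> sqrt (1 + s\<^sup>2) * euclid_dist 2 P Q"
proof -
  have "((Q 0 - P 0) + s * (Q 1 - P 1))\<^sup>2 \<le> (1 + s\<^sup>2) * ((P 0 - Q 0)\<^sup>2 + (P 1 - Q 1)\<^sup>2)"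
    using zero_le_power2[of "(Q 1 - P 1) - s * (Q 0 - P 0)"]
    by (simp add: power2_eq_square algebra_simps)
  from real_le_rsqrt[OF this] show ?thesis
    by (simp add: euclid_dist_2 real_sqrt_mult)
qed

context fan
begin

text \<open>Arc length per unit abscissa along the ray \<open>s\<close>, the norm of its direction
  \<open>(1, s)\<close>.\<close>

definition q :: "real \<Rightarrow> real" where "q s = sqrt (1 + s\<^sup>2)"

lemma q_pos: "0 < q s"
  by (simp add: q_def add_pos_nonneg)

lemma q_power2: "(q s)\<^sup>2 = 1 + s\<^sup>2"
  by (simp add: q_def)

lemma continuous_on_q [continuous_intros]: "continuous_on S f \<Longrightarrow> continuous_on S (\<lambda>x. q (f x))"
  unfolding q_def by (intro continuous_intros)

lemma q_deriv: "(q has_real_derivative s / q s) (at s)"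
proof -
  have "0 < 1 + s\<^sup>2" by (simp add: add_pos_nonneg)
  then show ?thesis
    unfolding q_def by (auto intro!: derivative_eq_intros simp: divide_simps)
qed

text \<open>The linear part \<open>(P 0 + s * P 1) / q s\<close> has \<open>s\<close>-derivative
  \<open>(P 1 - s * P 0) / (q s)^3\<close>, and on the ray \<open>s\<close> this numerator equals
  \<open>A s\<close>. Prescribing the same derivative for \<open>G\<close> makes \<open>s\<close> a
  critical parameter for every point of the ray \<open>s\<close>.\<close>

definition G :: "real \<Rightarrow> real"
  where "G = (SOME G. \<forall>s. (G has_real_derivative A s / (q s)^3) (at s))"

lemma G_deriv: "(G has_real_derivative A s / (q s)^3) (at s)"
proof -
  have "continuous_on UNIV (\<lambda>s. A s / (q s)^3)"
    using q_pos by (intro continuous_intros) (auto simp: less_imp_neq[symmetric])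
  then have "\<exists>G. \<forall>s. (G has_real_derivative A s / (q s)^3) (at s)"
    using einterval_antiderivative[of "-\<infinity>" "\<infinity>" "\<lambda>s. A s / (q s)^3"]
    by (auto simp: has_real_derivative_iff_has_vector_derivative continuous_on_eq_continuous_at)
  from someI_ex[OF this] show ?thesis by (simp add: G_def)
qed

text \<open>The affine function with gradient the direction of the ray \<open>s\<close>; the maximum over \<open>s\<close> of these
  functions is a Kantorovich potential, and \<^const>\<open>G\<close> is chosen such that at \<open>P\<close> the maximum is
  attained exactly at the ray through \<open>P\<close>.\<close>

definition ray_affine :: "real \<Rightarrow> point \<Rightarrow> real"
  where "ray_affine s P = (P 0 + s * P 1) / q s - G s"

text \<open>The sign of the derivative tells whether \<open>P\<close> lies above or below the ray
  \<open>s\<close>; strict monotonicity of the ray heights then turns the critical parameter into a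
  strict maximum.\<close>

lemma ray_affine_deriv:
  "((\<lambda>s. ray_affine s P) has_real_derivative (P 1 - (A s + P 0 * s)) / (q s)^3) (at s)"
proof -
  have "((\<lambda>s. ray_affine s P) has_real_derivative
      (P 1 * q s - (P 0 + s * P 1) * (s / q s)) / (q s * q s) - A s / (q s)^3) (at s)"
    unfolding ray_affine_def using q_pos[of s] by (auto intro!: derivative_eq_intros q_deriv G_deriv)
  moreover have "(P 1 * q s - (P 0 + s * P 1) * (s / q s)) / (q s * q s) - A s / (q s)^3
      = (P 1 * (q s)\<^sup>2 - (P 0 + s * P 1) * s - A s) / (q s)^3"
    using q_pos[of s] by (simp add: field_simps power2_eq_square power3_eq_cube)
  moreover have "P 1 * (q s)\<^sup>2 - (P 0 + s * P 1) * s - A s = P 1 - (A s + P 0 * s)"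
    unfolding q_power2 by (simp add: power2_eq_square algebra_simps)
  ultimately show ?thesis by (simp only:)
qed

lemma ray_affine_less:
  assumes "(s, x) \<in> K" "0 \<le> t" "t \<noteq> s"
  shows "ray_affine t (\<Phi> (s, x)) < ray_affine s (\<Phi> (s, x))"
proof (cases t s rule: linorder_cases)
  case less
  have cont: "continuous_on {t..s} (\<lambda>s'. ray_affine s' (\<Phi> (s, x)))"
    by (rule DERIV_continuous_on[OF has_field_derivative_at_within[OF ray_affine_deriv]])
  show ?thesis
  proof (rule DERIV_pos_imp_increasing_open[OF less _ cont])
    fix r assume r: "t < r" "r < s"
    then have "A r + x * r < A s + x * s"
      using assms by (intro ray_strict_mono) (auto simp: K_def)
    then have "0 < (\<Phi> (s, x) 1 - (A r + \<Phi> (s, x) 0 * r)) / (q r)^3"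
      using q_pos[of r] by (intro divide_pos_pos) (auto simp: \<Phi>_def)
    then show "\<exists>y. ((\<lambda>s'. ray_affine s' (\<Phi> (s, x))) has_real_derivative y) (at r) \<and> 0 < y"
      using ray_affine_deriv by blast
  qed
next
  case greater
  have cont: "continuous_on {s..t} (\<lambda>s'. ray_affine s' (\<Phi> (s, x)))"
    by (rule DERIV_continuous_on[OF has_field_derivative_at_within[OF ray_affine_deriv]])
  show ?thesis
  proof (rule DERIV_neg_imp_decreasing_open[OF greater _ cont])
    fix r assume r: "s < r" "r < t"
    then have "A s + x * s < A r + x * r"
      using assms by (intro ray_strict_mono) (auto simp: K_def)
    then have "(\<Phi> (s, x) 1 - (A r + \<Phi> (s, x) 0 * r)) / (q r)^3 < 0"
      using q_pos[of r] by (intro divide_neg_pos) (auto simp: \<Phi>_def)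
    then show "\<exists>y. ((\<lambda>s'. ray_affine s' (\<Phi> (s, x))) has_real_derivative y) (at r) \<and> y < 0"
      using ray_affine_deriv by blast
  qed
qed (use assms in auto)

text \<open>Defined through the ray of \<open>P\<close> instead of a supremum; the next two lemmas
  identify it as the maximum of \<open>ray_affine\<close> over all \<open>t \<ge> 0\<close>,
  attained only there.\<close>

definition pot :: "point \<Rightarrow> real" where "pot P = ray_affine (fst (\<Psi> P)) P"

lemma ray_affine_le_pot: "P \<in> \<Omega> \<Longrightarrow> 0 \<le> t \<Longrightarrow> ray_affine t P \<le> pot P"
  using ray_affine_less[of "fst (\<Psi> P)" "snd (\<Psi> P)" t] Psi_in_K[of P]
  by (cases "t = fst (\<Psi> P)") (auto simp: pot_def)

lemma ray_affine_eq_pot: "P \<in> \<Omega> \<Longrightarrow> 0 \<le> t \<Longrightarrow> ray_affine t P = pot P \<Longrightarrow> t = fst (\<Psi> P)"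
  using ray_affine_less[of "fst (\<Psi> P)" "snd (\<Psi> P)" t] Psi_in_K[of P]
  by (cases "t = fst (\<Psi> P)") (auto simp: pot_def)

lemma ray_affine_diff: "ray_affine s Q - ray_affine s P \<le> euclid_dist 2 P Q"
proof -
  have "ray_affine s Q - ray_affine s P = ((Q 0 - P 0) + s * (Q 1 - P 1)) / q s"
    using q_pos[of s] by (simp add: ray_affine_def field_simps)
  also have "\<dots> \<le> euclid_dist 2 P Q"
    using directional_le_euclid_dist[of Q P s] q_pos[of s]
    by (simp add: pos_divide_le_eq q_def mult.commute)
  finally show ?thesis .
qed

lemma fst_Psi_bounds: "P \<in> \<Omega> \<Longrightarrow> 0 \<le> fst (\<Psi> P)" "P \<in> \<Omega> \<Longrightarrow> fst (\<Psi> P) \<le> 1"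
  using Psi_in_K[of P] by (auto simp: K_def)

text \<open>A maximum of 1-Lipschitz functions: both points are compared through the affine function
  of the ray of \<open>Q\<close>.\<close>

lemma pot_diff_le:
  assumes "P \<in> \<Omega>" "Q \<in> \<Omega>"
  shows "pot Q - pot P \<le> euclid_dist 2 P Q"
  using ray_affine_le_pot[OF assms(1) fst_Psi_bounds(1)[OF assms(2)]] ray_affine_diff[of "fst (\<Psi> Q)" Q P]
  by (simp add: pot_def)

lemma pot_on_ray:
  assumes "(s, x) \<in> K" "(s, z) \<in> K"
  shows "pot (\<Phi> (s, z)) - pot (\<Phi> (s, x)) = (z - x) * q s"
proof -
  have "pot (\<Phi> (s, z)) - pot (\<Phi> (s, x)) = ((z - x) * (1 + s\<^sup>2)) / q s"
    using assms q_pos[of s]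
    by (simp add: pot_def ray_affine_def) (simp add: \<Phi>_def field_simps power2_eq_square)
  also have "\<dots> = (z - x) * q s"
    using q_pos[of s] unfolding q_power2[symmetric] by (simp add: power2_eq_square)
  finally show ?thesis .
qed

lemma dist_on_ray: "euclid_dist 2 (\<Phi> (s, x)) (\<Phi> (s, z)) = \<bar>z - x\<bar> * q s"
proof -
  have "(x - z)\<^sup>2 + (A s + x * s - (A s + z * s))\<^sup>2 = (z - x)\<^sup>2 * (1 + s\<^sup>2)"
    by (simp add: power2_eq_square algebra_simps)
  then show ?thesis
    by (simp add: euclid_dist_2 \<Phi>_def q_def real_sqrt_mult)
qed

text \<open>Equality in the Lipschitz estimate forces the affine function of the ray of
  \<open>Q\<close> to be maximal at \<open>P\<close> too, and the maximizer is unique. The order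
  follows because the potential increases along the ray.\<close>

lemma pot_diff_eq_dist:
  assumes P: "P \<in> \<Omega>" and Q: "Q \<in> \<Omega>" and eq: "pot Q - pot P = euclid_dist 2 P Q"
  shows "fst (\<Psi> P) = fst (\<Psi> Q)" "snd (\<Psi> P) \<le> snd (\<Psi> Q)"
proof -
  let ?s = "fst (\<Psi> Q)"
  have s: "0 \<le> ?s" by (rule fst_Psi_bounds(1)[OF Q])
  have "ray_affine ?s P = pot P"
    using ray_affine_le_pot[OF P s] ray_affine_diff[of ?s Q P] eq by (simp add: pot_def)
  then show *: "fst (\<Psi> P) = fst (\<Psi> Q)"
    using ray_affine_eq_pot[OF P s] by simp
  have "0 \<le> pot Q - pot P"
    unfolding eq by (simp add: euclid_dist_2)
  also have "pot Q - pot P = (snd (\<Psi> Q) - snd (\<Psi> P)) * q ?s"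
    using pot_on_ray[of ?s "snd (\<Psi> P)" "snd (\<Psi> Q)"] Psi_in_K[OF P] Psi_in_K[OF Q] *[symmetric] P Q
    by (metis Phi_Psi prod.collapse)
  finally show "snd (\<Psi> P) \<le> snd (\<Psi> Q)"
    using q_pos[of ?s] by (simp add: zero_le_mult_iff)
qed

lemma continuous_on_pot_Phi: "continuous_on K (\<lambda>z. pot (\<Phi> z))"
proof -
  have G: "continuous_on UNIV G"
    by (rule DERIV_continuous_on[OF has_field_derivative_at_within[OF G_deriv]])
  have "continuous_on K (\<lambda>z. (snd z + fst z * (A (fst z) + snd z * fst z)) / q (fst z) - G (fst z))"
    using q_pos by (intro continuous_intros continuous_on_compose2[OF G]) (auto simp: less_imp_neq[symmetric])
  then show ?thesis
  proof (rule continuous_on_eq)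
    fix z assume "z \<in> K"
    then have "pot (\<Phi> z) = ray_affine (fst z) (\<Phi> z)" by (simp add: pot_def)
    then show "(snd z + fst z * (A (fst z) + snd z * fst z)) / q (fst z) - G (fst z) = pot (\<Phi> z)"
      by (simp add: ray_affine_def \<Phi>_def)
  qed
qed

lemma segment_point_on_ray:
  "segment_point (\<Phi> (s, x)) (\<Phi> (s, z)) t = \<Phi> (s, (1 - t) * x + t * z)"
  by (auto simp: segment_point_def \<Phi>_def pt_def fun_eq_iff algebra_simps)

text \<open>An antiderivative of \<open>\<phi>\<close> along the ray with respect to arc length. It
  turns the integral over a segment into a difference of values at the endpoints, so that integrals
  against a plan moving mass along rays depend only on its marginals.\<close>

definition ray_prim :: "(point \<Rightarrow> real) \<Rightarrow> real \<times> real \<Rightarrow> real"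
  where "ray_prim \<phi> z = q (fst z) * integral {0..snd z} (\<lambda>r. \<phi> (\<Phi> (fst z, r)))"

lemma continuous_on_ray:
  assumes "continuous_on \<Omega> \<phi>" "s \<in> {0..1}"
  shows "continuous_on {0..2} (\<lambda>r. \<phi> (\<Phi> (s, r)))"
  by (rule continuous_on_compose2[OF assms(1) continuous_on_compose2[OF continuous_on_Phi[of UNIV]]])
    (use assms(2) in \<open>auto intro!: continuous_intros simp: \<Omega>_def K_def\<close>)

lemma ray_prim_deriv:
  assumes \<phi>: "continuous_on \<Omega> \<phi>" and s: "s \<in> {0..1}" and x: "0 < x" "x < 2"
  shows "((\<lambda>x. ray_prim \<phi> (s, x)) has_real_derivative q s * \<phi> (\<Phi> (s, x))) (at x)"
proof -
  have "((\<lambda>u. integral {0..u} (\<lambda>r. \<phi> (\<Phi> (s, r)))) has_real_derivative \<phi> (\<Phi> (s, x))) (at x within {0..2})"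
    by (rule integral_has_real_derivative[OF continuous_on_ray[OF \<phi> s]]) (use x in auto)
  then have "((\<lambda>u. integral {0..u} (\<lambda>r. \<phi> (\<Phi> (s, r)))) has_real_derivative \<phi> (\<Phi> (s, x))) (at x)"
    using x by (simp add: at_within_Icc_at)
  from DERIV_cmult[OF this, of "q s"] show ?thesis
    by (simp add: ray_prim_def)
qed

lemma continuous_on_ray_prim_x:
  assumes \<phi>: "continuous_on \<Omega> \<phi>" and s: "s \<in> {0..1}"
  shows "continuous_on {0..2} (\<lambda>x. ray_prim \<phi> (s, x))"
  using continuous_on_ray[OF \<phi> s]
  by (auto simp: ray_prim_def intro!: continuous_intros indefinite_integral_continuous_1 integrable_continuous_real)

lemma ray_prim_segment:
  assumes \<phi>: "continuous_on \<Omega> \<phi>" and s: "s \<in> {0..1}" and x: "0 \<le> x" "x \<le> z" "z \<le> 2"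
  shows "(LINT t:{0..1}|lborel. \<phi> (\<Phi> (s, (1 - t) * x + t * z)) * ((z - x) * q s))
    = ray_prim \<phi> (s, z) - ray_prim \<phi> (s, x)"
proof (cases "x = z")
  case False
  then have xz: "x < z" using x by simp
  have in02: "(1 - t) * x + t * z \<in> {0..2}" if "t \<in> {0..1}" for t
  proof -
    have "(1 - t) * x + t * z \<le> (1 - t) * 2 + t * 2"
      using that x by (intro add_mono mult_left_mono) auto
    then show ?thesis using that x by (auto intro!: add_nonneg_nonneg)
  qed
  have in02': "0 < (1 - t) * x + t * z" "(1 - t) * x + t * z < 2" if "t \<in> {0<..<1}" for t
  proof -
    have "(1 - t) * 0 + t * 0 < (1 - t) * x + t * z"
      using that x xz by (intro add_le_less_mono mult_left_mono mult_strict_left_mono) auto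
    then show "0 < (1 - t) * x + t * z" by simp
    have "(1 - t) * x + t * z < (1 - t) * 2 + t * 2"
      using that x xz by (intro add_less_le_mono mult_left_mono mult_strict_left_mono) auto
    then show "(1 - t) * x + t * z < 2" by simp
  qed
  let ?g = "\<lambda>t. ray_prim \<phi> (s, (1 - t) * x + t * z)"
  let ?g' = "\<lambda>t. \<phi> (\<Phi> (s, (1 - t) * x + t * z)) * ((z - x) * q s)"
  have c': "continuous_on {0..1} ?g'"
    by (intro continuous_on_mult continuous_on_const continuous_on_compose2[OF continuous_on_ray[OF \<phi> s]] continuous_intros)
      (use in02 in auto)
  obtain B where B: "\<forall>t\<in>{0..1}. \<bar>?g' t\<bar> \<le> B"
    using compact_imp_bounded[OF compact_continuous_image[OF c']] by (auto simp: bounded_iff)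
  have "(LINT t:{0..1}|lborel. ?g' t) = ?g 1 - ?g 0"
  proof (rule LINT_deriv(2))
    show "continuous_on {0..1} ?g"
      by (intro continuous_on_compose2[OF continuous_on_ray_prim_x[OF \<phi> s]] continuous_intros) (use in02 in auto)
    show "(?g has_real_derivative ?g' t) (at t)" if "t \<in> {0<..<1}" for t
    proof -
      have "((\<lambda>t. (1 - t) * x + t * z) has_real_derivative z - x) (at t)"
        by (auto intro!: derivative_eq_intros)
      from DERIV_chain2[OF ray_prim_deriv[OF \<phi> s in02'[OF that]] this]
      show ?thesis by (simp add: mult_ac)
    qed
    show "set_borel_measurable lborel {0..1} ?g'"
      using borel_measurable_continuous_on_indicator[OF _ c'] by (simp add: set_borel_measurable_def)
  qed (use B in auto)
  then show ?thesis by simp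
qed (simp add: set_lebesgue_integral_def)

text \<open>The substitution \<open>r = t * x\<close> moves the variable endpoint into the
  integrand, where continuity of parameter integrals over a fixed interval applies.\<close>

lemma continuous_on_ray_prim:
  assumes \<phi>: "continuous_on \<Omega> \<phi>"
  shows "continuous_on K (ray_prim \<phi>)"
proof -
  let ?J = "\<lambda>z. integral (cbox 0 1) (\<lambda>t. \<phi> (\<Phi> (fst z, t * snd z)))"
  have "continuous_on (K \<times> cbox 0 1) (\<lambda>(z, t). \<phi> (\<Phi> (fst z, t * snd z)))"
    unfolding case_prod_beta
    by (intro continuous_on_compose2[OF \<phi> continuous_on_compose2[OF continuous_on_Phi[of UNIV]]] continuous_intros)
      (auto simp: \<Omega>_def K_def mult_left_le_one_le intro!: imageI order_trans[OF mult_left_le_one_le])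
  from integral_continuous_on_param[OF this]
  have "continuous_on K (\<lambda>z. q (fst z) * snd z * ?J z)"
    by (intro continuous_intros)
  then show ?thesis
  proof (rule continuous_on_eq)
    fix z assume "z \<in> K"
    then obtain s x where z: "z = (s, x)" "s \<in> {0..1}" "0 \<le> x" "x \<le> 2"
      by (auto simp: K_def)
    have c: "continuous_on {0..1} (\<lambda>t. \<phi> (\<Phi> (s, t * x)))"
      by (rule continuous_on_compose2[OF continuous_on_ray[OF \<phi> z(2)]])
        (use z in \<open>auto intro!: continuous_intros order_trans[OF mult_left_le_one_le]\<close>)
    have "ray_prim \<phi> (s, x) = ray_prim \<phi> (s, x) - ray_prim \<phi> (s, 0)"
      by (simp add: ray_prim_def)
    also have "\<dots> = (LINT t:{0..1}|lborel. \<phi> (\<Phi> (s, t * x)) * (x * q s))"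
      using ray_prim_segment[OF \<phi> z(2), of 0 x] z by simp
    also have "\<dots> = (LINT t:{0..1}|lborel. \<phi> (\<Phi> (s, t * x))) * (x * q s)"
      by simp
    also have "(LINT t:{0..1}|lborel. \<phi> (\<Phi> (s, t * x))) = ?J z"
      using borel_integrable_atLeastAtMost'[OF c] by (simp add: set_borel_integral_eq_integral z)
    finally show "q (fst z) * snd z * ?J z = ray_prim \<phi> z"
      by (simp add: z mult_ac)
  qed
qed

end

section \<open>Transport along the rays\<close>

lemma continuous_on_euclid_dist: "continuous_on S (\<lambda>z. euclid_dist d (fst z) (snd z))"
  unfolding euclid_dist_def L2_set_def
  by (intro continuous_on_real_sqrt continuous_on_sum continuous_on_power continuous_on_diff
      continuous_on_product_then_coordinatewise[OF continuous_on_fst[OF continuous_on_id]]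
      continuous_on_product_then_coordinatewise[OF continuous_on_snd[OF continuous_on_id]])

text \<open>Up to the normalization by \<open>dil\<close>, \<open>W (s, x)\<close> is the mass
  crossing abscissa \<open>x\<close> on the ray \<open>s\<close>. Its zero values at both ends
  express mass balance on each ray, \<open>Fp_far\<close> and \<open>zeta_near\<close> let all mass
  travel towards larger \<open>x\<close>, and the product form in \<open>Fm_split\<close> gives the
  independent coupling on each ray the correct second marginal.\<close>

locale ray_transport = fan +
  fixes Fp Fm W :: "real \<times> real \<Rightarrow> real" and \<zeta> M :: "real \<Rightarrow> real"
  assumes cont_Fp: "continuous_on K Fp" and cont_Fm: "continuous_on K Fm" and cont_W: "continuous_on K W"
    and Fp_nonneg: "\<And>z. z \<in> K \<Longrightarrow> 0 \<le> Fp z" and Fm_nonneg: "\<And>z. z \<in> K \<Longrightarrow> 0 \<le> Fm z"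
    and W_nonneg: "\<And>z. z \<in> K \<Longrightarrow> 0 \<le> W z"
    and W_deriv: "\<And>s x. s \<in> {0..1} \<Longrightarrow> 0 < x \<Longrightarrow> x < 2 \<Longrightarrow>
      ((\<lambda>x. W (s, x)) has_real_derivative dil (s, x) * (Fp (s, x) - Fm (s, x))) (at x)"
    and W_bdry: "\<And>s. s \<in> {0..1} \<Longrightarrow> W (s, 0) = 0" "\<And>s. s \<in> {0..1} \<Longrightarrow> W (s, 2) = 0"
    and Fp_far: "\<And>s x. (s, x) \<in> K \<Longrightarrow> 1 \<le> x \<Longrightarrow> Fp (s, x) = 0"
    and cont_zeta: "continuous_on UNIV \<zeta>" and zeta_nonneg: "\<And>x. 0 \<le> \<zeta> x"
    and zeta_near: "\<And>x. x \<le> 1 \<Longrightarrow> \<zeta> x = 0"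
    and zeta_mass: "(LINT x:{0..2}|lborel. \<zeta> x) = 1"
    and Fm_split: "\<And>z. z \<in> K \<Longrightarrow> dil z * Fm z = \<zeta> (snd z) * M (fst z)"
begin

definition fp :: "point \<Rightarrow> real" where "fp P = Fp (\<Psi> P)"
definition fm :: "point \<Rightarrow> real" where "fm P = Fm (\<Psi> P)"

lemma measurable_fp: "fp \<in> borel_measurable (restrict_space borel \<Omega>)"
  and measurable_fm: "fm \<in> borel_measurable (restrict_space borel \<Omega>)"
  unfolding fp_def fm_def
  by (intro measurable_comp_Psi measurable_K_continuous cont_Fp cont_Fm)+

lemma fp_nonneg: "P \<in> \<Omega> \<Longrightarrow> 0 \<le> fp P" and fm_nonneg: "P \<in> \<Omega> \<Longrightarrow> 0 \<le> fm P"
  by (simp_all add: fp_def fm_def Fp_nonneg Fm_nonneg Psi_in_K)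

lemma integrable_comp_Psi:
  fixes F :: "real \<times> real \<Rightarrow> real"
  assumes "continuous_on K F"
  shows "integrable leb\<Omega> (\<lambda>P. F (\<Psi> P))"
proof -
  obtain B where "\<forall>z\<in>K. \<bar>F z\<bar> \<le> B" using continuous_K_bounded[OF assms] by blast
  then show ?thesis
    by (intro integrable_leb_Omega[of _ B] measurable_comp_Psi measurable_K_continuous assms) (auto dest: Psi_in_K)
qed

lemma integral_comp_Psi:
  fixes F :: "real \<times> real \<Rightarrow> real"
  assumes "continuous_on K F"
  shows "(LINT P|leb\<Omega>. F (\<Psi> P)) = (LINT z:K|lborel. dil z * F z)"
  using integral_leb_Omega[OF measurable_comp_Psi[OF measurable_K_continuous[OF assms]]]
    set_lebesgue_integral_cong[of K lborel "\<lambda>z. dil z * F (\<Psi> (\<Phi> z))" "\<lambda>z. dil z * F z"]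
  by simp

text \<open>The \<open>x\<close>-derivative of \<open>W * g\<close> is
  \<open>dil * (Fp - Fm) * g + W * g'\<close>, and it integrates to 0. With \<open>g = 1\<close>
  this is equality of total masses, with \<open>g = ray_prim \<phi>\<close> it identifies the
  transport measure.\<close>

lemma flux_identity:
  assumes cont: "continuous_on K g"
    and deriv: "\<And>s x. s \<in> {0..1} \<Longrightarrow> 0 < x \<Longrightarrow> x < 2 \<Longrightarrow> ((\<lambda>x. g (s, x)) has_real_derivative g' (s, x)) (at x)"
    and cont': "continuous_on K g'"
  shows "(LINT z:K|lborel. dil z * (Fm z * g z)) - (LINT z:K|lborel. dil z * (Fp z * g z)) = (LINT z:K|lborel. W z * g' z)"
proof -
  let ?h = "\<lambda>z. dil z * (Fp z - Fm z) * g z + W z * g' z"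
  have c: "continuous_on K ?h"
    by (intro continuous_intros continuous_on_dil cont cont' cont_Fp cont_Fm cont_W)
  obtain B where B: "\<forall>z\<in>K. \<bar>?h z\<bar> \<le> B" using continuous_K_bounded[OF c] by blast
  have "(LINT z:K|lborel. ?h z) = 0"
  proof (rule LINT_K_deriv_x[where H = "\<lambda>z. W z * g z" and B = B])
    fix s x :: real assume sx: "s \<in> {0..1}" "0 < x" "x < 2"
    show "((\<lambda>x. W (s, x) * g (s, x)) has_real_derivative ?h (s, x)) (at x)"
      using DERIV_mult[OF W_deriv[OF sx] deriv[OF sx]] by (simp add: algebra_simps)
  qed (use B c W_bdry in \<open>auto intro!: continuous_intros cont cont_W measurable_K_continuous\<close>)
  moreover have "(LINT z:K|lborel. ?h z) = (LINT z:K|lborel. (dil z * (Fp z * g z) - dil z * (Fm z * g z)) + W z * g' z)"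
    by (rule set_lebesgue_integral_cong) (auto simp: algebra_simps)
  moreover have "\<dots> = (LINT z:K|lborel. dil z * (Fp z * g z) - dil z * (Fm z * g z)) + (LINT z:K|lborel. W z * g' z)"
    by (intro set_integral_add bddK_integrable bddK_cont continuous_intros continuous_on_dil cont cont' cont_Fp cont_Fm cont_W)
  moreover have "(LINT z:K|lborel. dil z * (Fp z * g z) - dil z * (Fm z * g z))
      = (LINT z:K|lborel. dil z * (Fp z * g z)) - (LINT z:K|lborel. dil z * (Fm z * g z))"
    by (intro set_integral_diff bddK_integrable bddK_cont continuous_intros continuous_on_dil cont cont' cont_Fp cont_Fm cont_W)
  ultimately show ?thesis by simp
qed

lemma mass_balance: "(LINT P|leb\<Omega>. fp P) = (LINT P|leb\<Omega>. fm P)"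
  using flux_identity[of "\<lambda>_. 1" "\<lambda>_. 0"]
  by (simp add: fp_def fm_def integral_comp_Psi cont_Fp cont_Fm)

lemma density_on_eq: "density_on 2 \<Omega> f = density leb\<Omega> (\<lambda>P. ennreal (f P))"
  by (simp add: density_on_def leb\<Omega>_def)

section \<open>Arbitrary transport plans between the two densities\<close>

context
  fixes \<gamma> assumes plan: "transport_plan 2 \<Omega> fp fm \<gamma>"
begin

lemma sets_plan: "sets \<gamma> = sets (restrict_space borel (\<Omega> \<times> \<Omega>))"
  and fst_plan: "distr \<gamma> (restrict_space borel \<Omega>) fst = density leb\<Omega> (\<lambda>P. ennreal (fp P))"
  and snd_plan: "distr \<gamma> (restrict_space borel \<Omega>) snd = density leb\<Omega> (\<lambda>P. ennreal (fm P))"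
  using plan by (auto simp: transport_plan_def density_on_eq)

lemma space_plan: "space \<gamma> = \<Omega> \<times> \<Omega>"
  using sets_eq_imp_space_eq[OF sets_plan] by (simp add: space_restrict_space)

lemma measurable_fst_plan: "fst \<in> measurable \<gamma> (restrict_space borel \<Omega>)"
  and measurable_snd_plan: "snd \<in> measurable \<gamma> (restrict_space borel \<Omega>)"
proof -
  have "fst \<in> measurable (restrict_space borel (\<Omega> \<times> \<Omega>)) (restrict_space borel \<Omega>)"
    "snd \<in> measurable (restrict_space borel (\<Omega> \<times> \<Omega>)) (restrict_space borel \<Omega>)"
    by (rule measurable_restrict_space3[OF borel_measurable_continuous_onI[OF continuous_on_fst[OF continuous_on_id]]],
        force, rule measurable_restrict_space3[OF borel_measurable_continuous_onI[OF continuous_on_snd[OF continuous_on_id]]],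
        force)
  then show "fst \<in> measurable \<gamma> (restrict_space borel \<Omega>)" "snd \<in> measurable \<gamma> (restrict_space borel \<Omega>)"
    using measurable_cong_sets[OF sets_plan refl] by blast+
qed

lemma finite_plan: "finite_measure \<gamma>"
proof
  have "emeasure \<gamma> (space \<gamma>) = emeasure (distr \<gamma> (restrict_space borel \<Omega>) fst) \<Omega>"
    by (subst emeasure_distr[OF measurable_fst_plan])
      (auto simp: space_plan sets_restrict_space intro!: arg_cong[where f = "emeasure \<gamma>"])
  also have "\<dots> = (\<integral>\<^sup>+ P. ennreal (fp P) * indicator \<Omega> P \<partial>leb\<Omega>)"
    unfolding fst_plan using measurable_fp
    by (subst emeasure_density) (auto simp: measurable_leb_Omega sets_leb_Omega sets_restrict_space)
  also have "\<dots> = (\<integral>\<^sup>+ P. ennreal (fp P) \<partial>leb\<Omega>)"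
    by (intro nn_integral_cong) auto
  also have "\<dots> = ennreal (LINT P|leb\<Omega>. fp P)"
    using integrable_comp_Psi[OF cont_Fp] fp_nonneg
    by (intro nn_integral_eq_integral AE_I2) (auto simp: fp_def)
  finally show "emeasure \<gamma> (space \<gamma>) \<noteq> \<infinity>" by simp
qed

lemma plan_integrals:
  assumes h: "continuous_on K h"
  shows "(LINT z|\<gamma>. h (\<Psi> (fst z))) = (LINT z:K|lborel. dil z * (Fp z * h z))"
    and "(LINT z|\<gamma>. h (\<Psi> (snd z))) = (LINT z:K|lborel. dil z * (Fm z * h z))"
    and "integrable \<gamma> (\<lambda>z. h (\<Psi> (fst z)))" "integrable \<gamma> (\<lambda>z. h (\<Psi> (snd z)))"
proof -
  have m: "(\<lambda>P. h (\<Psi> P)) \<in> borel_measurable (restrict_space borel \<Omega>)"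
    by (intro measurable_comp_Psi measurable_K_continuous h)
  have "(LINT z|\<gamma>. h (\<Psi> (fst z))) = (LINT P|distr \<gamma> (restrict_space borel \<Omega>) fst. h (\<Psi> P))"
    by (rule integral_distr[OF measurable_fst_plan m, symmetric])
  also have "\<dots> = (LINT P|leb\<Omega>. fp P * h (\<Psi> P))"
    unfolding fst_plan using m measurable_fp fp_nonneg
    by (subst integral_density) (auto simp: measurable_leb_Omega intro!: AE_I2)
  also have "\<dots> = (LINT z:K|lborel. dil z * (Fp z * h z))"
    unfolding fp_def by (rule integral_comp_Psi) (intro continuous_intros cont_Fp h)
  finally show "(LINT z|\<gamma>. h (\<Psi> (fst z))) = (LINT z:K|lborel. dil z * (Fp z * h z))" .
  have "(LINT z|\<gamma>. h (\<Psi> (snd z))) = (LINT P|distr \<gamma> (restrict_space borel \<Omega>) snd. h (\<Psi> P))"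
    by (rule integral_distr[OF measurable_snd_plan m, symmetric])
  also have "\<dots> = (LINT P|leb\<Omega>. fm P * h (\<Psi> P))"
    unfolding snd_plan using m measurable_fm fm_nonneg
    by (subst integral_density) (auto simp: measurable_leb_Omega intro!: AE_I2)
  also have "\<dots> = (LINT z:K|lborel. dil z * (Fm z * h z))"
    unfolding fm_def by (rule integral_comp_Psi) (intro continuous_intros cont_Fm h)
  finally show "(LINT z|\<gamma>. h (\<Psi> (snd z))) = (LINT z:K|lborel. dil z * (Fm z * h z))" .
  interpret finite_measure \<gamma> by (rule finite_plan)
  obtain B where B: "\<forall>z\<in>K. \<bar>h z\<bar> \<le> B" using continuous_K_bounded[OF h] by blast
  show "integrable \<gamma> (\<lambda>z. h (\<Psi> (fst z)))"
    by (rule integrable_const_bound[where B = B])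
      (use B in \<open>auto intro!: AE_I2 measurable_compose[OF measurable_fst_plan m] simp: space_plan Psi_in_K\<close>)
  show "integrable \<gamma> (\<lambda>z. h (\<Psi> (snd z)))"
    by (rule integrable_const_bound[where B = B])
      (use B in \<open>auto intro!: AE_I2 measurable_compose[OF measurable_snd_plan m] simp: space_plan Psi_in_K\<close>)
qed

text \<open>The value on the right does not involve the plan: it is the dual lower bound for the
  cost, common to all plans.\<close>

lemma pot_plan:
  shows "integrable \<gamma> (\<lambda>z. pot (snd z) - pot (fst z))"
    and "(LINT z|\<gamma>. pot (snd z) - pot (fst z))
      = (LINT z:K|lborel. dil z * (Fm z * pot (\<Phi> z))) - (LINT z:K|lborel. dil z * (Fp z * pot (\<Phi> z)))"
proof -
  note I = plan_integrals[OF continuous_on_pot_Phi]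
  have i: "integrable \<gamma> (\<lambda>z. pot (\<Phi> (\<Psi> (snd z))) - pot (\<Phi> (\<Psi> (fst z))))"
    by (intro Bochner_Integration.integrable_diff I)
  have e: "(LINT z|\<gamma>. pot (\<Phi> (\<Psi> (snd z))) - pot (\<Phi> (\<Psi> (fst z))))
    = (LINT z:K|lborel. dil z * (Fm z * pot (\<Phi> z))) - (LINT z:K|lborel. dil z * (Fp z * pot (\<Phi> z)))"
    by (subst Bochner_Integration.integral_diff) (auto simp: I)
  have c: "z \<in> space \<gamma> \<Longrightarrow> pot (\<Phi> (\<Psi> (snd z))) - pot (\<Phi> (\<Psi> (fst z))) = pot (snd z) - pot (fst z)" for z
    by (auto simp: space_plan)
  show "integrable \<gamma> (\<lambda>z. pot (snd z) - pot (fst z))"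
    by (rule Bochner_Integration.integrable_cong[THEN iffD1, OF refl _ i]) (rule c)
  show "(LINT z|\<gamma>. pot (snd z) - pot (fst z))
      = (LINT z:K|lborel. dil z * (Fm z * pot (\<Phi> z))) - (LINT z:K|lborel. dil z * (Fp z * pot (\<Phi> z)))"
    unfolding e[symmetric] by (rule Bochner_Integration.integral_cong[OF refl]) (rule c[symmetric])
qed

lemma integrable_dist: "integrable \<gamma> (\<lambda>z. euclid_dist 2 (fst z) (snd z))"
proof -
  interpret finite_measure \<gamma> by (rule finite_plan)
  let ?d = "\<lambda>z. euclid_dist 2 (fst z) (snd z)"
  have c: "continuous_on (\<Omega> \<times> \<Omega>) ?d"
    by (rule continuous_on_euclid_dist)
  have m: "?d \<in> borel_measurable \<gamma>"
    using borel_measurable_continuous_on_restrict[OF c] measurable_cong_sets[OF sets_plan refl] by blast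
  obtain B where "\<forall>z\<in>\<Omega> \<times> \<Omega>. \<bar>?d z\<bar> \<le> B"
    using compact_imp_bounded[OF compact_continuous_image[OF c compact_Times[OF compact_Omega compact_Omega]]]
    by (auto simp: bounded_iff)
  then show ?thesis
    by (intro integrable_const_bound[where B = B] AE_I2 m) (auto simp: space_plan)
qed

lemma transport_cost_eq: "transport_cost 2 \<gamma> = ennreal (LINT z|\<gamma>. euclid_dist 2 (fst z) (snd z))"
  unfolding transport_cost_def case_prod_beta
  by (intro nn_integral_eq_integral integrable_dist AE_I2) (simp add: euclid_dist_2)

lemma cost_ge: "(LINT z|\<gamma>. pot (snd z) - pot (fst z)) \<le> (LINT z|\<gamma>. euclid_dist 2 (fst z) (snd z))"
  by (intro integral_mono pot_plan integrable_dist) (auto simp: space_plan intro: pot_diff_le)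

text \<open>Complementary slackness: the Lipschitz defect is nonnegative and its integral is at most
  0.\<close>

lemma cost_eq_AE:
  assumes "(LINT z|\<gamma>. euclid_dist 2 (fst z) (snd z)) \<le> (LINT z|\<gamma>. pot (snd z) - pot (fst z))"
  shows "AE z in \<gamma>. pot (snd z) - pot (fst z) = euclid_dist 2 (fst z) (snd z)"
proof -
  let ?h = "\<lambda>z. euclid_dist 2 (fst z) (snd z) - (pot (snd z) - pot (fst z))"
  have i: "integrable \<gamma> ?h" by (intro Bochner_Integration.integrable_diff pot_plan(1) integrable_dist)
  have n: "AE z in \<gamma>. 0 \<le> ?h z"
    by (intro AE_I2) (use pot_diff_le in \<open>force simp: space_plan\<close>)
  have "(LINT z|\<gamma>. ?h z) = 0"
    using Bochner_Integration.integral_diff[OF integrable_dist pot_plan(1)] assms cost_ge by simp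
  then have "AE z in \<gamma>. ?h z = 0"
    using integral_nonneg_eq_0_iff_AE[OF i n] by simp
  then show ?thesis by (rule AE_mp) (auto intro!: AE_I2)
qed

text \<open>Almost every pair lies on one ray in the right order, so the inner integral is a
  difference of \<open>ray_prim\<close> at the endpoints. The marginals and the flux identity then
  give a value independent of the plan.\<close>

lemma plan_segments:
  assumes ae: "AE z in \<gamma>. pot (snd z) - pot (fst z) = euclid_dist 2 (fst z) (snd z)"
    and \<phi>: "continuous_on \<Omega> \<phi>"
  shows "(LINT (x, y)|\<gamma>. (LINT t:{0..1}|lborel. \<phi> (segment_point x y t) * euclid_dist 2 x y))
    = (LINT z:K|lborel. W z * (q (fst z) * \<phi> (\<Phi> z)))"
proof -
  note I = plan_integrals[OF continuous_on_ray_prim[OF \<phi>]]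
  let ?D = "\<lambda>z. ray_prim \<phi> (\<Psi> (snd z)) - ray_prim \<phi> (\<Psi> (fst z))"
  let ?L = "\<lambda>z. case z of (x, y) \<Rightarrow> (LINT t:{0..1}|lborel. \<phi> (segment_point x y t) * euclid_dist 2 x y)"
  have iD: "integrable \<gamma> ?D" by (intro Bochner_Integration.integrable_diff I)
  have ae': "AE z in \<gamma>. ?D z = ?L z"
    using ae
  proof (rule AE_mp, intro AE_I2 impI)
    fix z assume z: "z \<in> space \<gamma>" and eq: "pot (snd z) - pot (fst z) = euclid_dist 2 (fst z) (snd z)"
    obtain P Q where PQ: "z = (P, Q)" "P \<in> \<Omega>" "Q \<in> \<Omega>" using z by (auto simp: space_plan)
    obtain s x w where sx: "\<Psi> P = (s, x)" "\<Psi> Q = (s, w)" "x \<le> w"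
      using pot_diff_eq_dist[OF PQ(2,3)] eq PQ(1) by (metis fst_conv prod.collapse snd_conv)
    have "(s, x) \<in> K" "(s, w) \<in> K"
      using Psi_in_K[OF PQ(2)] Psi_in_K[OF PQ(3)] sx by auto
    moreover have "P = \<Phi> (s, x)" "Q = \<Phi> (s, w)"
      using sx PQ Phi_Psi by metis+
    ultimately show "?D z = ?L z"
      using ray_prim_segment[OF \<phi>, of s x w] sx(3)
      by (simp add: PQ(1) segment_point_on_ray dist_on_ray K_def)
  qed
  have pD: "(\<lambda>z. ?L z) \<in> borel_measurable \<gamma> \<Longrightarrow> (LINT z|\<gamma>. ?L z) = (LINT z|\<gamma>. ?D z)"
    using ae' iD by (intro integral_cong_AE) auto
  \<comment> \<open>Agreement almost everywhere with \<open>?D\<close> does not give measurability,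
    as \<open>\<gamma>\<close> may be incomplete. It comes from continuity of the parameter integral
    over segments, which stay in \<open>\<Omega>\<close> by convexity.\<close>
  have m: "?L \<in> borel_measurable \<gamma>"
  proof -
    let ?f = "\<lambda>z t. \<phi> (segment_point (fst z) (snd z) t) * euclid_dist 2 (fst z) (snd z)"
    have seg: "continuous_on ((\<Omega> \<times> \<Omega>) \<times> {0..1}) (\<lambda>w. segment_point (fst (fst w)) (snd (fst w)) (snd w))"
      unfolding segment_point_def
      by (rule continuous_on_coordinatewise_then_product)
        (intro continuous_on_add continuous_on_mult continuous_on_diff continuous_on_const
          continuous_on_snd[OF continuous_on_id]
          continuous_on_product_then_coordinatewise[OF continuous_on_fst[OF continuous_on_fst[OF continuous_on_id]]]
          continuous_on_product_then_coordinatewise[OF continuous_on_snd[OF continuous_on_fst[OF continuous_on_id]]])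
    have c: "continuous_on ((\<Omega> \<times> \<Omega>) \<times> {0..1}) (\<lambda>w. ?f (fst w) (snd w))"
      by (intro continuous_on_mult continuous_on_compose2[OF \<phi> seg]
          continuous_on_compose2[OF continuous_on_euclid_dist continuous_on_fst[OF continuous_on_id]])
        (use convex_Omega in \<open>auto simp: convex_set_def\<close>)
    then have "continuous_on ((\<Omega> \<times> \<Omega>) \<times> cbox 0 1) (\<lambda>(z, t). ?f z t)"
      by (simp add: case_prod_unfold)
    from integral_continuous_on_param[OF this]
    have "continuous_on (\<Omega> \<times> \<Omega>) (\<lambda>z. integral {0..1} (?f z))" by simp
    moreover have "integral {0..1} (?f z) = ?L z" if "z \<in> \<Omega> \<times> \<Omega>" for z
    proof -
      have "continuous_on {0..1} (\<lambda>t. ?f (fst (z, t)) (snd (z, t)))"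
        by (rule continuous_on_compose2[OF c]) (use that in \<open>auto intro!: continuous_intros\<close>)
      then have "continuous_on {0..1} (?f z)" by simp
      from set_borel_integral_eq_integral(2)[OF borel_integrable_atLeastAtMost'[OF this]]
      show ?thesis unfolding case_prod_beta by (rule sym)
    qed
    ultimately have "continuous_on (\<Omega> \<times> \<Omega>) ?L"
      by (rule continuous_on_eq)
    from borel_measurable_continuous_on_restrict[OF this] show ?thesis
      using measurable_cong_sets[OF sets_plan refl] by blast
  qed
  have "(LINT z|\<gamma>. ?L z) = (LINT z|\<gamma>. ?D z)"
    by (rule pD[OF m])
  also have "\<dots> = (LINT z:K|lborel. dil z * (Fm z * ray_prim \<phi> z)) - (LINT z:K|lborel. dil z * (Fp z * ray_prim \<phi> z))"
    by (subst Bochner_Integration.integral_diff) (auto simp: I)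
  also have "\<dots> = (LINT z:K|lborel. W z * (q (fst z) * \<phi> (\<Phi> z)))"
  proof (rule flux_identity)
    show "continuous_on K (ray_prim \<phi>)" by (rule continuous_on_ray_prim[OF \<phi>])
    show "continuous_on K (\<lambda>z. q (fst z) * \<phi> (\<Phi> z))"
      by (intro continuous_intros continuous_on_compose2[OF \<phi> continuous_on_Phi]) (auto simp: \<Omega>_def)
  qed (use ray_prim_deriv[OF \<phi>] in auto)
  finally show ?thesis .
qed

end

text \<open>Integrating the derivative of \<open>W\<close> along the ray gives 0, so source and
  target mass on the ray agree; the latter is \<open>M s\<close> because \<open>\<zeta>\<close> has
  integral 1.\<close>

lemma ray_mass:
  assumes s: "s \<in> {0..1}"
  shows "(LINT x:{0..2}|lborel. dil (s, x) * Fp (s, x)) = M s"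
proof -
  have line: "continuous_on {0..2} (\<lambda>x. F (s, x))" if "continuous_on K F" for F :: "_ \<Rightarrow> real"
    by (rule continuous_on_compose2[OF that]) (use s in \<open>auto simp: K_def intro!: continuous_intros\<close>)
  have cp: "continuous_on {0..2} (\<lambda>x. dil (s, x) * Fp (s, x))"
    by (intro continuous_on_mult line continuous_on_dil cont_Fp)
  have cm: "continuous_on {0..2} (\<lambda>x. dil (s, x) * Fm (s, x))"
    by (intro continuous_on_mult line continuous_on_dil cont_Fm)
  have c: "continuous_on {0..2} (\<lambda>x. dil (s, x) * (Fp (s, x) - Fm (s, x)))"
    by (intro continuous_on_mult continuous_on_diff line continuous_on_dil cont_Fm cont_Fp)
  obtain B where B: "\<forall>x\<in>{0..2}. \<bar>dil (s, x) * (Fp (s, x) - Fm (s, x))\<bar> \<le> B"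
    using compact_imp_bounded[OF compact_continuous_image[OF c]] by (auto simp: bounded_iff)
  have "(LINT x:{0..2}|lborel. dil (s, x) * (Fp (s, x) - Fm (s, x))) = W (s, 2) - W (s, 0)"
    by (rule LINT_deriv(2)[where B = B])
      (use W_deriv[OF s] B borel_measurable_continuous_on_indicator[OF _ c] line[OF cont_W]
        in \<open>auto simp: set_borel_measurable_def\<close>)
  then have "0 = (LINT x:{0..2}|lborel. dil (s, x) * Fp (s, x) - dil (s, x) * Fm (s, x))"
    by (simp add: W_bdry(1)[OF s] W_bdry(2)[OF s] right_diff_distrib)
  also have "\<dots> = (LINT x:{0..2}|lborel. dil (s, x) * Fp (s, x)) - (LINT x:{0..2}|lborel. dil (s, x) * Fm (s, x))"
    by (intro set_integral_diff borel_integrable_atLeastAtMost' cp cm)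
  also have "(LINT x:{0..2}|lborel. dil (s, x) * Fm (s, x)) = (LINT x:{0..2}|lborel. M s * \<zeta> x)"
    by (rule set_lebesgue_integral_cong) (use s Fm_split in \<open>auto simp: K_def\<close>)
  also have "\<dots> = M s"
    by (simp add: zeta_mass)
  finally show ?thesis by simp
qed

lemma zeta_nn: "(\<integral>\<^sup>+ y. ennreal (\<zeta> y) * indicator {0..2} y \<partial>lborel) = 1"
proof -
  have i: "set_integrable lborel {0..2} \<zeta>"
    by (rule borel_integrable_atLeastAtMost') (rule continuous_on_subset[OF cont_zeta], simp)
  have "(\<integral>\<^sup>+ y. ennreal (\<zeta> y) * indicator {0..2} y \<partial>lborel) = (\<integral>\<^sup>+ y. ennreal (indicator {0..2} y *\<^sub>R \<zeta> y) \<partial>lborel)"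
    by (intro nn_integral_cong) (auto split: split_indicator)
  also have "\<dots> = ennreal (LINT x:{0..2}|lborel. \<zeta> x)"
    unfolding set_lebesgue_integral_def
    by (intro nn_integral_eq_integral AE_I2) (use i zeta_nonneg in \<open>auto simp: set_integrable_def\<close>)
  finally show ?thesis by (simp add: zeta_mass)
qed

lemma ray_mass_nn:
  assumes s: "s \<in> {0..1}"
  shows "(\<integral>\<^sup>+ x. ennreal (dil (s, x) * Fp (s, x)) * indicator {0..2} x \<partial>lborel) = ennreal (M s)"
proof -
  have c: "continuous_on {0..2} (\<lambda>x. dil (s, x) * Fp (s, x))"
    by (intro continuous_on_mult continuous_on_compose2[OF continuous_on_dil[of K]] continuous_on_compose2[OF cont_Fp])
      (use s in \<open>auto simp: K_def intro!: continuous_intros\<close>)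
  have "(\<integral>\<^sup>+ x. ennreal (dil (s, x) * Fp (s, x)) * indicator {0..2} x \<partial>lborel)
      = (\<integral>\<^sup>+ x. ennreal (indicator {0..2} x *\<^sub>R (dil (s, x) * Fp (s, x))) \<partial>lborel)"
    by (intro nn_integral_cong) (auto split: split_indicator)
  also have "\<dots> = ennreal (LINT x:{0..2}|lborel. dil (s, x) * Fp (s, x))"
    unfolding set_lebesgue_integral_def
    by (intro nn_integral_eq_integral AE_I2)
      (use borel_integrable_atLeastAtMost'[OF c] s Fp_nonneg dil_nonneg in
        \<open>auto simp: set_integrable_def K_def split: split_indicator\<close>)
  finally show ?thesis by (simp add: ray_mass[OF s])
qed

section \<open>An explicit optimal coupling\<close>

abbreviation pairs :: "((real \<times> real) \<times> real) measure"
  where "pairs \<equiv> lebK \<Otimes>\<^sub>M restrict_space lborel {0..2}"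

text \<open>A point \<open>((s, x), y)\<close> stands for a source point and the abscissa of a
  target point on the same ray. The ray mass \<open>M s\<close> is absent from the weight, since the
  integral of \<open>dil * Fp\<close> along the ray supplies it.\<close>

definition coupling_base :: "((real \<times> real) \<times> real) measure"
  where "coupling_base = density (pairs) (\<lambda>w. ennreal (Fp (fst w) * \<zeta> (snd w)))"

definition coupling_map :: "(real \<times> real) \<times> real \<Rightarrow> point \<times> point"
  where "coupling_map w = (\<Phi> (fst w), \<Phi> (fst (fst w), snd w))"

text \<open>On every ray, source and target mass are coupled independently.\<close>

definition coupling :: "(point \<times> point) measure"
  where "coupling = distr coupling_base (restrict_space borel (\<Omega> \<times> \<Omega>)) coupling_map"

lemma space_coupling_base: "space coupling_base = K \<times> {0..2}"
  by (simp add: coupling_base_def space_pair_measure space_restrict_space)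

lemma measurable_fst_base:
  assumes "h \<in> measurable (restrict_space borel K) N"
  shows "(\<lambda>w. h (fst w)) \<in> measurable (pairs) N"
  by (rule measurable_compose[OF measurable_fst]) (use assms measurable_cong_sets[OF sets_lebK refl] in blast)

lemma measurable_snd_base:
  assumes "h \<in> measurable borel N"
  shows "(\<lambda>w. h (snd w)) \<in> measurable (pairs) N"
  by (rule measurable_compose[OF measurable_snd]) (use assms in \<open>auto intro: measurable_restrict_space1\<close>)

lemma measurable_second_endpoint:
  "(\<lambda>w. \<Phi> (fst (fst w), snd w)) \<in> measurable (pairs) (restrict_space borel \<Omega>)"
proof (rule measurable_restrict_space2)
  show "(\<lambda>w. \<Phi> (fst (fst w), snd w)) \<in> space (pairs) \<rightarrow> \<Omega>"
    by (auto simp: space_pair_measure space_restrict_space \<Omega>_def K_def)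
  have "(\<lambda>w. (fst (fst w), snd w)) \<in> borel_measurable (pairs)"
    by (rule borel_measurable_Pair)
      (auto intro!: measurable_fst_base measurable_snd_base measurable_restrict_space1
        borel_measurable_continuous_onI continuous_intros)
  from measurable_compose[OF this borel_measurable_continuous_onI[OF continuous_on_Phi]]
  show "(\<lambda>w. \<Phi> (fst (fst w), snd w)) \<in> borel_measurable (pairs)" .
qed

lemma measurable_coupling_density:
  "(\<lambda>w. ennreal (Fp (fst w) * \<zeta> (snd w))) \<in> borel_measurable (pairs)"
  using measurable_fst_base[OF measurable_K_continuous[OF cont_Fp]]
    measurable_snd_base[OF borel_measurable_continuous_onI[OF cont_zeta]] by measurable

lemma measurable_coupling_map:
  "coupling_map \<in> measurable coupling_base (restrict_space borel (\<Omega> \<times> \<Omega>))"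
proof (rule measurable_restrict_space2)
  show "coupling_map \<in> space coupling_base \<rightarrow> \<Omega> \<times> \<Omega>"
    by (auto simp: coupling_map_def space_coupling_base \<Omega>_def K_def)
  have "(\<lambda>w. \<Phi> (fst w)) \<in> borel_measurable (pairs)"
    by (rule measurable_fst_base) (auto intro!: measurable_restrict_space1 borel_measurable_continuous_onI continuous_on_Phi)
  moreover have "(\<lambda>w. \<Phi> (fst (fst w), snd w)) \<in> borel_measurable (pairs)"
    using measurable_second_endpoint by (simp add: measurable_restrict_space2_iff)
  ultimately have "coupling_map \<in> borel_measurable (pairs)"
    unfolding coupling_map_def[abs_def] by (rule borel_measurable_Pair)
  then show "coupling_map \<in> borel_measurable coupling_base"
    by (simp add: coupling_base_def)
qed

lemma nn_integral_coupling_base: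
  assumes "h \<in> borel_measurable (pairs)"
  shows "(\<integral>\<^sup>+ w. h w \<partial>coupling_base) = (\<integral>\<^sup>+ z. ennreal (Fp z) *
    (\<integral>\<^sup>+ y. ennreal (\<zeta> y) * indicator {0..2} y * h (z, y) \<partial>lborel) \<partial>lebK)"
proof -
  interpret S: sigma_finite_measure "restrict_space lborel {0..2::real}"
    by (rule finite_measure.axioms(1)[OF finite_measureI])
      (simp add: emeasure_restrict_space space_restrict_space)
  have sec: "(\<lambda>y. h (z, y)) \<in> borel_measurable (restrict_space lborel {0..2::real})" if "z \<in> space lebK" for z
    using measurable_compose[OF measurable_Pair1'[OF that] assms] .
  have zr: "(\<lambda>y. ennreal (\<zeta> y)) \<in> borel_measurable (restrict_space lborel {0..2::real})"
    using borel_measurable_continuous_onI[OF cont_zeta] by (auto intro!: measurable_restrict_space1)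
  have "(\<integral>\<^sup>+ w. h w \<partial>coupling_base)
      = (\<integral>\<^sup>+ w. ennreal (Fp (fst w) * \<zeta> (snd w)) * h w \<partial>(pairs))"
    unfolding coupling_base_def by (rule nn_integral_density[OF measurable_coupling_density assms])
  also have "\<dots> = (\<integral>\<^sup>+ z. \<integral>\<^sup>+ y. ennreal (Fp z * \<zeta> y) * h (z, y) \<partial>restrict_space lborel {0..2::real} \<partial>lebK)"
    by (subst S.nn_integral_fst[symmetric])
      (auto intro!: borel_measurable_times_ennreal measurable_coupling_density assms)
  also have "\<dots> = (\<integral>\<^sup>+ z. ennreal (Fp z) *
    (\<integral>\<^sup>+ y. ennreal (\<zeta> y) * indicator {0..2} y * h (z, y) \<partial>lborel) \<partial>lebK)"
  proof (rule nn_integral_cong)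
    fix z assume z: "z \<in> space lebK"
    have "(\<integral>\<^sup>+ y. ennreal (Fp z * \<zeta> y) * h (z, y) \<partial>restrict_space lborel {0..2::real})
        = (\<integral>\<^sup>+ y. ennreal (Fp z) * (ennreal (\<zeta> y) * h (z, y)) \<partial>restrict_space lborel {0..2::real})"
      using z Fp_nonneg zeta_nonneg by (intro nn_integral_cong) (simp add: ennreal_mult mult.assoc)
    also have "\<dots> = ennreal (Fp z) * (\<integral>\<^sup>+ y. ennreal (\<zeta> y) * h (z, y) \<partial>restrict_space lborel {0..2::real})"
      by (intro nn_integral_cmult borel_measurable_times_ennreal zr sec z)
    also have "(\<integral>\<^sup>+ y. ennreal (\<zeta> y) * h (z, y) \<partial>restrict_space lborel {0..2::real})
        = (\<integral>\<^sup>+ y. ennreal (\<zeta> y) * indicator {0..2} y * h (z, y) \<partial>lborel)"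
      by (subst nn_integral_restrict_space) (auto intro!: nn_integral_cong simp: mult_ac)
    finally show "(\<integral>\<^sup>+ y. ennreal (Fp z * \<zeta> y) * h (z, y) \<partial>restrict_space lborel {0..2::real}) = ennreal (Fp z) *
      (\<integral>\<^sup>+ y. ennreal (\<zeta> y) * indicator {0..2} y * h (z, y) \<partial>lborel)" .
  qed
  finally show ?thesis .
qed

lemma nn_integral_lebK:
  assumes "h \<in> borel_measurable (restrict_space borel K)"
  shows "(\<integral>\<^sup>+ z. h z \<partial>lebK) = (\<integral>\<^sup>+ s. (\<integral>\<^sup>+ x. ennreal (dil (s, x)) * h (s, x) * indicator {0..2} x \<partial>lborel) * indicator {0..1} s \<partial>lborel)"
proof -
  have m: "(\<lambda>z. h z * indicator K z) \<in> borel_measurable borel"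
    using assms by (subst borel_measurable_restrict_space_iff_ennreal[symmetric]) auto
  have m2: "(\<lambda>z. ennreal (dil z) * (h z * indicator K z)) \<in> borel_measurable (lborel \<Otimes>\<^sub>M lborel)"
    unfolding lborel_prod using m by measurable
  have "(\<integral>\<^sup>+ z. h z \<partial>lebK) = (\<integral>\<^sup>+ z. ennreal (dil z) * h z \<partial>restrict_space lborel K)"
    unfolding lebK_def
    by (rule nn_integral_density) (use assms in \<open>auto simp: measurable_lborelK intro!: measurable_restrict_space1\<close>)
  also have "\<dots> = (\<integral>\<^sup>+ z. ennreal (dil z) * (h z * indicator K z) \<partial>(lborel \<Otimes>\<^sub>M lborel))"
    unfolding lborel_prod by (subst nn_integral_restrict_space) (auto simp: mult_ac)
  also have "\<dots> = (\<integral>\<^sup>+ s. \<integral>\<^sup>+ x. ennreal (dil (s, x)) * (h (s, x) * indicator K (s, x)) \<partial>lborel \<partial>lborel)"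
    by (rule lborel.nn_integral_fst[OF m2, symmetric])
  also have "\<dots> = (\<integral>\<^sup>+ s. (\<integral>\<^sup>+ x. ennreal (dil (s, x)) * h (s, x) * indicator {0..2} x \<partial>lborel) * indicator {0..1} s \<partial>lborel)"
  proof (rule nn_integral_cong)
    fix s :: real
    show "(\<integral>\<^sup>+ x. ennreal (dil (s, x)) * (h (s, x) * indicator K (s, x)) \<partial>lborel) =
      (\<integral>\<^sup>+ x. ennreal (dil (s, x)) * h (s, x) * indicator {0..2} x \<partial>lborel) * indicator {0..1} s"
      by (cases "s \<in> {0..1}") (auto simp: K_def indicator_times mult_ac intro!: nn_integral_cong)
  qed
  finally show ?thesis .
qed

text \<open>The first marginal is right because \<open>\<zeta>\<close> has integral 1; for the
  second the source is integrated out along each ray, which leaves \<open>M s * \<zeta> y\<close>,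
  that is, \<open>dil * Fm\<close>.\<close>

lemma coupling_plan: "transport_plan 2 \<Omega> fp fm coupling"
proof -
  have fst_m: "fst \<in> measurable (restrict_space borel (\<Omega> \<times> \<Omega>)) (restrict_space borel \<Omega>)"
    by (rule measurable_restrict_space3[OF borel_measurable_continuous_onI[OF continuous_on_fst[OF continuous_on_id]]]) force
  have snd_m: "snd \<in> measurable (restrict_space borel (\<Omega> \<times> \<Omega>)) (restrict_space borel \<Omega>)"
    by (rule measurable_restrict_space3[OF borel_measurable_continuous_onI[OF continuous_on_snd[OF continuous_on_id]]]) force
  have mf: "\<And>X. X \<in> sets (restrict_space borel \<Omega>) \<Longrightarrow>
      emeasure (density leb\<Omega> (\<lambda>P. ennreal (f P))) X = (\<integral>\<^sup>+ z. ennreal (f (\<Phi> z)) * indicator X (\<Phi> z) \<partial>lebK)"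
    if f: "f \<in> borel_measurable (restrict_space borel \<Omega>)" for f :: "point \<Rightarrow> real"
  proof -
    fix X assume X: "X \<in> sets (restrict_space borel \<Omega>)"
    have "emeasure (density leb\<Omega> (\<lambda>P. ennreal (f P))) X = (\<integral>\<^sup>+ P. ennreal (f P) * indicator X P \<partial>leb\<Omega>)"
      using f X by (subst emeasure_density) (auto simp: measurable_leb_Omega sets_leb_Omega)
    also have "\<dots> = (\<integral>\<^sup>+ z. ennreal (f (\<Phi> z)) * indicator X (\<Phi> z) \<partial>lebK)"
      using f X by (intro nn_integral_leb_Omega borel_measurable_times_ennreal borel_measurable_indicator) auto
    finally show "emeasure (density leb\<Omega> (\<lambda>P. ennreal (f P))) X = (\<integral>\<^sup>+ z. ennreal (f (\<Phi> z)) * indicator X (\<Phi> z) \<partial>lebK)" .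
  qed
  have "distr coupling (restrict_space borel \<Omega>) fst = density leb\<Omega> (\<lambda>P. ennreal (fp P))"
  proof (rule measure_eqI)
    fix X assume "X \<in> sets (distr coupling (restrict_space borel \<Omega>) fst)"
    then have X: "X \<in> sets (restrict_space borel \<Omega>)" by simp
    have "emeasure (distr coupling (restrict_space borel \<Omega>) fst) X = (\<integral>\<^sup>+ P. indicator X P \<partial>distr coupling (restrict_space borel \<Omega>) fst)"
      using X by simp
    also have "\<dots> = (\<integral>\<^sup>+ w. indicator X (\<Phi> (fst w)) \<partial>coupling_base)"
      unfolding coupling_def using X
      by (subst nn_integral_distr, simp add: fst_m, simp)
        (subst nn_integral_distr[OF measurable_coupling_map], auto intro: measurable_compose[OF fst_m] simp: coupling_map_def)
    also have "\<dots> = (\<integral>\<^sup>+ z. ennreal (Fp z) *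
        (\<integral>\<^sup>+ y. ennreal (\<zeta> y) * indicator {0..2} y * indicator X (\<Phi> z) \<partial>lborel) \<partial>lebK)"
      using X by (subst nn_integral_coupling_base)
        (auto intro!: measurable_compose[OF measurable_fst_base[OF measurable_Phi]])
    also have "\<dots> = (\<integral>\<^sup>+ z. ennreal (fp (\<Phi> z)) * indicator X (\<Phi> z) \<partial>lebK)"
    proof (rule nn_integral_cong)
      fix z assume "z \<in> space lebK"
      have "(\<integral>\<^sup>+ y. ennreal (\<zeta> y) * indicator {0..2} y * indicator X (\<Phi> z) \<partial>lborel) = indicator X (\<Phi> z)"
        using borel_measurable_continuous_onI[OF cont_zeta]
        by (subst nn_integral_multc) (auto simp: zeta_nn)
      then show "ennreal (Fp z) * (\<integral>\<^sup>+ y. ennreal (\<zeta> y) * indicator {0..2} y * indicator X (\<Phi> z) \<partial>lborel)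
        = ennreal (fp (\<Phi> z)) * indicator X (\<Phi> z)"
        using \<open>z \<in> space lebK\<close> by (simp add: fp_def)
    qed
    also have "\<dots> = emeasure (density leb\<Omega> (\<lambda>P. ennreal (fp P))) X"
      by (rule mf[OF measurable_fp X, symmetric])
    finally show "emeasure (distr coupling (restrict_space borel \<Omega>) fst) X = emeasure (density leb\<Omega> (\<lambda>P. ennreal (fp P))) X" .
  qed (simp add: sets_leb_Omega)
  moreover have "distr coupling (restrict_space borel \<Omega>) snd = density leb\<Omega> (\<lambda>P. ennreal (fm P))"
  proof (rule measure_eqI)
    fix X assume "X \<in> sets (distr coupling (restrict_space borel \<Omega>) snd)"
    then have X: "X \<in> sets (restrict_space borel \<Omega>)" by simp
    let ?I = "\<lambda>z. indicator X (\<Phi> z) * indicator K z :: ennreal"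
    let ?J = "\<lambda>s. \<integral>\<^sup>+ y. ennreal (\<zeta> y) * indicator {0..2} y * ?I (s, y) \<partial>lborel"
    have hm: "(\<lambda>w. indicator X (\<Phi> (fst (fst w), snd w)) :: ennreal) \<in> borel_measurable (pairs)"
      using X by (intro measurable_compose[OF measurable_second_endpoint]) auto
    have Im: "?I \<in> borel_measurable (lborel \<Otimes>\<^sub>M lborel)"
      unfolding lborel_prod measurable_lborel1
      using X by (subst borel_measurable_restrict_space_iff_ennreal[symmetric])
        (auto intro: measurable_compose[OF measurable_Phi])
    have zm: "\<zeta> \<in> borel_measurable borel"
      by (rule borel_measurable_continuous_onI[OF cont_zeta])
    have Is: "(\<lambda>y. ?I (s, y)) \<in> borel_measurable borel" for s
      using measurable_compose[OF measurable_Pair1' Im, of s] by simp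
    have Jm: "?J \<in> borel_measurable borel"
    proof -
      have "(\<lambda>(s, y). ennreal (\<zeta> y) * indicator {0..2} y * ?I (s, y)) \<in> borel_measurable (lborel \<Otimes>\<^sub>M lborel)"
        unfolding case_prod_beta prod.collapse
        by (intro borel_measurable_times_ennreal Im measurable_compose[OF measurable_snd]) (use zm in auto)
      from lborel.borel_measurable_nn_integral[OF this] show ?thesis by simp
    qed
    have "emeasure (distr coupling (restrict_space borel \<Omega>) snd) X = (\<integral>\<^sup>+ P. indicator X P \<partial>distr coupling (restrict_space borel \<Omega>) snd)"
      using X by simp
    also have "\<dots> = (\<integral>\<^sup>+ w. indicator X (\<Phi> (fst (fst w), snd w)) \<partial>coupling_base)"
      unfolding coupling_def using X
      by (subst nn_integral_distr, simp add: snd_m, simp)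
        (subst nn_integral_distr[OF measurable_coupling_map], auto intro: measurable_compose[OF snd_m] simp: coupling_map_def)
    also have "\<dots> = (\<integral>\<^sup>+ z. ennreal (Fp z) * ?J (fst z) \<partial>lebK)"
    proof (subst nn_integral_coupling_base[OF hm], rule nn_integral_cong)
      fix z assume "z \<in> space lebK"
      then have "(\<integral>\<^sup>+ y. ennreal (\<zeta> y) * indicator {0..2} y * indicator X (\<Phi> (fst (fst (z, y)), snd (z, y))) \<partial>lborel) = ?J (fst z)"
        by (intro nn_integral_cong) (auto simp: K_def split: split_indicator)
      then show "ennreal (Fp z) * (\<integral>\<^sup>+ y. ennreal (\<zeta> y) * indicator {0..2} y * indicator X (\<Phi> (fst (fst (z, y)), snd (z, y))) \<partial>lborel)
        = ennreal (Fp z) * ?J (fst z)" by simp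
    qed
    \<comment> \<open>The inner integral depends on the source point only through its ray, so the
      abscissa \<open>x\<close> integrates out to \<open>M s\<close>.\<close>
    also have "\<dots> = (\<integral>\<^sup>+ s. ennreal (M s) * ?J s * indicator {0..1} s \<partial>lborel)"
    proof (subst nn_integral_lebK)
      show "(\<lambda>z. ennreal (Fp z) * ?J (fst z)) \<in> borel_measurable (restrict_space borel K)"
        using measurable_K_continuous[OF cont_Fp]
        by (intro borel_measurable_times_ennreal measurable_compose[OF _ Jm])
          (auto intro!: measurable_restrict_space1 borel_measurable_continuous_onI continuous_intros)
      show "(\<integral>\<^sup>+ s. (\<integral>\<^sup>+ x. ennreal (dil (s, x)) * (ennreal (Fp (s, x)) * ?J (fst (s, x))) * indicator {0..2} x \<partial>lborel) * indicator {0..1} s \<partial>lborel)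
        = (\<integral>\<^sup>+ s. ennreal (M s) * ?J s * indicator {0..1} s \<partial>lborel)"
      proof (rule nn_integral_cong)
        fix s :: real
        show "(\<integral>\<^sup>+ x. ennreal (dil (s, x)) * (ennreal (Fp (s, x)) * ?J (fst (s, x))) * indicator {0..2} x \<partial>lborel) * indicator {0..1} s
          = ennreal (M s) * ?J s * indicator {0..1} s"
        proof (cases "s \<in> {0..1}")
          case True
          have m: "(\<lambda>x. ennreal (dil (s, x) * Fp (s, x)) * indicator {0..2} x) \<in> borel_measurable borel"
          proof -
            have "continuous_on {0..2} (\<lambda>x. dil (s, x) * Fp (s, x))"
              by (intro continuous_on_mult continuous_on_compose2[OF continuous_on_dil[of K]] continuous_on_compose2[OF cont_Fp])
                (use True in \<open>auto simp: K_def intro!: continuous_intros\<close>)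
            from borel_measurable_continuous_on_indicator[OF _ this]
            have "(\<lambda>x. ennreal (indicator {0..2} x *\<^sub>R (dil (s, x) * Fp (s, x)))) \<in> borel_measurable borel" by simp
            also have "(\<lambda>x. ennreal (indicator {0..2} x *\<^sub>R (dil (s, x) * Fp (s, x)))) = (\<lambda>x. ennreal (dil (s, x) * Fp (s, x)) * indicator {0..2} x)"
              by (auto split: split_indicator)
            finally show ?thesis .
          qed
          have "(\<integral>\<^sup>+ x. ennreal (dil (s, x)) * (ennreal (Fp (s, x)) * ?J (fst (s, x))) * indicator {0..2} x \<partial>lborel)
            = (\<integral>\<^sup>+ x. (ennreal (dil (s, x) * Fp (s, x)) * indicator {0..2} x) * ?J s \<partial>lborel)"
          proof (rule nn_integral_cong)
            fix x :: real
            show "ennreal (dil (s, x)) * (ennreal (Fp (s, x)) * ?J (fst (s, x))) * indicator {0..2} x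
              = (ennreal (dil (s, x) * Fp (s, x)) * indicator {0..2} x) * ?J s"
            proof (cases "x \<in> {0..2}")
              case x: True
              then have "(s, x) \<in> K" using True by (simp add: K_def)
              then show ?thesis
                using dil_nonneg[of "(s, x)"] Fp_nonneg[of "(s, x)"] by (simp add: ennreal_mult mult_ac)
            qed simp
          qed
          also have "\<dots> = ennreal (M s) * ?J s"
            using m by (subst nn_integral_multc) (auto simp: ray_mass_nn[OF True])
          finally show ?thesis by simp
        qed simp
      qed
    qed
    also have "\<dots> = (\<integral>\<^sup>+ z. ennreal (fm (\<Phi> z)) * indicator X (\<Phi> z) \<partial>lebK)"
    proof (subst nn_integral_lebK)
      show "(\<lambda>z. ennreal (fm (\<Phi> z)) * indicator X (\<Phi> z)) \<in> borel_measurable (restrict_space borel K)"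
        using X measurable_fm by (intro borel_measurable_times_ennreal measurable_compose[OF measurable_Phi]) auto
      show "(\<integral>\<^sup>+ s. ennreal (M s) * ?J s * indicator {0..1} s \<partial>lborel)
        = (\<integral>\<^sup>+ s. (\<integral>\<^sup>+ x. ennreal (dil (s, x)) * (ennreal (fm (\<Phi> (s, x))) * indicator X (\<Phi> (s, x))) * indicator {0..2} x \<partial>lborel) * indicator {0..1} s \<partial>lborel)"
      proof (rule nn_integral_cong)
        fix s :: real
        show "ennreal (M s) * ?J s * indicator {0..1} s
          = (\<integral>\<^sup>+ x. ennreal (dil (s, x)) * (ennreal (fm (\<Phi> (s, x))) * indicator X (\<Phi> (s, x))) * indicator {0..2} x \<partial>lborel) * indicator {0..1} s"
        proof (cases "s \<in> {0..1}")
          case True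
          have "ennreal (M s) * ?J s = (\<integral>\<^sup>+ y. ennreal (M s) * (ennreal (\<zeta> y) * indicator {0..2} y * ?I (s, y)) \<partial>lborel)"
            by (rule nn_integral_cmult[symmetric]) (use zm Is in measurable)
          also have "\<dots> = (\<integral>\<^sup>+ x. ennreal (dil (s, x)) * (ennreal (fm (\<Phi> (s, x))) * indicator X (\<Phi> (s, x))) * indicator {0..2} x \<partial>lborel)"
          proof (rule nn_integral_cong)
            fix x :: real
            show "ennreal (M s) * (ennreal (\<zeta> x) * indicator {0..2} x * ?I (s, x))
              = ennreal (dil (s, x)) * (ennreal (fm (\<Phi> (s, x))) * indicator X (\<Phi> (s, x))) * indicator {0..2} x"
            proof (cases "x \<in> {0..2}")
              case x: True
              then have K: "(s, x) \<in> K" using True by (simp add: K_def)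
              have "ennreal (dil (s, x)) * ennreal (Fm (s, x)) = ennreal (\<zeta> x) * ennreal (M s)"
                using Fm_split[OF K] dil_nonneg[OF K] Fm_nonneg[OF K] zeta_nonneg[of x] ennreal_mult'[of "\<zeta> x" "M s"]
                by (simp flip: ennreal_mult)
              then show ?thesis
                using x K by (cases "\<Phi> (s, x) \<in> X") (auto simp: fm_def mult_ac)
            qed simp
          qed
          finally show ?thesis by simp
        qed simp
      qed
    qed
    also have "\<dots> = emeasure (density leb\<Omega> (\<lambda>P. ennreal (fm P))) X"
      by (rule mf[OF measurable_fm X, symmetric])
    finally show "emeasure (distr coupling (restrict_space borel \<Omega>) snd) X = emeasure (density leb\<Omega> (\<lambda>P. ennreal (fm P))) X" .
  qed (simp add: sets_leb_Omega)
  ultimately show ?thesis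
    by (simp add: transport_plan_def density_on_eq coupling_def)
qed

text \<open>Positive weight means \<open>Fp (s, x) \<noteq> 0\<close> and
  \<open>\<zeta> y \<noteq> 0\<close>, hence \<open>x < 1 < y\<close>: mass moves forward on its
  ray, where distance and potential difference agree.\<close>

lemma coupling_cost:
  "(LINT z|coupling. euclid_dist 2 (fst z) (snd z)) = (LINT z|coupling. pot (snd z) - pot (fst z))"
proof -
  have S: "sets coupling = sets (restrict_space borel (\<Omega> \<times> \<Omega>))" by (simp add: coupling_def)
  have cm: "h \<in> borel_measurable coupling \<Longrightarrow> h \<in> borel_measurable (restrict_space borel (\<Omega> \<times> \<Omega>))" for h :: "_ \<Rightarrow> real"
    using measurable_cong_sets[OF S refl, of "borel :: real measure"] by blast
  note plan = coupling_plan
  have dm: "(\<lambda>z. euclid_dist 2 (fst z) (snd z)) \<in> borel_measurable (restrict_space borel (\<Omega> \<times> \<Omega>))"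
    by (rule cm[OF borel_measurable_integrable[OF integrable_dist[OF plan]]])
  have pm: "(\<lambda>z. pot (snd z) - pot (fst z)) \<in> borel_measurable (restrict_space borel (\<Omega> \<times> \<Omega>))"
    by (rule cm[OF borel_measurable_integrable[OF pot_plan(1)[OF plan]]])
  have "AE w in pairs. 0 < ennreal (Fp (fst w) * \<zeta> (snd w)) \<longrightarrow>
    euclid_dist 2 (fst (coupling_map w)) (snd (coupling_map w)) = pot (snd (coupling_map w)) - pot (fst (coupling_map w))"
  proof (intro AE_I2 impI)
    fix w assume w: "w \<in> space (pairs)"
      and pos: "0 < ennreal (Fp (fst w) * \<zeta> (snd w))"
    obtain s x y where sxy: "w = ((s, x), y)" by (metis prod.collapse)
    have K: "(s, x) \<in> K" "(s, y) \<in> K"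
      using w by (auto simp: sxy space_pair_measure space_restrict_space K_def)
    have "Fp (s, x) \<noteq> 0" "\<zeta> y \<noteq> 0" using pos by (auto simp: sxy)
    then have "x \<le> y" using Fp_far[OF K(1)] zeta_near[of y] by force
    then show "euclid_dist 2 (fst (coupling_map w)) (snd (coupling_map w))
        = pot (snd (coupling_map w)) - pot (fst (coupling_map w))"
      by (simp add: sxy coupling_map_def dist_on_ray pot_on_ray[OF K])
  qed
  then have ae: "AE w in coupling_base. euclid_dist 2 (fst (coupling_map w)) (snd (coupling_map w))
      = pot (snd (coupling_map w)) - pot (fst (coupling_map w))"
    unfolding coupling_base_def by (subst AE_density[OF measurable_coupling_density])
  show ?thesis
    unfolding coupling_def integral_distr[OF measurable_coupling_map dm] integral_distr[OF measurable_coupling_map pm]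
    by (rule integral_cong_AE[OF measurable_compose[OF measurable_coupling_map dm]
          measurable_compose[OF measurable_coupling_map pm] ae])
qed

lemma cost_ge_coupling:
  assumes "transport_plan 2 \<Omega> fp fm \<gamma>"
  shows "transport_cost 2 coupling \<le> transport_cost 2 \<gamma>"
  unfolding transport_cost_eq[OF assms] transport_cost_eq[OF coupling_plan] coupling_cost
  using cost_ge[OF assms] by (intro ennreal_leI) (simp add: pot_plan(2)[OF assms] pot_plan(2)[OF coupling_plan])

lemma optimal_coupling: "optimal_plan 2 \<Omega> fp fm coupling"
  by (simp add: optimal_plan_def coupling_plan cost_ge_coupling)

text \<open>An optimal plan costs no more than the coupling, whose cost is the dual value. So the
  Lipschitz estimate is an equality almost everywhere for the plan, and \<open>plan_segments\<close>
  applies.\<close>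

lemma optimal_segments:
  assumes opt: "optimal_plan 2 \<Omega> fp fm \<gamma>" and \<phi>: "continuous_on \<Omega> \<phi>"
  shows "(LINT (x, y)|\<gamma>. (LINT t:{0..1}|lborel. \<phi> (segment_point x y t) * euclid_dist 2 x y))
    = (LINT z:K|lborel. W z * (q (fst z) * \<phi> (\<Phi> z)))"
proof -
  have plan: "transport_plan 2 \<Omega> fp fm \<gamma>" and "transport_cost 2 \<gamma> \<le> transport_cost 2 coupling"
    using opt coupling_plan by (auto simp: optimal_plan_def)
  then have "(LINT z|\<gamma>. euclid_dist 2 (fst z) (snd z)) \<le> (LINT z|coupling. euclid_dist 2 (fst z) (snd z))"
    unfolding transport_cost_eq[OF plan] transport_cost_eq[OF coupling_plan]
    by (subst (asm) ennreal_le_iff) (auto intro!: integral_nonneg_AE AE_I2 simp: euclid_dist_2)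
  also have "\<dots> = (LINT z|\<gamma>. pot (snd z) - pot (fst z))"
    by (simp add: coupling_cost pot_plan(2)[OF plan] pot_plan(2)[OF coupling_plan])
  finally show ?thesis
    by (intro plan_segments[OF plan cost_eq_AE[OF plan] \<phi>])
qed

section \<open>The transport density in ray coordinates\<close>

definition \<sigma>0 :: "point \<Rightarrow> real"
  where "\<sigma>0 P = q (fst (\<Psi> P)) * W (\<Psi> P) / dil (\<Psi> P)"

lemma measurable_sigma0: "\<sigma>0 \<in> borel_measurable (restrict_space borel \<Omega>)"
  unfolding \<sigma>0_def[abs_def]
  by (rule measurable_comp_Psi, intro borel_measurable_divide measurable_K_continuous
      continuous_intros cont_W continuous_on_dil)

lemma sigma0_nonneg: "P \<in> \<Omega> \<Longrightarrow> 0 \<le> \<sigma>0 P"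
  using q_pos W_nonneg dil_nonneg Psi_in_K by (simp add: \<sigma>0_def less_imp_le)

text \<open>Multiplying by \<open>dil\<close> undoes the division except at the corner
  \<open>(0, 0)\<close>, where \<open>dil\<close> vanishes but the flux does as well.\<close>

lemma dil_sigma0:
  assumes "z \<in> K"
  shows "dil z * \<sigma>0 (\<Phi> z) = q (fst z) * W z"
proof (cases "z = (0, 0)")
  case False
  then have "dil z \<noteq> 0"
    using dil_pos[of "fst z" "snd z"] assms by (auto simp: K_def)
  then show ?thesis using assms by (simp add: \<sigma>0_def)
next
  case True
  then show ?thesis using W_bdry(1)[of 0] by (simp add: dil_def a_0)
qed

lemma LINT_sigma0:
  assumes \<phi>: "continuous_on \<Omega> \<phi>"
  shows "(LINT P|density_on 2 \<Omega> \<sigma>0. \<phi> P) = (LINT z:K|lborel. W z * (q (fst z) * \<phi> (\<Phi> z)))"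
proof -
  have m\<phi>: "\<phi> \<in> borel_measurable (restrict_space borel \<Omega>)"
    by (rule borel_measurable_continuous_on_restrict[OF \<phi>])
  have "(LINT P|density_on 2 \<Omega> \<sigma>0. \<phi> P) = (LINT P|leb\<Omega>. \<sigma>0 P * \<phi> P)"
    unfolding density_on_eq using m\<phi> measurable_sigma0 sigma0_nonneg
    by (subst integral_density) (auto simp: measurable_leb_Omega intro!: AE_I2)
  also have "\<dots> = (LINT z:K|lborel. dil z * (\<sigma>0 (\<Phi> z) * \<phi> (\<Phi> z)))"
    using m\<phi> measurable_sigma0 by (intro integral_leb_Omega borel_measurable_times)
  also have "\<dots> = (LINT z:K|lborel. W z * (q (fst z) * \<phi> (\<Phi> z)))"
  proof (rule set_lebesgue_integral_cong, simp, intro allI impI)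
    fix z assume "z \<in> K"
    have "dil z * (\<sigma>0 (\<Phi> z) * \<phi> (\<Phi> z)) = (dil z * \<sigma>0 (\<Phi> z)) * \<phi> (\<Phi> z)" by simp
    then show "dil z * (\<sigma>0 (\<Phi> z) * \<phi> (\<Phi> z)) = W z * (q (fst z) * \<phi> (\<Phi> z))"
      unfolding dil_sigma0[OF \<open>z \<in> K\<close>] by (simp add: mult_ac)
  qed
  finally show ?thesis .
qed

lemma finite_sigma0: "finite_measure (density_on 2 \<Omega> \<sigma>0)"
proof
  have c: "continuous_on K (\<lambda>z. q (fst z) * W z)" by (intro continuous_intros cont_W)
  have "emeasure (density_on 2 \<Omega> \<sigma>0) (space (density_on 2 \<Omega> \<sigma>0)) = (\<integral>\<^sup>+ P. ennreal (\<sigma>0 P) * indicator \<Omega> P \<partial>leb\<Omega>)"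
    unfolding density_on_eq using measurable_sigma0
    by (subst emeasure_density) (auto simp: measurable_leb_Omega sets_leb_Omega sets_restrict_space)
  also have "\<dots> = (\<integral>\<^sup>+ P. ennreal (\<sigma>0 P) \<partial>leb\<Omega>)"
    by (intro nn_integral_cong) auto
  also have "\<dots> = (\<integral>\<^sup>+ z. ennreal (\<sigma>0 (\<Phi> z)) \<partial>lebK)"
    using measurable_sigma0 by (intro nn_integral_leb_Omega) auto
  also have "\<dots> = (\<integral>\<^sup>+ z. ennreal (dil z) * ennreal (\<sigma>0 (\<Phi> z)) \<partial>restrict_space lborel K)"
    unfolding lebK_def
    using measurable_compose[OF measurable_Phi measurable_sigma0]
    by (intro nn_integral_density) (auto simp: measurable_lborelK intro!: measurable_restrict_space1 measurable_compose[OF _ measurable_ennreal])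
  also have "\<dots> = (\<integral>\<^sup>+ z. ennreal (indicator K z *\<^sub>R (q (fst z) * W z)) \<partial>lborel)"
  proof (subst nn_integral_restrict_space, simp, rule nn_integral_cong)
    fix z
    show "ennreal (dil z) * ennreal (\<sigma>0 (\<Phi> z)) * indicator K z = ennreal (indicator K z *\<^sub>R (q (fst z) * W z))"
      using dil_sigma0[of z] dil_nonneg[of z] sigma0_nonneg[of "\<Phi> z"]
      by (cases "z \<in> K") (auto simp: \<Omega>_def simp flip: ennreal_mult)
  qed
  also have "\<dots> = ennreal (LINT z:K|lborel. q (fst z) * W z)"
    unfolding set_lebesgue_integral_def
    using bddK_integrable[OF bddK_cont[OF c]] q_pos W_nonneg
    by (intro nn_integral_eq_integral AE_I2)
      (auto simp: set_integrable_def less_imp_le split: split_indicator)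
  finally show "emeasure (density_on 2 \<Omega> \<sigma>0) (space (density_on 2 \<Omega> \<sigma>0)) \<noteq> \<infinity>" by simp
qed

lemma transport_density_sigma0: "transport_density 2 \<Omega> fp fm \<sigma>0"
proof -
  have "\<sigma>0 \<in> borel_measurable (restrict_space (leb 2) \<Omega>)"
    using measurable_sigma0 measurable_leb_Omega[of \<sigma>0] unfolding leb\<Omega>_def by blast
  moreover have "sets (density_on 2 \<Omega> \<sigma>0) = sets (restrict_space borel \<Omega>)"
    by (simp add: density_on_eq sets_leb_Omega)
  ultimately show ?thesis
    unfolding transport_density_def transport_measure_def
    using sigma0_nonneg finite_sigma0 optimal_coupling optimal_segments[OF optimal_coupling] LINT_sigma0
    by auto
qed

text \<open>Valid for every density of the transport measure, whichever optimal plan produced it.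
  Failure of regularity can therefore be shown for all of them at once, without first proving
  uniqueness almost everywhere.\<close>

lemma transport_density_integral:
  assumes td: "transport_density 2 \<Omega> fp fm \<sigma>" and \<phi>: "continuous_on \<Omega> \<phi>"
  shows "(LINT P|leb\<Omega>. \<sigma> P * \<phi> P) = (LINT z:K|lborel. W z * (q (fst z) * \<phi> (\<Phi> z)))"
proof -
  have "\<sigma> \<in> borel_measurable leb\<Omega>" "\<phi> \<in> borel_measurable leb\<Omega>"
    using td borel_measurable_continuous_on_restrict[OF \<phi>]
    by (auto simp: transport_density_def leb\<Omega>_def[symmetric] measurable_leb_Omega)
  then have "(LINT P|leb\<Omega>. \<sigma> P * \<phi> P) = (LINT P|density_on 2 \<Omega> \<sigma>. \<phi> P)"
    unfolding density_on_eq using td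
    by (subst integral_density) (auto simp: transport_density_def intro!: AE_I2)
  also obtain \<gamma> where "optimal_plan 2 \<Omega> fp fm \<gamma>"
    and "(LINT P|density_on 2 \<Omega> \<sigma>. \<phi> P) = (LINT (x, y)|\<gamma>. (LINT t:{0..1}|lborel. \<phi> (segment_point x y t) * euclid_dist 2 x y))"
    using td \<phi> unfolding transport_density_def transport_measure_def by blast
  then have "(LINT P|density_on 2 \<Omega> \<sigma>. \<phi> P) = (LINT z:K|lborel. W z * (q (fst z) * \<phi> (\<Phi> z)))"
    using optimal_segments[OF _ \<phi>] by simp
  finally show ?thesis .
qed

end

section \<open>Test functions on cells of rays\<close>

context ray_transport
begin

text \<open>The last two cutoffs are steps of expressions affine in \<open>P\<close> whose zero
  lines are the rays \<open>s1\<close> and \<open>s4\<close>, so the product is smooth in Cartesian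
  coordinates although it follows the rays. \<open>\<eta>\<close> and \<open>w\<close> are the
  horizontal and vertical thickness of the transition layers; the signs are spelled out to fit
  \<open>smooth_algebra\<close>.\<close>

definition step_test :: "real \<Rightarrow> real \<Rightarrow> real \<Rightarrow> real \<Rightarrow> real \<Rightarrow> real \<Rightarrow> point \<Rightarrow> real"
  where "step_test s1 s4 x1 x2 \<eta> w P =
    (smooth_step ((1 / \<eta>) * (P 0 + - x1)) * smooth_step ((1 / \<eta>) * (x2 + (-1) * P 0))) *
    (smooth_step ((1 / w) * (P 1 + - s1 * P 0 + - A s1)) * smooth_step ((1 / w) * (A s4 + s4 * P 0 + (-1) * P 1)))"

lemma step_test_smooth: "step_test s1 s4 x1 x2 \<eta> w \<in> smooth_algebra"
  unfolding step_test_def[abs_def] by (intro smooth_algebra.intros)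

lemma step_test_bounds: "0 \<le> step_test s1 s4 x1 x2 \<eta> w P" "step_test s1 s4 x1 x2 \<eta> w P \<le> 1"
proof -
  note b = smooth_step_bounds
  show "0 \<le> step_test s1 s4 x1 x2 \<eta> w P"
    unfolding step_test_def by (intro mult_nonneg_nonneg b)
  show "step_test s1 s4 x1 x2 \<eta> w P \<le> 1"
    unfolding step_test_def by (intro mult_le_one mult_nonneg_nonneg b)
qed

definition cell :: "real \<Rightarrow> real \<Rightarrow> real \<Rightarrow> real \<Rightarrow> point set"
  where "cell s1 s4 x1 x2 = \<Phi> ` ({s1..s4} \<times> {x1..x2})"

text \<open>At an abscissa \<open>y \<ge> x1\<close> two rays are vertically at least
  \<open>y\<close> times their parameter difference apart. The bounds on \<open>w\<close> therefore
  keep the rising layer at \<open>s1\<close> below the ray \<open>s2\<close> and the falling layer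
  at \<open>s4\<close> above the ray \<open>s3\<close>.\<close>

context
  fixes s1 s2 s3 s4 x1 x2 w :: real
  assumes s: "0 < s1" "s1 < s2" "s2 \<le> s3" "s3 < s4" "s4 < 1"
    and x: "0 < x1" "x1 < x2" "x2 < 2"
    and w: "0 < w" "w \<le> x1 * (s2 - s1)" "w \<le> x1 * (s4 - s3)"
begin

abbreviation "\<eta> \<equiv> (x2 - x1) / 3"
abbreviation "test \<equiv> step_test s1 s4 x1 x2 \<eta> w"

lemma eta_pos: "0 < \<eta>" using x by simp

lemma cell_subset_K: "{s1..s4} \<times> {x1..x2} \<subseteq> K"
  using s x by (auto simp: K_def)

lemma cell_subset_U: "cell s1 s4 x1 x2 \<subseteq> U"
proof
  fix P assume "P \<in> cell s1 s4 x1 x2"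
  then obtain r y where "P = \<Phi> (r, y)" "s1 \<le> r" "r \<le> s4" "x1 \<le> y" "y \<le> x2"
    by (auto simp: cell_def)
  moreover from this have "(r, y) \<in> K"
    using cell_subset_K by (auto simp: subset_iff)
  ultimately show "P \<in> U"
    using Phi_in_U_iff[of r y] s x by auto
qed

lemma compact_cell: "compact (cell s1 s4 x1 x2)"
  unfolding cell_def by (intro compact_continuous_image continuous_on_Phi compact_Times compact_Icc)

lemma step_test_nonzero:
  assumes P: "P \<in> Rn 2" "test P \<noteq> 0"
  shows "P \<in> cell s1 s4 x1 x2"
proof -
  have pos: "smooth_step u \<noteq> 0 \<Longrightarrow> 0 < u" for u
    using smooth_step_eq_0[of u] by force
  have "0 < (1 / \<eta>) * (P 0 + - x1)" "0 < (1 / \<eta>) * (x2 + (-1) * P 0)"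
    "0 < (1 / w) * (P 1 + - s1 * P 0 + - A s1)" "0 < (1 / w) * (A s4 + s4 * P 0 + (-1) * P 1)"
    using P(2) unfolding step_test_def by (auto intro!: pos)
  then have l: "x1 < P 0" "P 0 < x2" "A s1 + P 0 * s1 < P 1" "P 1 < A s4 + P 0 * s4"
    using eta_pos w(1) by (auto simp: zero_less_mult_iff zero_less_divide_iff mult.commute)
  have m: "A 0 + P 0 * 0 \<le> A s1 + P 0 * s1" "A s4 + P 0 * s4 \<le> A 1 + P 0 * 1"
    using l x s by (intro ray_mono; simp)+
  then have "P \<in> \<Omega>"
    using l x P(1) A_0 by (auto simp: Omega_iff)
  then obtain r y where ry: "(r, y) \<in> K" "P = \<Phi> (r, y)" by (auto simp: \<Omega>_def)
  then have "s1 < r" "r < s4" "x1 < y" "y < x2"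
    using l s x ray_less_iff[of s1 r y] ray_less_iff[of r s4 y] by (auto simp: \<Phi>_def K_def)
  then show ?thesis
    using ry by (auto simp: cell_def)
qed

lemma step_test_in: "test \<in> test_functions 2 U"
proof -
  let ?N = "{P \<in> Rn 2. test P \<noteq> 0}"
  have C: "cell s1 s4 x1 x2 \<subseteq> Rn 2" using cell_subset_U by (auto simp: U_eq)
  have cl: "closedin (Euclidean_space 2) (cell s1 s4 x1 x2)"
    using compact_imp_closed[OF compact_cell] C by (simp add: closedin_Euclidean_space_iff)
  have sub: "Euclidean_space 2 closure_of ?N \<subseteq> cell s1 s4 x1 x2"
    by (rule closure_of_minimal[OF _ cl]) (use step_test_nonzero in auto)
  have "compactin (Euclidean_space 2) (cell s1 s4 x1 x2)"
    using compact_cell C by (simp add: Euclidean_space_eq_top_of_set topspace_Euclidean_space compactin_subtopology)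
  then have "compactin (Euclidean_space 2) (Euclidean_space 2 closure_of ?N)"
    by (rule closed_compactin[OF _ sub]) simp
  then show ?thesis
    using smooth_algebra_smooth[OF step_test_smooth] sub cell_subset_U by (auto simp: test_functions_def)
qed

definition X where "X y = smooth_step ((1 / \<eta>) * (y + - x1)) * smooth_step ((1 / \<eta>) * (x2 + (-1) * y))"
definition rise where "rise y r = (1 / w) * (A r + y * r - (A s1 + y * s1))"
definition fall where "fall y r = (1 / w) * (A s4 + y * s4 - (A r + y * r))"

lemma step_test_Phi: "test (\<Phi> (r, y)) = X y * (smooth_step (rise y r) * smooth_step (fall y r))"
proof -
  have "(1 / w) * (\<Phi> (r, y) 1 + - s1 * \<Phi> (r, y) 0 + - A s1) = rise y r"
    "(1 / w) * (A s4 + s4 * \<Phi> (r, y) 0 + (-1) * \<Phi> (r, y) 1) = fall y r"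
    by (auto simp: rise_def fall_def \<Phi>_def algebra_simps)
  moreover have "\<Phi> (r, y) 0 = y" by (simp add: \<Phi>_def)
  ultimately show ?thesis unfolding step_test_def X_def by simp
qed

abbreviation "rise' y r \<equiv> step_scale * bump (rise y r) * (dil (r, y) / w)"
abbreviation "fall' y r \<equiv> step_scale * bump (fall y r) * (- dil (r, y) / w)"

lemma rise_deriv: "((\<lambda>r. smooth_step (rise y r)) has_real_derivative rise' y r) (at r)"
proof -
  have "((\<lambda>r. rise y r) has_real_derivative dil (r, y) / w) (at r)"
    unfolding rise_def
    using DERIV_cmult[OF DERIV_diff[OF ray_deriv[of y r] DERIV_const], of "1 / w"] by simp
  from DERIV_chain2[OF smooth_step_has_derivative this] show ?thesis .
qed

lemma fall_deriv: "((\<lambda>r. smooth_step (fall y r)) has_real_derivative fall' y r) (at r)"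
proof -
  have "((\<lambda>r. fall y r) has_real_derivative - dil (r, y) / w) (at r)"
    unfolding fall_def
    using DERIV_cmult[OF DERIV_diff[OF DERIV_const ray_deriv[of y r]], of "1 / w"] by simp
  from DERIV_chain2[OF smooth_step_has_derivative this] show ?thesis .
qed

text \<open>At fixed abscissa the chain rule in \<open>s\<close> involves only the vertical partial
  derivative, with factor \<open>dil\<close>; differentiating the ray form of the test function
  therefore computes it.\<close>

lemma step_test_partial:
  "partial 1 test (\<Phi> (r, y)) * dil (r, y)
    = X y * (rise' y r * smooth_step (fall y r) + fall' y r * smooth_step (rise y r))"
proof (rule DERIV_unique[OF test_function_ray_derivs(1)[OF step_test_in]])
  have "((\<lambda>r. X y * (smooth_step (rise y r) * smooth_step (fall y r))) has_real_derivative
    X y * (rise' y r * smooth_step (fall y r) + fall' y r * smooth_step (rise y r))) (at r)"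
    by (rule DERIV_cmult[OF DERIV_mult[OF rise_deriv fall_deriv]])
  then show "((\<lambda>s. test (\<Phi> (s, y))) has_real_derivative
    X y * (rise' y r * smooth_step (fall y r) + fall' y r * smooth_step (rise y r))) (at r)"
    by (simp only: step_test_Phi)
qed

lemma X_bounds: "0 \<le> X y" "X y \<noteq> 0 \<Longrightarrow> x1 < y \<and> y < x2"
proof -
  show "0 \<le> X y" unfolding X_def by (intro mult_nonneg_nonneg smooth_step_bounds)
  have pos: "smooth_step u \<noteq> 0 \<Longrightarrow> 0 < u" for u
    using smooth_step_eq_0[of u] by force
  assume "X y \<noteq> 0"
  then have "0 < (1 / \<eta>) * (y + - x1)" "0 < (1 / \<eta>) * (x2 + (-1) * y)"
    unfolding X_def by (auto intro!: pos)
  then show "x1 < y \<and> y < x2"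
    using eta_pos by (auto simp: zero_less_mult_iff zero_less_divide_iff)
qed

lemma continuous_on_X: "continuous_on S X"
  unfolding X_def[abs_def] by (intro continuous_intros)

text \<open>The horizontal cutoff equals 1 on the middle third of \<open>{x1..x2}\<close>.\<close>

lemma X_mass: "\<eta> \<le> (LINT y:{0..2}|lborel. X y)"
proof -
  have 1: "X y = 1" if "y \<in> {x1 + \<eta>..x2 - \<eta>}" for y
  proof -
    have "1 \<le> (1 / \<eta>) * (y + - x1)" "1 \<le> (1 / \<eta>) * (x2 + (-1) * y)"
      using that x by (auto simp: pos_le_divide_eq) argo+
    then show ?thesis unfolding X_def by (simp add: smooth_step_eq_1)
  qed
  have "\<eta> = (LINT y:{x1 + \<eta>..x2 - \<eta>}|lborel. 1)"
  proof -
    have len: "(LINT y:{a..b}|lborel. 1) = b - a" if "a \<le> b" for a b :: real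
      using that by (simp add: set_lebesgue_integral_def)
    have "x1 + \<eta> \<le> x2 - \<eta>" "x2 - \<eta> - (x1 + \<eta>) = \<eta>" using x by argo+
    then show ?thesis by (simp only: len)
  qed
  also have "\<dots> = (LINT y:{x1 + \<eta>..x2 - \<eta>}|lborel. X y)"
    by (rule set_lebesgue_integral_cong) (auto simp: 1)
  also have "\<dots> \<le> (LINT y:{0..2}|lborel. X y)"
    unfolding set_lebesgue_integral_def
  proof (rule integral_mono)
    show "integrable lborel (\<lambda>y. indicator {x1 + \<eta>..x2 - \<eta>} y *\<^sub>R X y)"
      "integrable lborel (\<lambda>y. indicator {0..2} y *\<^sub>R X y)"
      using borel_integrable_atLeastAtMost'[OF continuous_on_X] by (simp_all add: set_integrable_def)
    show "indicator {x1 + \<eta>..x2 - \<eta>} y *\<^sub>R X y \<le> indicator {0..2} y *\<^sub>R X y" for y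
    proof (cases "y \<in> {x1 + \<eta>..x2 - \<eta>}")
      case True
      then have "x1 + \<eta> \<le> y" "y \<le> x2 - \<eta>" by auto
      then have "0 \<le> y" "y \<le> 2" using x by argo+
      then show ?thesis using True by simp
    qed (use X_bounds(1)[of y] in simp)
  qed
  finally show ?thesis .
qed

text \<open>The vertical derivative of the test function is positive only in the layer at
  \<open>s1\<close>, where the density is at most \<open>rL\<close>, and negative only in the layer
  at \<open>s4\<close>, where it is at least \<open>rR\<close>. At fixed abscissa each step has
  total variation 1, so the integral in \<open>r\<close> is at most
  \<open>X y * (rL y - rR y)\<close>.\<close>

lemma step_test_flux:
  assumes rL: "\<And>r y. r \<in> {s1..s2} \<Longrightarrow> y \<in> {x1..x2} \<Longrightarrow> W (r, y) * q r \<le> rL y * dil (r, y)"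
    and rR: "\<And>r y. r \<in> {s3..s4} \<Longrightarrow> y \<in> {x1..x2} \<Longrightarrow> rR y * dil (r, y) \<le> W (r, y) * q r"
    and gap: "\<And>y. y \<in> {x1..x2} \<Longrightarrow> gap \<le> rR y - rL y" and gap0: "0 \<le> gap"
  shows "(LINT z:K|lborel. W z * (q (fst z) * partial 1 test (\<Phi> z))) \<le> - (gap * \<eta>)"
proof -
  let ?h = "\<lambda>z. W z * (q (fst z) * partial 1 test (\<Phi> z))"
  have ch: "continuous_on K ?h"
  proof -
    have "\<Phi> ` K \<subseteq> Rn 2" by (auto simp: \<Phi>_def)
    then show ?thesis
      by (intro continuous_intros cont_W continuous_on_compose2[OF test_function_props(2)[OF step_test_in] continuous_on_Phi]) auto
  qed
  have line: "continuous_on {0..1} (\<lambda>r. ?h (r, y))" if "y \<in> {0..2}" for y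
    by (rule continuous_on_compose2[OF ch]) (use that in \<open>auto simp: K_def intro!: continuous_intros\<close>)
  have inner: "(LINT r:{0..1}|lborel. ?h (r, y)) \<le> - (gap * X y)" if y02: "y \<in> {0..2}" for y
  proof (cases "X y = 0")
    case True
    have "?h (r, y) = 0" if "r \<in> {0..1}" for r
    proof (cases "(r, y) = (0, 0)")
      case False
      then have "dil (r, y) \<noteq> 0" using dil_pos[of r y] that y02 by auto
      then show ?thesis using step_test_partial[of r y] True by simp
    qed (use W_bdry(1)[of 0] in simp)
    then have "(LINT r:{0..1}|lborel. ?h (r, y)) = (LINT r:{0..1}|lborel. 0)"
      using set_lebesgue_integral_cong[of "{0..1}" lborel "\<lambda>r. ?h (r, y)" "\<lambda>_. 0"] by simp
    then show ?thesis using True by (simp add: set_lebesgue_integral_def)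
  next
    case False
    then have y: "y \<in> {x1..x2}" "0 < y" and X0: "0 < X y"
      using X_bounds[of y] x by auto
    \<comment> \<open>A majorant of the integrand that is an exact derivative in \<open>r\<close>:
      the density is frozen at \<open>rL\<close> in the rising layer and at \<open>rR\<close> in the
      falling one.\<close>
    let ?b = "\<lambda>r. X y * (rL y * rise' y r + rR y * fall' y r)"
    let ?B = "\<lambda>r. X y * (rL y * smooth_step (rise y r) + rR y * smooth_step (fall y r))"
    have cb: "continuous_on {0..1} ?b"
      unfolding rise_def fall_def dil_def bump_def by (intro continuous_intros) (use w in auto)
    have le: "?h (r, y) \<le> ?b r" if r: "r \<in> {0..1}" for r
    proof -
      have d: "0 < dil (r, y)" using dil_pos[of r y] r y by auto
      have c0: "0 \<le> step_scale * bump u * (dil (r, y) / w)" for u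
        using step_scale_pos bump_nonneg d w by (intro mult_nonneg_nonneg) (auto simp: less_imp_le)
      have Wq: "?h (r, y) = (W (r, y) * q r / dil (r, y)) * (partial 1 test (\<Phi> (r, y)) * dil (r, y))"
        using d by simp
      \<comment> \<open>Only the rising layer matters. There the bounds on \<open>w\<close> put
        \<open>r\<close> between \<open>s1\<close> and \<open>s2\<close> and at vertical distance at
        least \<open>w\<close> below \<open>s4\<close>, so the falling step is already 1.\<close>
      have up: "(W (r, y) * q r / dil (r, y)) * (rise' y r * smooth_step (fall y r)) \<le> rL y * rise' y r"
      proof (cases "bump (rise y r) = 0")
        case False
        then have "rise y r \<in> {0<..<1}" using bump_eq_0 by blast
        then have l: "A s1 + y * s1 < A r + y * r" "A r + y * r - (A s1 + y * s1) < w"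
          using w(1) by (auto simp: rise_def zero_less_divide_iff)
        then have "s1 < r" using ray_less_iff[of s1 r y] s r y by auto
        have step: "y * (s2 - s1) \<le> (A s2 + y * s2) - (A s1 + y * s1)"
          using ray_mono[of s1 s2 0] s by (simp add: algebra_simps)
        have "w \<le> y * (s2 - s1)" using w(2) y s by (intro order_trans[OF w(2)] mult_right_mono) auto
        then have "A r + y * r < A s2 + y * s2" using l step by linarith
        then have "r < s2" using ray_less_iff[of r s2 y] s r y by auto
        have step4: "y * (s4 - s3) \<le> (A s4 + y * s4) - (A s3 + y * s3)"
          using ray_mono[of s3 s4 0] s by (simp add: algebra_simps)
        have "w \<le> y * (s4 - s3)" using w(3) y s by (intro order_trans[OF w(3)] mult_right_mono) auto
        moreover have "A r + y * r \<le> A s3 + y * s3"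
          using \<open>r < s2\<close> s r y by (intro ray_mono) auto
        ultimately have "w \<le> A s4 + y * s4 - (A r + y * r)" using step4 by linarith
        then have "1 \<le> fall y r" using w(1) by (simp add: fall_def pos_le_divide_eq)
        then have "smooth_step (fall y r) = 1" by (rule smooth_step_eq_1)
        moreover have "W (r, y) * q r / dil (r, y) \<le> rL y"
          using rL[of r y] \<open>s1 < r\<close> \<open>r < s2\<close> y d by (simp add: pos_divide_le_eq)
        then have "(W (r, y) * q r / dil (r, y)) * rise' y r \<le> rL y * rise' y r"
          by (rule mult_right_mono[OF _ c0])
        ultimately show ?thesis by (simp only: mult_1_right)
      qed simp
      have down: "(W (r, y) * q r / dil (r, y)) * (fall' y r * smooth_step (rise y r)) \<le> rR y * fall' y r"
      proof (cases "bump (fall y r) = 0")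
        case False
        then have "fall y r \<in> {0<..<1}" using bump_eq_0 by blast
        then have l: "A r + y * r < A s4 + y * s4" "A s4 + y * s4 - (A r + y * r) < w"
          using w(1) by (auto simp: fall_def zero_less_divide_iff)
        then have "r < s4" using ray_less_iff[of r s4 y] s r y by auto
        have step: "y * (s4 - s3) \<le> (A s4 + y * s4) - (A s3 + y * s3)"
          using ray_mono[of s3 s4 0] s by (simp add: algebra_simps)
        have "w \<le> y * (s4 - s3)" using w(3) y s by (intro order_trans[OF w(3)] mult_right_mono) auto
        then have "A s3 + y * s3 < A r + y * r" using l step by linarith
        then have "s3 < r" using ray_less_iff[of s3 r y] s r y by auto
        have step2: "y * (s2 - s1) \<le> (A s2 + y * s2) - (A s1 + y * s1)"
          using ray_mono[of s1 s2 0] s by (simp add: algebra_simps)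
        have "w \<le> y * (s2 - s1)" using w(2) y s by (intro order_trans[OF w(2)] mult_right_mono) auto
        moreover have "A s2 + y * s2 \<le> A r + y * r"
          using \<open>s3 < r\<close> s r y by (intro ray_mono) auto
        ultimately have "w \<le> A r + y * r - (A s1 + y * s1)" using step2 by linarith
        then have "1 \<le> rise y r" using w(1) by (simp add: rise_def pos_le_divide_eq)
        then have "smooth_step (rise y r) = 1" by (rule smooth_step_eq_1)
        moreover have "rR y \<le> W (r, y) * q r / dil (r, y)"
          using rR[of r y] \<open>s3 < r\<close> \<open>r < s4\<close> y d by (simp add: pos_le_divide_eq)
        then have "rR y * (step_scale * bump (fall y r) * (dil (r, y) / w))
            \<le> (W (r, y) * q r / dil (r, y)) * (step_scale * bump (fall y r) * (dil (r, y) / w))"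
          by (rule mult_right_mono[OF _ c0])
        then have "(W (r, y) * q r / dil (r, y)) * fall' y r \<le> rR y * fall' y r"
          by (simp only: minus_divide_left[symmetric] mult_minus_right neg_le_iff_le)
        ultimately show ?thesis by (simp only: mult_1_right)
      qed simp
      have "?h (r, y) = X y * ((W (r, y) * q r / dil (r, y)) * (rise' y r * smooth_step (fall y r))
          + (W (r, y) * q r / dil (r, y)) * (fall' y r * smooth_step (rise y r)))"
        unfolding Wq step_test_partial by (simp only: distrib_left mult_ac)
      also have "\<dots> \<le> ?b r"
        by (intro mult_left_mono add_mono up down X_bounds)
      finally show ?thesis .
    qed
    have "(LINT r:{0..1}|lborel. ?h (r, y)) \<le> (LINT r:{0..1}|lborel. ?b r)"
      by (intro set_integral_mono borel_integrable_atLeastAtMost' line[OF y02] cb le)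
    also have "\<dots> = ?B 1 - ?B 0"
    proof -
      obtain B where B: "\<forall>r\<in>{0..1}. \<bar>?b r\<bar> \<le> B"
        using compact_imp_bounded[OF compact_continuous_image[OF cb]] by (auto simp: bounded_iff)
      have db: "(?B has_real_derivative ?b r) (at r)" for r
        by (intro DERIV_cmult DERIV_add rise_deriv fall_deriv)
      have "continuous_on {0..1} ?B"
        by (rule DERIV_continuous_on[OF has_field_derivative_at_within[OF db]])
      then show ?thesis
        by (intro LINT_deriv(2)[where B = B] db)
          (use B borel_measurable_continuous_on_indicator[OF _ cb] in \<open>auto simp: set_borel_measurable_def\<close>)
    qed
    also have "\<dots> = X y * (rL y - rR y)"
    proof -
      have st: "y * (s2 - s1) \<le> (A s2 + y * s2) - (A s1 + y * s1)" "y * (s4 - s3) \<le> (A s4 + y * s4) - (A s3 + y * s3)"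
        using ray_mono[of s1 s2 0] ray_mono[of s3 s4 0] s by (simp_all add: algebra_simps)
      have wy: "w \<le> y * (s2 - s1)" "w \<le> y * (s4 - s3)"
        using w(2,3) y s by (auto intro: order_trans[OF w(2) mult_right_mono] order_trans[OF w(3) mult_right_mono])
      have mono: "A 0 + y * 0 \<le> A s1 + y * s1" "A s2 + y * s2 \<le> A 1 + y * 1" "A s4 + y * s4 \<le> A 1 + y * 1"
        "A 0 + y * 0 \<le> A s3 + y * s3"
        using s y by (intro ray_mono; simp)+
      \<comment> \<open>Between \<open>r = 0\<close> and \<open>r = 1\<close> the rising step goes
        from 0 to 1 and the falling one from 1 to 0.\<close>
      have v: "1 \<le> rise y 1" "rise y 0 \<le> 0" "fall y 1 \<le> 0" "1 \<le> fall y 0"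
        using st wy mono w(1)
        by (auto simp: rise_def fall_def pos_le_divide_eq divide_le_0_iff)
      show ?thesis
        using v by (simp add: smooth_step_eq_0 smooth_step_eq_1 algebra_simps)
    qed
    also have "\<dots> \<le> X y * (- gap)"
      using gap[OF y(1)] X0 by (intro mult_left_mono) auto
    finally show ?thesis by (simp add: mult.commute)
  qed
  have "(LINT z:K|lborel. ?h z) = (LINT y:{0..2}|lborel. LINT r:{0..1}|lborel. ?h (r, y))"
    by (rule LINT_K(2)[OF bddK_integrable[OF bddK_cont[OF ch]]])
  also have "\<dots> \<le> (LINT y:{0..2}|lborel. - (gap * X y))"
  proof (rule set_integral_mono)
    have i: "integrable (lborel \<Otimes>\<^sub>M lborel) (\<lambda>(r, y). indicat_real K (r, y) *\<^sub>R ?h (r, y))"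
      using bddK_integrable[OF bddK_cont[OF ch]] by (simp add: lborel_prod set_integrable_def case_prod_beta')
    have "integrable lborel (\<lambda>y. LINT r|lborel. indicat_real K (r, y) *\<^sub>R ?h (r, y))"
      by (rule lborel_pair.integrable_snd[OF i])
    also have "(\<lambda>y. LINT r|lborel. indicat_real K (r, y) *\<^sub>R ?h (r, y))
        = (\<lambda>y. indicator {0..2} y *\<^sub>R (LINT r:{0..1}|lborel. ?h (r, y)))"
      by (auto simp: K_def indicator_times set_lebesgue_integral_def fun_eq_iff split: split_indicator)
    finally show "set_integrable lborel {0..2} (\<lambda>y. LINT r:{0..1}|lborel. ?h (r, y))"
      by (simp add: set_integrable_def)
    show "set_integrable lborel {0..2} (\<lambda>y. - (gap * X y))"
      by (intro borel_integrable_atLeastAtMost' continuous_intros continuous_on_X)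
  qed (use inner in auto)
  also have "\<dots> = - (gap * (LINT y:{0..2}|lborel. X y))"
    by (simp add: set_lebesgue_integral_def mult.left_commute[of _ gap])
  also have "\<dots> \<le> - (gap * \<eta>)"
    using mult_left_mono[OF X_mass gap0] by (rule le_imp_neg_le)
  finally show ?thesis .
qed

lemma cell_sets: "cell s1 s4 x1 x2 \<in> sets (leb 2)"
  using compact_imp_closed[OF compact_cell] cell_subset_U
  by (auto simp: sets_leb sets_restrict_space U_eq intro!: image_eqI[of _ _ "cell s1 s4 x1 x2"])

lemma measure_cell:
  assumes "\<And>r y. r \<in> {s1..s4} \<Longrightarrow> y \<in> {x1..x2} \<Longrightarrow> dil (r, y) \<le> D"
  shows "emeasure (leb 2) (cell s1 s4 x1 x2) \<le> ennreal (D * ((s4 - s1) * (x2 - x1)))"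
proof -
  have sub: "cell s1 s4 x1 x2 \<subseteq> \<Omega>" using cell_subset_U U_subset by auto
  have inj: "\<Phi> z \<in> cell s1 s4 x1 x2 \<longleftrightarrow> z \<in> {s1..s4} \<times> {x1..x2}" if "z \<in> K" for z
    using inj_on_Phi that cell_subset_K by (auto simp: cell_def inj_on_def)
  have D0: "0 \<le> D"
    using assms[of s1 x1] dil_nonneg[of "(s1, x1)"] s x by (auto simp: K_def)
  have box: "cbox (s1, x1) (s4, x2) = {s1..s4} \<times> {x1..x2}" by auto
  have m: "indicator (cell s1 s4 x1 x2) \<in> borel_measurable (restrict_space borel \<Omega>)"
    using compact_imp_closed[OF compact_cell] by (intro measurable_restrict_space1) simp
  have "emeasure (leb 2) (cell s1 s4 x1 x2) = emeasure leb\<Omega> (cell s1 s4 x1 x2)"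
    unfolding leb\<Omega>_def using sub Omega_subset by (subst emeasure_restrict_space) (auto simp: Int_absorb2)
  also have "\<dots> = (\<integral>\<^sup>+ P. indicator (cell s1 s4 x1 x2) P \<partial>leb\<Omega>)"
    using compact_imp_closed[OF compact_cell] sub
    by (subst nn_integral_indicator) (auto simp: sets_leb_Omega sets_restrict_space intro!: image_eqI[of _ _ "cell s1 s4 x1 x2"])
  also have "\<dots> = (\<integral>\<^sup>+ z. indicator (cell s1 s4 x1 x2) (\<Phi> z) \<partial>lebK)"
    by (rule nn_integral_leb_Omega[OF m])
  also have "\<dots> = (\<integral>\<^sup>+ z. ennreal (dil z) * indicator (cell s1 s4 x1 x2) (\<Phi> z) \<partial>restrict_space lborel K)"
    unfolding lebK_def using measurable_compose[OF measurable_Phi m]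
    by (intro nn_integral_density) (auto simp: measurable_lborelK intro!: measurable_restrict_space1)
  also have "\<dots> = (\<integral>\<^sup>+ z. ennreal (dil z) * indicator (cell s1 s4 x1 x2) (\<Phi> z) * indicator K z \<partial>lborel)"
    by (rule nn_integral_restrict_space) simp
  also have "\<dots> \<le> (\<integral>\<^sup>+ z. ennreal D * indicator (cbox (s1, x1) (s4, x2)) z \<partial>lborel)"
  proof (rule nn_integral_mono)
    fix z
    show "ennreal (dil z) * indicator (cell s1 s4 x1 x2) (\<Phi> z) * indicator K z
        \<le> ennreal D * indicator (cbox (s1, x1) (s4, x2)) z"
    proof (cases "z \<in> K \<and> z \<in> {s1..s4} \<times> {x1..x2}")
      case True
      then have "dil z \<le> D" using assms[of "fst z" "snd z"] by auto
      then show ?thesis using True inj unfolding box by (simp add: ennreal_leI)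
    qed (use inj in \<open>auto split: split_indicator\<close>)
  qed
  also have "\<dots> = ennreal D * emeasure lborel (cbox (s1, x1) (s4, x2))"
    by (rule nn_integral_cmult_indicator) simp
  also have "emeasure lborel (cbox (s1, x1) (s4, x2)) = ennreal ((s4 - s1) * (x2 - x1))"
  proof -
    have "emeasure lborel ({s1..s4} \<times> {x1..x2}) = emeasure lborel {s1..s4} * emeasure lborel {x1..x2}"
      unfolding lborel_prod[symmetric] by (rule lborel.emeasure_pair_measure_Times) auto
    then show ?thesis
      unfolding box using s x by (simp add: ennreal_mult)
  qed
  also have "ennreal D * ennreal ((s4 - s1) * (x2 - x1)) = ennreal (D * ((s4 - s1) * (x2 - x1)))"
    using D0 s x by (intro ennreal_mult[symmetric]) auto
  finally show ?thesis .
qed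

text \<open>The pointwise bound \<open>\<bar>g\<bar> \<le> t + t powr (1 - p) * \<bar>g\<bar> powr p\<close> replaces Hoelder's inequality;
  \<open>t\<close> is optimized later.\<close>

lemma weak_derivative_lower_bound:
  assumes td: "transport_density 2 \<Omega> fp fm \<sigma>" and weak: "weak_partial 2 U 1 \<sigma> g" and g: "g \<in> Lp 2 U p"
    and p: "1 < p" and t: "0 < t"
    and rL: "\<And>r y. r \<in> {s1..s2} \<Longrightarrow> y \<in> {x1..x2} \<Longrightarrow> W (r, y) * q r \<le> rL y * dil (r, y)"
    and rR: "\<And>r y. r \<in> {s3..s4} \<Longrightarrow> y \<in> {x1..x2} \<Longrightarrow> rR y * dil (r, y) \<le> W (r, y) * q r"
    and gap: "\<And>y. y \<in> {x1..x2} \<Longrightarrow> gap \<le> rR y - rL y" and gap0: "0 \<le> gap"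
    and D: "\<And>r y. r \<in> {s1..s4} \<Longrightarrow> y \<in> {x1..x2} \<Longrightarrow> dil (r, y) \<le> D"
  shows "gap * \<eta> \<le> t * (D * ((s4 - s1) * (x2 - x1)))
    + t powr (1 - p) * (LINT P:cell s1 s4 x1 x2|leb 2. \<bar>g P\<bar> powr p)"
proof -
  let ?C = "cell s1 s4 x1 x2"
  have cont: "continuous_on \<Omega> (partial 1 test)"
    by (rule continuous_on_subset[OF test_function_props(2)[OF step_test_in] Omega_subset]) simp
  have "(LINT P:U|leb 2. g P * test P) = - (LINT P:U|leb 2. \<sigma> P * partial 1 test P)"
    using weak step_test_in by (auto simp: weak_partial_def)
  also have "(LINT P:U|leb 2. \<sigma> P * partial 1 test P) = (LINT P|leb\<Omega>. \<sigma> P * partial 1 test P)"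
    by (rule set_integral_test(2)[OF step_test_in]) simp
  also have "\<dots> = (LINT z:K|lborel. W z * (q (fst z) * partial 1 test (\<Phi> z)))"
    by (rule transport_density_integral[OF td cont])
  finally have "gap * \<eta> \<le> (LINT P:U|leb 2. g P * test P)"
    using step_test_flux[OF rL rR gap gap0] by simp
  also have "\<dots> \<le> (LINT P|leb 2. t * indicator ?C P + t powr (1 - p) * (indicator ?C P *\<^sub>R \<bar>g P\<bar> powr p))"
    unfolding set_lebesgue_integral_def
  proof (rule integral_mono')
    have "emeasure (leb 2) ?C < \<infinity>"
      using measure_cell[OF D] by (rule order.strict_trans1) auto
    moreover have "set_integrable (leb 2) ?C (\<lambda>P. \<bar>g P\<bar> powr p)"
      using g by (auto simp: Lp_def intro: set_integrable_subset[OF _ cell_sets cell_subset_U])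
    ultimately show "integrable (leb 2) (\<lambda>P. t * indicator ?C P + t powr (1 - p) * (indicator ?C P *\<^sub>R \<bar>g P\<bar> powr p))"
      using cell_sets by (auto simp: set_integrable_def intro!: integrable_real_indicator)
    fix P assume P: "P \<in> space (leb 2)"
    \<comment> \<open>For \<open>\<bar>u\<bar> > t\<close> the factor
      \<open>t powr (1 - p) * \<bar>u\<bar> powr (p - 1)\<close> is at least 1.\<close>
    have young: "\<bar>u\<bar> \<le> t + t powr (1 - p) * \<bar>u\<bar> powr p" for u :: real
    proof (cases "\<bar>u\<bar> \<le> t")
      case True
      then show ?thesis by (simp add: add_increasing2)
    next
      case False
      then have "t powr (p - 1) \<le> \<bar>u\<bar> powr (p - 1)"
        using t p by (intro powr_mono2) auto
      then have "t powr (1 - p) * (t powr (p - 1) * \<bar>u\<bar>) \<le> t powr (1 - p) * (\<bar>u\<bar> powr (p - 1) * \<bar>u\<bar>)"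
        by (intro mult_left_mono mult_right_mono) auto
      moreover have "t powr (1 - p) * (t powr (p - 1) * \<bar>u\<bar>) = \<bar>u\<bar>"
        using t unfolding mult.assoc[symmetric] powr_add[symmetric] by simp
      moreover have "\<bar>u\<bar> powr (p - 1) * \<bar>u\<bar> = \<bar>u\<bar> powr p"
        using False t powr_add[of "\<bar>u\<bar>" "p - 1" 1] by simp
      ultimately show ?thesis using t by simp
    qed
    show "0 \<le> t * indicator ?C P + t powr (1 - p) * (indicator ?C P *\<^sub>R \<bar>g P\<bar> powr p)"
      using t by (auto split: split_indicator)
    show "indicator U P *\<^sub>R (g P * test P) \<le> t * indicator ?C P + t powr (1 - p) * (indicator ?C P *\<^sub>R \<bar>g P\<bar> powr p)"
    proof (cases "P \<in> ?C")
      case True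
      have "g P * test P \<le> \<bar>g P\<bar> * test P"
        by (rule mult_right_mono[OF abs_ge_self step_test_bounds(1)])
      also have "\<dots> \<le> \<bar>g P\<bar> * 1"
        by (rule mult_left_mono[OF step_test_bounds(2) abs_ge_zero])
      finally have "g P * test P \<le> \<bar>g P\<bar>" by simp
      then show ?thesis using True cell_subset_U young[of "g P"] by auto
    next
      case False
      then have "test P = 0" using step_test_nonzero[of P] P by auto
      then show ?thesis using False by simp
    qed
  qed
  also have "\<dots> = t * measure (leb 2) ?C + t powr (1 - p) * (LINT P:?C|leb 2. \<bar>g P\<bar> powr p)"
  proof -
    have "emeasure (leb 2) ?C < \<infinity>"
      using measure_cell[OF D] by (rule order.strict_trans1) auto
    moreover have "set_integrable (leb 2) ?C (\<lambda>P. \<bar>g P\<bar> powr p)"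
      using g by (auto simp: Lp_def intro: set_integrable_subset[OF _ cell_sets cell_subset_U])
    ultimately show ?thesis
      using cell_sets cell_subset_U
      by (subst Bochner_Integration.integral_add)
        (auto simp: set_integrable_def set_lebesgue_integral_def U_eq Int_absorb2 intro!: integrable_real_indicator arg_cong[where f = "measure (leb 2)"])
  qed
  also have "measure (leb 2) ?C \<le> D * ((s4 - s1) * (x2 - x1))"
  proof -
    have "0 \<le> D" using D[of s1 x1] dil_nonneg[of "(s1, x1)"] s x by (auto simp: K_def)
    then show ?thesis
      using enn2real_mono[OF measure_cell[OF D]] s x by (simp add: measure_def)
  qed
  finally show ?thesis using t by simp
qed

end

end

section \<open>The oscillating fan\<close>

text \<open>With exponent at least 2, a positive power is left in the difference quotient at the
  kink, so the one-sided derivatives agree there.\<close>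

lemma pos_power_deriv:
  fixes t :: real
  shows "((\<lambda>t. max 0 t ^ Suc (Suc n)) has_real_derivative real (Suc (Suc n)) * max 0 t ^ Suc n) (at t)"
proof -
  consider "t > 0" | "t < 0" | "t = 0" by linarith
  then show ?thesis
  proof cases
    case 1
    have "((\<lambda>t. t ^ Suc (Suc n)) has_real_derivative real (Suc (Suc n)) * max 0 t ^ Suc n) (at t)"
      using 1 DERIV_pow[of "Suc (Suc n)" t] by simp
    then show ?thesis
      by (rule has_field_derivative_transform_within_open[of _ _ _ "{0<..}"]) (use 1 in auto)
  next
    case 2
    have "((\<lambda>t. 0) has_real_derivative real (Suc (Suc n)) * max 0 t ^ Suc n) (at t)"
      using 2 by simp
    then show ?thesis
      by (rule has_field_derivative_transform_within_open[of _ _ _ "{..<0}"]) (use 2 in auto)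
  next
    case 3
    have "((\<lambda>h. max 0 h ^ Suc (Suc n) / h) \<longlongrightarrow> 0) (at (0::real))"
    proof (rule filterlim_split_at)
      have "((\<lambda>h. 0) \<longlongrightarrow> (0::real)) (at_left 0)" by simp
      then show "((\<lambda>h. max 0 h ^ Suc (Suc n) / h) \<longlongrightarrow> 0) (at_left (0::real))"
        by (rule Lim_transform_eventually) (auto simp: eventually_at_filter)
      have "((\<lambda>h. h ^ Suc n) \<longlongrightarrow> 0 ^ Suc n) (at_right (0::real))"
        by (intro tendsto_intros)
      then have "((\<lambda>h. h ^ Suc n) \<longlongrightarrow> 0) (at_right (0::real))" by simp
      then show "((\<lambda>h. max 0 h ^ Suc (Suc n) / h) \<longlongrightarrow> 0) (at_right (0::real))"
        by (rule Lim_transform_eventually) (auto simp: eventually_at_filter)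
    qed
    then show ?thesis using 3 by (simp add: DERIV_def)
  qed
qed

lemma pos2_deriv: "((\<lambda>t. (max 0 t)\<^sup>2) has_real_derivative 2 * max 0 t) (at t)" for t :: real
  using pos_power_deriv[of 0 t] by (simp add: power2_eq_square)

lemma pos3_deriv: "((\<lambda>t. (max 0 t)^3) has_real_derivative 3 * (max 0 t)\<^sup>2) (at t)" for t :: real
  using pos_power_deriv[of 1 t] by (simp add: numeral_3_eq_3 numeral_2_eq_2)

lemma pos4_deriv: "((\<lambda>t. (max 0 t)^4) has_real_derivative 4 * (max 0 t)^3) (at t)" for t :: real
  using pos_power_deriv[of 2 t] by (simp add: numeral_3_eq_3 numeral_2_eq_2 eval_nat_numeral)

locale oscillation =
  fixes k :: nat
  assumes k: "1 \<le> k"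
begin

definition m :: nat where "m = 4 * k - 1"

lemma m_pos: "0 < m" and Suc_m: "Suc m = 4 * k" and k_le_m: "k \<le> m"
  using k by (auto simp: m_def)

text \<open>The frequency \<open>m\<close> is the largest one for which source and target below still have bounded weak
  derivatives: \<open>s ^ (3 * k) * width' s\<close> stays bounded.\<close>

definition width :: "real \<Rightarrow> real"
  where "width s = (if s \<le> 0 then 0 else s ^ k * (2 + sin (1 / s ^ m)))"

text \<open>The derivative of \<open>width\<close> for \<open>s > 0\<close>. At \<open>s = 0\<close>
  division by zero supplies a default value, which keeps the bounds below valid on the closed
  interval.\<close>

definition width' :: "real \<Rightarrow> real"
  where "width' s = real k * s ^ (k - 1) * (2 + sin (1 / s ^ m))
    - s ^ k * cos (1 / s ^ m) * (real m / s ^ Suc m)"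

lemma width_bounds: "0 < s \<Longrightarrow> s ^ k \<le> width s" "0 < s \<Longrightarrow> width s \<le> 3 * s ^ k"
proof -
  assume s: "0 < s"
  have "s ^ k * 1 \<le> s ^ k * (2 + sin (1 / s ^ m))"
    using s sin_ge_minus_one[of "1 / s ^ m"] by (intro mult_left_mono) (linarith, simp)
  then show "s ^ k \<le> width s" using s by (simp add: width_def)
  have "s ^ k * (2 + sin (1 / s ^ m)) \<le> s ^ k * 3"
    using s sin_le_one[of "1 / s ^ m"] by (intro mult_left_mono) (linarith, simp)
  then show "width s \<le> 3 * s ^ k" using s by (simp add: width_def)
qed

lemma width_deriv:
  assumes "0 < s"
  shows "(width has_real_derivative width' s) (at s)"
proof -
  have "((\<lambda>s. s ^ k * (2 + sin (1 / s ^ m))) has_real_derivative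
      real k * s ^ (k - 1) * (2 + sin (1 / s ^ m)) + cos (1 / s ^ m) * (- (real m * s ^ (m - 1)) / (s ^ m * s ^ m)) * s ^ k) (at s)"
    using assms by (auto intro!: derivative_eq_intros)
  moreover have e: "real m * s ^ (m - 1) / (s ^ m * s ^ m) = real m / s ^ Suc m"
    using assms m_pos by (cases m) (auto simp: field_simps)
  have "real k * s ^ (k - 1) * (2 + sin (1 / s ^ m)) + cos (1 / s ^ m) * (- (real m * s ^ (m - 1)) / (s ^ m * s ^ m)) * s ^ k
      = width' s"
    unfolding width'_def e[symmetric] by (simp add: mult_ac)
  ultimately have "((\<lambda>s. s ^ k * (2 + sin (1 / s ^ m))) has_real_derivative width' s) (at s)"
    by (simp only:)
  then show ?thesis
    by (rule has_field_derivative_transform_within_open[of _ _ _ "{0<..}"])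
      (use assms in \<open>auto simp: width_def\<close>)
qed

lemma continuous_width: "continuous_on UNIV width"
proof -
  have "isCont width s" for s
  proof -
    consider "s > 0" | "s < 0" | "s = 0" by linarith
    then show ?thesis
    proof cases
      case 1
      then show ?thesis using width_deriv DERIV_isCont by blast
    next
      case 2
      have "isCont (\<lambda>_. 0 :: real) s" by simp
      moreover have "\<forall>\<^sub>F t in nhds s. width t = 0"
        using eventually_nhds_in_open[of "{..<0}" s] 2 by (auto elim!: eventually_mono simp: width_def)
      ultimately show ?thesis by (simp cong: isCont_cong)
    next
      case 3
      have "(width \<longlongrightarrow> 0) (at 0)"
      proof (rule Lim_null_comparison)
        show "\<forall>\<^sub>F t in at 0. norm (width t) \<le> 3 * \<bar>t\<bar> ^ k"
        proof (intro always_eventually allI)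
          fix t show "norm (width t) \<le> 3 * \<bar>t\<bar> ^ k"
          proof (cases "0 < t")
            case True
            then have "0 \<le> t ^ k" by simp
            then have "0 \<le> width t" using width_bounds(1)[OF True] by linarith
            then show ?thesis using width_bounds(2)[OF True] True by simp
          qed (simp add: width_def)
        qed
        have "((\<lambda>t::real. 3 * \<bar>t\<bar> ^ k) \<longlongrightarrow> 3 * \<bar>0\<bar> ^ k) (at 0)"
          by (intro tendsto_intros)
        then show "((\<lambda>t::real. 3 * \<bar>t\<bar> ^ k) \<longlongrightarrow> 0) (at 0)"
          using k by (simp add: power_0_left)
      qed
      then show ?thesis using 3 by (simp add: isCont_def width_def)
    qed
  qed
  then show ?thesis by (simp add: continuous_on_eq_continuous_at)
qed

definition offset :: "real \<Rightarrow> real"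
  where "offset = (SOME A. (\<forall>s. (A has_real_derivative width s) (at s)) \<and> A 0 = 0)"

lemma offset: "(offset has_real_derivative width s) (at s)" "offset 0 = 0"
proof -
  obtain H where H: "\<And>s. (H has_real_derivative width s) (at s)"
    using einterval_antiderivative[of "-\<infinity>" "\<infinity>" width] continuous_width
    by (auto simp: has_real_derivative_iff_has_vector_derivative continuous_on_eq_continuous_at)
  have "((\<lambda>s. H s - H 0) has_real_derivative width s) (at s)" for s
    using DERIV_diff[OF H DERIV_const] by simp
  then have "\<exists>A. (\<forall>s. (A has_real_derivative width s) (at s)) \<and> A 0 = 0"
    by (intro exI[of _ "\<lambda>s. H s - H 0"]) simp
  from someI_ex[OF this] show "(offset has_real_derivative width s) (at s)" "offset 0 = 0"
    by (auto simp: offset_def)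
qed

sublocale fan offset width
proof
  show "0 < width s" if "0 < s" for s
    using width_bounds(1)[OF that] zero_less_power[OF that, of k] by linarith
qed (auto simp: offset continuous_width, simp add: width_def)

text \<open>The square makes the truncation differentiable across the edge \<open>x = s ^ k\<close>
  and leaves in the \<open>s\<close>-derivative one factor of size at most \<open>s ^ k\<close>,
  which \<open>dil\<close> dominates.\<close>

definition src :: "real \<times> real \<Rightarrow> real"
  where "src z = (max 0 (fst z ^ k - snd z))\<^sup>2"

text \<open>The derivative of \<open>(max 0 (x - 1))^3\<close>, hence of integral 1 over
  \<open>{0..2}\<close>.\<close>

definition prof :: "real \<Rightarrow> real" where "prof x = 3 * (max 0 (x - 1))\<^sup>2"

text \<open>The mass \<open>\<integral> dil (s, x) * src (s, x) dx\<close> of the ray \<open>s\<close>.\<close>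

definition mass :: "real \<Rightarrow> real"
  where "mass s = (s ^ k)^3 * width s / 3 + (s ^ k)^4 / 12"

definition tgt :: "real \<times> real \<Rightarrow> real"
  where "tgt z = prof (snd z) * mass (fst z) / dil z"

text \<open>The antiderivative of \<open>dil * src\<close> in \<open>x\<close>, starting at 0: with
  \<open>p = max 0 (s ^ k - x)\<close> the Jacobian on the source is
  \<open>(width s + s ^ k) - p\<close>, so the integrand is
  \<open>(width s + s ^ k) * p^2 - p^3\<close>.\<close>

definition prim :: "real \<Rightarrow> real \<Rightarrow> real"
  where "prim s x = (width s + s ^ k) * ((s ^ k)^3 - (max 0 (s ^ k - x))^3) / 3
    - ((s ^ k)^4 - (max 0 (s ^ k - x))^4) / 4"

definition flux :: "real \<times> real \<Rightarrow> real"
  where "flux z = prim (fst z) (snd z) - mass (fst z) * (max 0 (snd z - 1))^3"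

lemma pow_k: "s \<in> {0..1} \<Longrightarrow> 0 \<le> s ^ k" "s \<in> {0..1} \<Longrightarrow> s ^ k \<le> (1::real)"
  by (auto intro: power_le_one)

lemma width_nonneg: "s \<in> {0..1} \<Longrightarrow> 0 \<le> width s"
  by (rule a_nonneg) simp

lemma width_le: "s \<in> {0..1} \<Longrightarrow> s ^ k \<le> width s" "s \<in> {0..1} \<Longrightarrow> width s \<le> 3 * s ^ k"
  using width_bounds[of s] k by (cases "s = 0"; auto simp: width_def power_0_left)+

lemma mass_bounds:
  assumes "s \<in> {0..1}"
  shows "0 \<le> mass s" "mass s \<le> 2"
proof -
  let ?c = "s ^ k"
  have c: "0 \<le> ?c" "?c \<le> 1" by (rule pow_k[OF assms])+
  show "0 \<le> mass s"
    unfolding mass_def using c width_nonneg[OF assms]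
    by (intro add_nonneg_nonneg divide_nonneg_nonneg mult_nonneg_nonneg zero_le_power[OF c(1)] width_nonneg[OF assms]) auto
  have "?c^3 * width s \<le> 1 * 3"
    using width_le(2)[OF assms] c width_nonneg[OF assms] power_le_one[OF c, of 3]
    by (intro mult_mono) auto
  moreover have "?c^4 \<le> 1" by (rule power_le_one[OF c])
  ultimately show "mass s \<le> 2" unfolding mass_def by simp
qed

lemma prof_nonneg: "0 \<le> prof x"
  by (simp add: prof_def)

lemma prof_near: "x \<le> 1 \<Longrightarrow> prof x = 0"
  by (simp add: prof_def)

lemma continuous_prof: "continuous_on S prof"
  unfolding prof_def[abs_def] by (intro continuous_intros)

lemma prof_deriv: "(prof has_real_derivative 6 * max 0 (x - 1)) (at x)"
proof -
  have "((\<lambda>x. (max 0 (x - 1))\<^sup>2) has_real_derivative 2 * max 0 (x - 1) * 1) (at x)"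
    by (rule DERIV_chain2[OF pos2_deriv]) (auto intro!: derivative_eq_intros)
  from DERIV_cmult[OF this, of 3] show ?thesis by (simp add: prof_def[abs_def])
qed

lemma continuous_mass: "continuous_on S (\<lambda>z. mass (f z))" if "continuous_on S f"
  unfolding mass_def using that by (intro continuous_intros) auto

lemma continuous_tgt: "continuous_on K tgt"
proof -
  \<comment> \<open>The maximum keeps the denominator away from 0 and changes nothing, because
    \<open>prof\<close> vanishes for \<open>x \<le> 1\<close>.\<close>
  have "continuous_on K (\<lambda>z. prof (snd z) * mass (fst z) / (width (fst z) + max 1 (snd z)))"
  proof (intro continuous_intros continuous_mass continuous_on_compose2[OF continuous_prof])
    show "\<forall>z\<in>K. width (fst z) + max 1 (snd z) \<noteq> 0"
      using width_nonneg by (force simp: K_def)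
  qed auto
  then show ?thesis
  proof (rule continuous_on_eq)
    fix z show "prof (snd z) * mass (fst z) / (width (fst z) + max 1 (snd z)) = tgt z"
      by (cases "snd z \<le> 1") (auto simp: tgt_def dil_def prof_near)
  qed
qed

lemma tgt_split: "z \<in> K \<Longrightarrow> dil z * tgt z = prof (snd z) * mass (fst z)"
  using dil_pos[of "fst z" "snd z"]
  by (cases "snd z \<le> 1") (auto simp: tgt_def prof_near K_def)

lemma prim_nonneg:
  assumes s: "s \<in> {0..1}" and x: "0 \<le> x"
  shows "0 \<le> prim s x"
proof -
  define c p where "c = s ^ k" and "p = max 0 (c - x)"
  have cp: "0 \<le> p" "p \<le> c" using x pow_k(1)[OF s] by (auto simp: c_def p_def)
  have "c * (c^3 - p^3) \<le> (width s + c) * (c^3 - p^3)"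
    using width_nonneg[OF s] cp by (intro mult_right_mono) (auto intro: power_mono)
  \<comment> \<open>With the \<open>width\<close> part discarded, \<open>prim\<close> becomes
    \<open>(c - p)^2 * (c^2 + 2 * c * p + 3 * p^2) / 12\<close>.\<close>
  moreover have "0 \<le> (c - p)\<^sup>2 * (c\<^sup>2 + 2 * c * p + 3 * p\<^sup>2)"
    using cp by (intro mult_nonneg_nonneg add_nonneg_nonneg) auto
  moreover have "(c - p)\<^sup>2 * (c\<^sup>2 + 2 * c * p + 3 * p\<^sup>2) = 4 * (c * (c^3 - p^3)) - 3 * (c^4 - p^4)"
    by (simp add: power2_eq_square power3_eq_cube power4_eq_xxxx algebra_simps)
  ultimately have "0 \<le> (width s + c) * (c^3 - p^3) / 3 - (c^4 - p^4) / 4"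
    by argo
  then show ?thesis
    unfolding prim_def c_def[symmetric] p_def[symmetric] .
qed

lemma prim_far: "s ^ k \<le> x \<Longrightarrow> prim s x = mass s"
  by (simp add: prim_def mass_def field_simps power4_eq_xxxx power3_eq_cube)

lemma prim_deriv:
  assumes "s \<in> {0..1}"
  shows "((\<lambda>x. prim s x) has_real_derivative dil (s, x) * src (s, x)) (at x)"
proof -
  have l: "((\<lambda>x. s ^ k - x) has_real_derivative -1) (at x)"
    by (auto intro!: derivative_eq_intros)
  have "((\<lambda>x. prim s x) has_real_derivative
      (width s + s ^ k) * (0 - 3 * (max 0 (s ^ k - x))\<^sup>2 * -1) / 3 - (0 - 4 * (max 0 (s ^ k - x))^3 * -1) / 4) (at x)"
    unfolding prim_def
    by (intro DERIV_diff DERIV_cdivide DERIV_cmult DERIV_const DERIV_chain2[OF pos3_deriv l] DERIV_chain2[OF pos4_deriv l])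
  moreover have "(width s + s ^ k) * (0 - 3 * (max 0 (s ^ k - x))\<^sup>2 * -1) / 3 - (0 - 4 * (max 0 (s ^ k - x))^3 * -1) / 4
      = dil (s, x) * src (s, x)"
  proof -
    have e: "(v + c) * (0 - 3 * p\<^sup>2 * -1) / 3 - (0 - 4 * p^3 * -1) / 4 = (v + (c - p)) * p\<^sup>2" for v c p :: real
      by (simp add: power2_eq_square power3_eq_cube algebra_simps)
    show ?thesis
      unfolding e by (cases "s ^ k \<le> x") (auto simp: src_def dil_def)
  qed
  ultimately show ?thesis by simp
qed

lemma flux_deriv:
  assumes "s \<in> {0..1}" "0 < x" "x < 2"
  shows "((\<lambda>x. flux (s, x)) has_real_derivative dil (s, x) * (src (s, x) - tgt (s, x))) (at x)"
proof -
  have l: "((\<lambda>x. x - 1) has_real_derivative 1) (at x)" for x :: real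
    by (auto intro!: derivative_eq_intros)
  have "((\<lambda>x. prim s x - mass s * (max 0 (x - 1))^3) has_real_derivative
      dil (s, x) * src (s, x) - mass s * (3 * (max 0 (x - 1))\<^sup>2 * 1)) (at x)"
    by (intro DERIV_diff DERIV_cmult prim_deriv assms DERIV_chain2[OF pos3_deriv l])
  moreover have "mass s * (3 * (max 0 (x - 1))\<^sup>2 * 1) = dil (s, x) * tgt (s, x)"
    using tgt_split[of "(s, x)"] assms by (simp add: prof_def K_def)
  ultimately show ?thesis
    by (simp add: flux_def right_diff_distrib)
qed

sublocale ray_transport offset width src tgt flux prof mass
proof
  show "continuous_on K src"
    unfolding src_def[abs_def] by (intro continuous_intros)
  show "continuous_on K tgt" by (rule continuous_tgt)
  show "continuous_on K flux"
    unfolding flux_def[abs_def] prim_def by (intro continuous_intros continuous_mass) auto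
  show "0 \<le> src z" for z by (simp add: src_def)
  show "0 \<le> tgt z" if "z \<in> K" for z
    using that dil_nonneg[OF that] mass_bounds(1)[of "fst z"] prof_nonneg
    by (auto simp: tgt_def K_def)
  show "0 \<le> flux z" if "z \<in> K" for z
  proof (cases "snd z \<le> 1")
    case True
    then show ?thesis using prim_nonneg[of "fst z" "snd z"] that by (auto simp: flux_def K_def)
  next
    case False
    have "fst z \<in> {0..1}" "snd z \<le> 2" using that by (auto simp: K_def)
    then have "prim (fst z) (snd z) = mass (fst z)"
      using False pow_k(2)[of "fst z"] by (intro prim_far) auto
    moreover have "mass (fst z) * (max 0 (snd z - 1))^3 \<le> mass (fst z) * 1"
      using \<open>snd z \<le> 2\<close> mass_bounds(1)[OF \<open>fst z \<in> {0..1}\<close>]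
      by (intro mult_left_mono power_le_one) auto
    ultimately show ?thesis by (simp add: flux_def)
  qed
  show "((\<lambda>x. flux (s, x)) has_real_derivative dil (s, x) * (src (s, x) - tgt (s, x))) (at x)"
    if "s \<in> {0..1}" "0 < x" "x < 2" for s x using that by (rule flux_deriv)
  show "flux (s, 0) = 0" if "s \<in> {0..1}" for s
    using pow_k(1)[OF that] by (simp add: flux_def prim_def)
  show "flux (s, 2) = 0" if "s \<in> {0..1}" for s
    using pow_k(2)[OF that] prim_far[of s 2] by (simp add: flux_def)
  show "src (s, x) = 0" if "(s, x) \<in> K" "1 \<le> x" for s x
    using that pow_k(2)[of s] by (simp add: src_def K_def)
  show "continuous_on UNIV prof" by (rule continuous_prof)
  show "0 \<le> prof x" for x by (rule prof_nonneg)
  show "prof x = 0" if "x \<le> 1" for x using that by (rule prof_near)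
  show "(LINT x:{0..2}|lborel. prof x) = 1"
  proof -
    have d: "((\<lambda>x. (max 0 (x - 1))^3) has_real_derivative prof x) (at x)" for x
    proof -
      have "((\<lambda>x. (max 0 (x - 1))^3) has_real_derivative 3 * (max 0 (x - 1))\<^sup>2 * 1) (at x)"
        by (rule DERIV_chain2[OF pos3_deriv]) (auto intro!: derivative_eq_intros)
      then show ?thesis by (simp add: prof_def)
    qed
    have "(LINT x:{0..2}|lborel. prof x) = (max 0 (2 - 1))^3 - (max 0 (0 - 1))^3"
    proof (rule LINT_deriv(2)[where B = 3])
      show "continuous_on {0..2} (\<lambda>x::real. (max 0 (x - 1))^3)" by (intro continuous_intros)
      show "set_borel_measurable lborel {0..2} prof"
        using borel_measurable_continuous_on_indicator[OF _ continuous_prof[of "{0..2}"]] by (simp add: set_borel_measurable_def)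
      show "\<bar>prof x\<bar> \<le> 3" if "x \<in> {0..2}" for x
        using that by (auto simp: prof_def intro!: power_le_one)
    qed (use d in auto)
    then show ?thesis by simp
  qed
  show "dil z * tgt z = prof (snd z) * mass (fst z)" if "z \<in> K" for z
    using that by (rule tgt_split)
qed

section \<open>Sobolev regularity of source and target\<close>

lemma dil_ge: "(s, x) \<in> K \<Longrightarrow> s ^ k \<le> dil (s, x)"
  using width_le(1)[of s] by (simp add: dil_def K_def)

lemma power_pred_k: "s \<in> {0..1} \<Longrightarrow> 0 \<le> s ^ (k - 1)" "s \<in> {0..1} \<Longrightarrow> s ^ (k - 1) \<le> (1::real)"
  by (auto intro: power_le_one)

text \<open>The critical condition is that \<open>dil\<close> dominates the
  \<open>s\<close>-derivative; the truncated factor in it is at most \<open>s ^ k\<close>, and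
  \<open>dil_ge\<close> applies.\<close>

lemma src_W1p:
  assumes "0 \<le> p"
  shows "fp \<in> W1p 2 U p"
  unfolding fp_def[abs_def]
proof (rule W1p_of_ray_coordinates[OF cont_Fp,
    where Fs = "\<lambda>z. 2 * max 0 (fst z ^ k - snd z) * (real k * fst z ^ (k - 1))"
      and Fx = "\<lambda>z. - 2 * max 0 (fst z ^ k - snd z)" and B = "2 * real k"])
  fix s x :: real
  have l: "((\<lambda>s. s ^ k - x) has_real_derivative real k * s ^ (k - 1)) (at s)"
    by (auto intro!: derivative_eq_intros)
  show "((\<lambda>s. src (s, x)) has_real_derivative 2 * max 0 (fst (s, x) ^ k - snd (s, x)) * (real k * fst (s, x) ^ (k - 1))) (at s)"
    using DERIV_chain2[OF pos2_deriv l] by (simp add: src_def)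
  have l: "((\<lambda>x. s ^ k - x) has_real_derivative - 1) (at x)"
    by (auto intro!: derivative_eq_intros)
  show "((\<lambda>x. src (s, x)) has_real_derivative - 2 * max 0 (fst (s, x) ^ k - snd (s, x))) (at x)"
    using DERIV_chain2[OF pos2_deriv l] by (simp add: src_def)
next
  show "(\<lambda>z. 2 * max 0 (fst z ^ k - snd z) * (real k * fst z ^ (k - 1))) \<in> borel_measurable (restrict_space borel K)"
    "(\<lambda>z. - 2 * max 0 (fst z ^ k - snd z)) \<in> borel_measurable (restrict_space borel K)"
    by (intro measurable_K_continuous continuous_intros)+
next
  fix z assume z: "z \<in> K"
  obtain s x where sx: "z = (s, x)" "s \<in> {0..1}" "0 \<le> x" using z by (auto simp: K_def)
  have c: "0 \<le> max 0 (s ^ k - x)" "max 0 (s ^ k - x) \<le> s ^ k"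
    using sx(3) pow_k(1)[OF sx(2)] by auto
  have "max 0 (s ^ k - x) * s ^ (k - 1) \<le> s ^ k * 1"
    using c power_pred_k[OF sx(2)] by (intro mult_mono) auto
  also have "\<dots> \<le> dil z" using dil_ge[of s x] z sx(1) by simp
  finally have "2 * real k * (max 0 (s ^ k - x) * s ^ (k - 1)) \<le> 2 * real k * dil z"
    by (intro mult_left_mono) auto
  then show "\<bar>2 * max 0 (fst z ^ k - snd z) * (real k * fst z ^ (k - 1))\<bar> \<le> 2 * real k * dil z"
    using c power_pred_k[OF sx(2)] by (simp add: sx(1) abs_mult mult_ac)
  show "\<bar>- 2 * max 0 (fst z ^ k - snd z)\<bar> \<le> 2 * real k"
    using c pow_k(2)[OF sx(2)] k by (simp add: sx(1))
qed (rule assms)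

definition mass' :: "real \<Rightarrow> real"
  where "mass' s = (3 * (s ^ k)\<^sup>2 * (real k * s ^ (k - 1)) * width s + (s ^ k)^3 * width' s) / 3
    + 4 * (s ^ k)^3 * (real k * s ^ (k - 1)) / 12"

lemma mass_deriv:
  assumes "0 < s"
  shows "(mass has_real_derivative mass' s) (at s)"
  unfolding mass_def[abs_def]
  by (auto intro!: derivative_eq_intros width_deriv[OF assms] simp: mass'_def)

text \<open>The powers cancel exactly, \<open>3 * k + k = m + 1\<close>, so differentiating the
  oscillation costs at most a factor \<open>m\<close>. The constant is \<open>3 * k\<close> from the
  amplitude plus \<open>m \<le> 4 * k\<close>.\<close>

lemma width'_bound:
  assumes s: "s \<in> {0..1}"
  shows "\<bar>(s ^ k)^3 * width' s\<bar> \<le> 7 * real k"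
proof -
  have c: "0 \<le> s ^ k" "s ^ k \<le> 1" using pow_k[OF s] by auto
  have "(s ^ k)^3 * (s ^ k * (real m / s ^ Suc m)) \<le> real m"
  proof -
    have e: "(s ^ k)^3 * s ^ k = s ^ Suc m"
    proof -
      have "4 * k = k * 3 + k" by simp
      then show ?thesis by (simp only: Suc_m power_add power_mult)
    qed
    have "(s ^ k)^3 * (s ^ k * (real m / s ^ Suc m)) = s ^ Suc m * (real m / s ^ Suc m)"
      by (simp only: e flip: mult.assoc)
    also have "\<dots> \<le> real m" by (cases "s = 0") auto
    finally show ?thesis .
  qed
  moreover have "0 \<le> (s ^ k)^3 * (s ^ k * (real m / s ^ Suc m))"
    using s c by simp
  ultimately have 1: "\<bar>(s ^ k)^3 * (s ^ k * (real m / s ^ Suc m)) * cos (1 / s ^ m)\<bar> \<le> real m * 1"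
    unfolding abs_mult[of _ "cos _"] by (intro mult_mono) auto
  have c3: "0 \<le> (s ^ k)^3" "(s ^ k)^3 \<le> 1" using c by (auto intro: power_le_one)
  have "\<bar>2 + sin (1 / s ^ m)\<bar> \<le> 3"
    using sin_ge_minus_one[of "1 / s ^ m"] sin_le_one[of "1 / s ^ m"] by linarith
  then have "\<bar>(s ^ k)^3 * (real k * s ^ (k - 1)) * (2 + sin (1 / s ^ m))\<bar> \<le> 1 * (real k * 1) * 3"
    unfolding abs_mult using c3 power_pred_k[OF s] by (intro mult_mono) auto
  with 1 have "\<bar>(s ^ k)^3 * (real k * s ^ (k - 1)) * (2 + sin (1 / s ^ m))
      - (s ^ k)^3 * (s ^ k * (real m / s ^ Suc m)) * cos (1 / s ^ m)\<bar> \<le> 3 * real k + real m"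
    by linarith
  moreover have "(s ^ k)^3 * width' s = (s ^ k)^3 * (real k * s ^ (k - 1)) * (2 + sin (1 / s ^ m))
      - (s ^ k)^3 * (s ^ k * (real m / s ^ Suc m)) * cos (1 / s ^ m)"
    by (simp add: width'_def right_diff_distrib mult_ac)
  moreover have "real m \<le> 4 * real k" by (simp add: m_def)
  ultimately show ?thesis by linarith
qed

text \<open>Both terms of \<open>mass\<close> carry the factor \<open>(s ^ k)^3\<close>, which
  absorbs the singular derivative of the width.\<close>

lemma mass'_bound:
  assumes s: "s \<in> {0..1}"
  shows "\<bar>mass' s\<bar> \<le> 7 * real k" "\<bar>mass s * width' s\<bar> \<le> 14 * real k"
proof -
  have c: "0 \<le> s ^ k" "s ^ k \<le> 1" using pow_k[OF s] by auto
  have w: "0 \<le> width s" "width s \<le> 3" using width_nonneg[OF s] width_le(2)[OF s] c by auto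
  have "\<bar>(s ^ k)\<^sup>2 * (real k * s ^ (k - 1)) * width s\<bar> \<le> 1 * (real k * 1) * 3"
    unfolding abs_mult using c w power_pred_k[OF s] by (intro mult_mono) (auto intro: power_le_one)
  moreover have "\<bar>(s ^ k)^3 * (real k * s ^ (k - 1))\<bar> \<le> 1 * (real k * 1)"
    unfolding abs_mult using c power_pred_k[OF s] by (intro mult_mono) (auto intro: power_le_one)
  moreover have "mass' s = (s ^ k)\<^sup>2 * (real k * s ^ (k - 1)) * width s + (s ^ k)^3 * width' s / 3
      + (s ^ k)^3 * (real k * s ^ (k - 1)) / 3"
    by (simp add: mass'_def field_simps)
  ultimately show "\<bar>mass' s\<bar> \<le> 7 * real k"
    using width'_bound[OF s] by linarith
  have e: "mass s * width' s = ((s ^ k)^3 * width' s) * (width s / 3 + s ^ k / 12)"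
    by (simp add: mass_def field_simps power4_eq_xxxx power3_eq_cube)
  have "\<bar>((s ^ k)^3 * width' s) * (width s / 3 + s ^ k / 12)\<bar> \<le> (7 * real k) * 2"
    unfolding abs_mult[of "(s ^ k)^3 * width' s"] using width'_bound[OF s] c w by (intro mult_mono) auto
  then show "\<bar>mass s * width' s\<bar> \<le> 14 * real k" unfolding e by simp
qed

text \<open>On the support of \<open>prof\<close> one has \<open>dil \<ge> 1\<close>, so the
  quotient rule loses nothing and \<open>mass'_bound\<close> suffices. The constant is
  \<open>3 * (7 * k + 14 * k)\<close>, with \<open>prof \<le> 3\<close> on
  \<open>{0..2}\<close>.\<close>

lemma tgt_W1p:
  assumes "0 \<le> p"
  shows "fm \<in> W1p 2 U p"
  unfolding fm_def[abs_def]
proof (rule W1p_of_ray_coordinates[OF cont_Fm,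
    where Fs = "\<lambda>z. prof (snd z) * (mass' (fst z) / dil z - mass (fst z) * width' (fst z) / (dil z)\<^sup>2)"
      and Fx = "\<lambda>z. mass (fst z) * (6 * max 0 (snd z - 1) / dil z - prof (snd z) / (dil z)\<^sup>2)" and B = "63 * real k"])
  have [measurable]: "width' \<in> borel_measurable borel" "mass \<in> borel_measurable borel" "prof \<in> borel_measurable borel"
    unfolding width'_def[abs_def] mass_def[abs_def] prof_def[abs_def] by measurable
  have [measurable]: "mass' \<in> borel_measurable borel"
    unfolding mass'_def[abs_def] by measurable
  have [measurable]: "(fst :: real \<times> real \<Rightarrow> real) \<in> borel_measurable borel" "(snd :: real \<times> real \<Rightarrow> real) \<in> borel_measurable borel"
    by (auto intro!: borel_measurable_continuous_onI continuous_intros)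
  show "(\<lambda>z. prof (snd z) * (mass' (fst z) / dil z - mass (fst z) * width' (fst z) / (dil z)\<^sup>2)) \<in> borel_measurable (restrict_space borel K)"
    by (rule measurable_restrict_space1) measurable
  show "(\<lambda>z. mass (fst z) * (6 * max 0 (snd z - 1) / dil z - prof (snd z) / (dil z)\<^sup>2)) \<in> borel_measurable (restrict_space borel K)"
    by (rule measurable_restrict_space1) measurable
next
  fix s x :: real assume s: "0 < s" "s < 1" and x: "x \<in> {0..2}"
  have d: "0 < dil (s, x)" using s x by (intro dil_pos) auto
  have ds: "((\<lambda>s. dil (s, x)) has_real_derivative width' s) (at s)"
    unfolding dil_def using width_deriv[OF s(1)] by (auto intro!: derivative_eq_intros)
  have "((\<lambda>s. prof x * (mass s / dil (s, x))) has_real_derivative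
      prof x * ((mass' s * dil (s, x) - mass s * width' s) / (dil (s, x) * dil (s, x)))) (at s)"
    using d by (intro DERIV_cmult DERIV_divide mass_deriv s ds) auto
  moreover have "(mass' s * dil (s, x) - mass s * width' s) / (dil (s, x) * dil (s, x))
      = mass' s / dil (s, x) - mass s * width' s / (dil (s, x))\<^sup>2"
    using d by (simp add: diff_divide_distrib power2_eq_square)
  ultimately show "((\<lambda>s. tgt (s, x)) has_real_derivative
      prof (snd (s, x)) * (mass' (fst (s, x)) / dil (s, x) - mass (fst (s, x)) * width' (fst (s, x)) / (dil (s, x))\<^sup>2)) (at s)"
    by (simp add: tgt_def)
next
  fix s x :: real assume s: "s \<in> {0..1}" and x: "0 < x" "x < 2"
  have d: "0 < dil (s, x)" using s x by (intro dil_pos) auto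
  have dx: "((\<lambda>x. dil (s, x)) has_real_derivative 1) (at x)"
    unfolding dil_def by (auto intro!: derivative_eq_intros)
  have "((\<lambda>x. mass s * (prof x / dil (s, x))) has_real_derivative
      mass s * ((6 * max 0 (x - 1) * dil (s, x) - prof x * 1) / (dil (s, x) * dil (s, x)))) (at x)"
    using d by (intro DERIV_cmult DERIV_divide prof_deriv dx) auto
  moreover have "(6 * max 0 (x - 1) * dil (s, x) - prof x * 1) / (dil (s, x) * dil (s, x))
      = 6 * max 0 (x - 1) / dil (s, x) - prof x / (dil (s, x))\<^sup>2"
    using d by (simp add: diff_divide_distrib power2_eq_square)
  ultimately have "((\<lambda>x. mass s * (prof x / dil (s, x))) has_real_derivative
      mass s * (6 * max 0 (x - 1) / dil (s, x) - prof x / (dil (s, x))\<^sup>2)) (at x)"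
    by (simp only:)
  moreover have "(\<lambda>x. mass s * (prof x / dil (s, x))) = (\<lambda>x. tgt (s, x))"
    by (simp add: tgt_def mult_ac)
  ultimately show "((\<lambda>x. tgt (s, x)) has_real_derivative
      mass (fst (s, x)) * (6 * max 0 (snd (s, x) - 1) / dil (s, x) - prof (snd (s, x)) / (dil (s, x))\<^sup>2)) (at x)"
    by (simp only: fst_conv snd_conv)
next
  fix z assume z: "z \<in> K"
  obtain s x where sx: "z = (s, x)" "s \<in> {0..1}" "0 \<le> x" "x \<le> 2" using z by (auto simp: K_def)
  have k1: "1 \<le> real k" using k by simp
  show "\<bar>prof (snd z) * (mass' (fst z) / dil z - mass (fst z) * width' (fst z) / (dil z)\<^sup>2)\<bar> \<le> 63 * real k * dil z"
  proof (cases "x \<le> 1")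
    case True
    then show ?thesis using dil_nonneg[OF z] by (simp add: sx(1) prof_near)
  next
    case False
    have d: "1 \<le> dil (s, x)" using False width_nonneg[OF sx(2)] by (simp add: dil_def)
    have "\<bar>mass' s / dil (s, x)\<bar> \<le> 7 * real k / 1"
      unfolding abs_divide using d mass'_bound(1)[OF sx(2)] by (intro frac_le) auto
    moreover have "\<bar>mass s * width' s / (dil (s, x))\<^sup>2\<bar> \<le> 14 * real k / 1"
      unfolding abs_divide using d mass'_bound(2)[OF sx(2)] by (intro frac_le) (auto simp: one_le_power)
    ultimately have "\<bar>mass' s / dil (s, x) - mass s * width' s / (dil (s, x))\<^sup>2\<bar> \<le> 21 * real k"
      by linarith
    moreover have "\<bar>prof x\<bar> \<le> 3"
      using sx False by (auto simp: prof_def intro!: power_le_one)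
    ultimately have "\<bar>prof x * (mass' s / dil (s, x) - mass s * width' s / (dil (s, x))\<^sup>2)\<bar> \<le> 3 * (21 * real k)"
      unfolding abs_mult by (intro mult_mono) auto
    also have "\<dots> \<le> 63 * real k * dil (s, x)"
      using d k1 by (simp add: mult_le_cancel_left1)
    finally show ?thesis by (simp add: sx(1))
  qed
  show "\<bar>mass (fst z) * (6 * max 0 (snd z - 1) / dil z - prof (snd z) / (dil z)\<^sup>2)\<bar> \<le> 63 * real k"
  proof (cases "x \<le> 1")
    case True
    then show ?thesis by (simp add: sx(1) prof_near)
  next
    case False
    have d: "1 \<le> dil (s, x)" using False width_nonneg[OF sx(2)] by (simp add: dil_def)
    have "\<bar>6 * max 0 (x - 1) / dil (s, x)\<bar> \<le> 6 / 1"
      unfolding abs_divide using d sx by (intro frac_le) auto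
    moreover have "\<bar>prof x / (dil (s, x))\<^sup>2\<bar> \<le> 3 / 1"
      unfolding abs_divide using d sx False
      by (intro frac_le) (auto simp: one_le_power prof_def intro!: power_le_one)
    ultimately have "\<bar>6 * max 0 (x - 1) / dil (s, x) - prof x / (dil (s, x))\<^sup>2\<bar> \<le> 9"
      by linarith
    then have "\<bar>mass s * (6 * max 0 (x - 1) / dil (s, x) - prof x / (dil (s, x))\<^sup>2)\<bar> \<le> 2 * 9"
      unfolding abs_mult using mass_bounds[OF sx(2)] by (intro mult_mono) auto
    then show ?thesis using k1 by (simp add: sx(1))
  qed
qed (rule assms)

end

section \<open>Blow-up of the gradient of the transport density\<close>

context oscillation
begin

definition osc :: "real \<Rightarrow> real" where "osc s = sin (1 / s ^ m)"

lemma width_osc: "0 < s \<Longrightarrow> width s = s ^ k * (2 + osc s)"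
  by (simp add: width_def osc_def)

lemma osc_ge: "-1 \<le> osc s"
  by (simp add: osc_def)

lemma mass_osc: "0 < s \<Longrightarrow> mass s = (s ^ k)^4 * (9 + 4 * osc s) / 12"
  by (simp add: mass_def width_osc power4_eq_xxxx power3_eq_cube field_simps)

lemma flux_middle: "s ^ k \<le> x \<Longrightarrow> x \<le> 1 \<Longrightarrow> flux (s, x) = mass s"
  by (simp add: flux_def prim_far)

lemma q_mono: "0 \<le> s \<Longrightarrow> s \<le> t \<Longrightarrow> q s \<le> q t"
  by (simp add: q_def power_mono)

text \<open>The transport density at abscissa \<open>x\<close>, with the slow variable
  \<open>s\<close> and the value \<open>v\<close> of the fast oscillation decoupled; for
  \<open>v = osc s\<close>, \<open>s > 0\<close> and \<open>s ^ k \<le> x \<le> 1\<close> it is the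
  true one.\<close>

definition ray_density :: "real \<Rightarrow> real \<Rightarrow> real \<Rightarrow> real"
  where "ray_density s v x = q s * ((s ^ k)^4 * (9 + 4 * v) / (12 * (s ^ k * (2 + v) + x)))"

text \<open>For \<open>c = r ^ k \<le> x\<close> the density increases in the oscillation value,
  because \<open>4 * x > c\<close>, and also in \<open>c\<close> and in \<open>q\<close>. Among the
  admissible rays and values, \<open>r = b\<close> and \<open>v = - (1/2)\<close> are therefore
  extremal.\<close>

lemma transport_le_ray_density:
  assumes r: "0 < r" "r \<le> b" and o: "osc r \<le> - (1/2)" and x: "b ^ k \<le> x"
  shows "mass r * q r \<le> ray_density b (- (1/2)) x * dil (r, x)"
proof -
  define c C v where "c = r ^ k" and "C = b ^ k" and "v = osc r"
  have c: "0 < c" "c \<le> C" "C \<le> x" using r x by (auto simp: c_def C_def intro: power_mono)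
  have v: "-1 \<le> v" "v \<le> - (1/2)" using o osc_ge by (auto simp: v_def)
  have "0 < 2 + v" "0 < x" using c v by linarith+
  then have d: "0 < c * (2 + v) + x" using c by (intro add_pos_pos[OF mult_pos_pos]) auto
  \<comment> \<open>The product is the difference of the two sides of the next inequality, which is
    monotonicity in \<open>v\<close> cleared of denominators.\<close>
  have "0 \<le> (- (1 + 2 * v)) * (2 * x - c / 2)"
    using c v by (intro mult_nonneg_nonneg) auto
  then have 1: "(9 + 4 * v) * (c * (3/2) + x) \<le> 7 * (c * (2 + v) + x)"
    by (simp add: algebra_simps)
  have "c^3 \<le> C^3" "c^4 \<le> C^4" using c by (auto intro: power_mono)
  then have "(c * C) * c^3 \<le> (c * C) * C^3" "c^4 * x \<le> C^4 * x"
    using c by (auto intro: mult_left_mono mult_right_mono)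
  then have 2: "c^4 * (C * (3/2) + x) \<le> C^4 * (c * (3/2) + x)"
    by (simp add: algebra_simps power3_eq_cube power4_eq_xxxx)
  have "c^4 * (9 + 4 * v) * (C * (3/2) + x) = (9 + 4 * v) * (c^4 * (C * (3/2) + x))" by simp
  also have "\<dots> \<le> (9 + 4 * v) * (C^4 * (c * (3/2) + x))"
    using v 2 by (intro mult_left_mono) auto
  also have "\<dots> = C^4 * ((9 + 4 * v) * (c * (3/2) + x))" by simp
  also have "\<dots> \<le> C^4 * (7 * (c * (2 + v) + x))"
    using c 1 by (intro mult_left_mono) auto
  finally have le: "c^4 * (9 + 4 * v) \<le> C^4 * (7 * (c * (2 + v) + x)) / (C * (3/2) + x)"
    using c by (subst pos_le_divide_eq) auto
  have e: "C^4 * 7 / (12 * y) * z = (C^4 * (7 * z) / y) / 12" for y z :: real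
    by simp
  have 3: "c^4 * (9 + 4 * v) / 12 \<le> C^4 * 7 / (12 * (C * (3/2) + x)) * (c * (2 + v) + x)"
    unfolding e by (rule divide_right_mono[OF le]) simp
  have "mass r * q r = q r * (c^4 * (9 + 4 * v) / 12)"
    using r by (simp add: mass_osc c_def v_def)
  also have "\<dots> \<le> q b * (C^4 * 7 / (12 * (C * (3/2) + x)) * (c * (2 + v) + x))"
    using q_mono[of r b] r q_pos[of b] c v 3 by (intro mult_mono) auto
  also have "\<dots> = ray_density b (- (1/2)) x * dil (r, x)"
    using r by (simp add: ray_density_def dil_def width_osc c_def v_def C_def)
  finally show ?thesis .
qed

text \<open>The mirror image: to the right of \<open>b\<close>, where the oscillation is large, the
  smallest value is at \<open>r = b\<close> and \<open>v = 1/2\<close>.\<close>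

lemma ray_density_le_transport:
  assumes r: "0 < b" "b \<le> r" and o: "1/2 \<le> osc r" and x: "r ^ k \<le> x"
  shows "ray_density b (1/2) x * dil (r, x) \<le> mass r * q r"
proof -
  define c C v where "c = r ^ k" and "C = b ^ k" and "v = osc r"
  have c: "0 < C" "C \<le> c" "c \<le> x" using r x by (auto simp: c_def C_def intro: power_mono)
  have d: "0 < c * (2 + v) + x" using c o by (intro add_pos_pos mult_pos_pos) (auto simp: v_def)
  have "0 \<le> (2 * v - 1) * (2 * x - c / 2)"
    using c o by (intro mult_nonneg_nonneg) (auto simp: v_def)
  then have 1: "11 * (c * (2 + v) + x) \<le> (9 + 4 * v) * (c * (5/2) + x)"
    by (simp add: algebra_simps)
  have "C^3 \<le> c^3" "C^4 \<le> c^4" using c by (auto intro: power_mono)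
  then have "(c * C) * C^3 \<le> (c * C) * c^3" "C^4 * x \<le> c^4 * x"
    using c by (auto intro: mult_left_mono mult_right_mono)
  then have 2: "C^4 * (c * (5/2) + x) \<le> c^4 * (C * (5/2) + x)"
    by (simp add: algebra_simps power3_eq_cube power4_eq_xxxx)
  have "C^4 * (11 * (c * (2 + v) + x)) \<le> C^4 * ((9 + 4 * v) * (c * (5/2) + x))"
    using c 1 by (intro mult_left_mono) auto
  also have "\<dots> = (9 + 4 * v) * (C^4 * (c * (5/2) + x))" by simp
  also have "\<dots> \<le> (9 + 4 * v) * (c^4 * (C * (5/2) + x))"
    using o 2 by (intro mult_left_mono) (auto simp: v_def)
  also have "\<dots> = c^4 * (9 + 4 * v) * (C * (5/2) + x)" by simp
  finally have le: "C^4 * (11 * (c * (2 + v) + x)) / (C * (5/2) + x) \<le> c^4 * (9 + 4 * v)"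
    using c by (subst pos_divide_le_eq) auto
  have e: "C^4 * 11 / (12 * y) * z = (C^4 * (11 * z) / y) / 12" for y z :: real
    by simp
  have 3: "C^4 * 11 / (12 * (C * (5/2) + x)) * (c * (2 + v) + x) \<le> c^4 * (9 + 4 * v) / 12"
    unfolding e by (rule divide_right_mono[OF le]) simp
  have "ray_density b (1/2) x * dil (r, x) = q b * (C^4 * 11 / (12 * (C * (5/2) + x)) * (c * (2 + v) + x))"
    using r by (simp add: ray_density_def dil_def width_osc c_def v_def C_def)
  also have "\<dots> \<le> q r * (c^4 * (9 + 4 * v) / 12)"
    using q_mono[of b r] r q_pos[of r] c d 3 by (intro mult_mono) auto
  also have "\<dots> = mass r * q r"
    using r by (simp add: mass_osc c_def v_def)
  finally show ?thesis .
qed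

text \<open>With \<open>C = b ^ k\<close> the difference of the two fractions is
  \<open>C^4 / 12 * (4 * x - C)\<close> over the product of the denominators. The numerator
  \<open>4 * x - C\<close> is at least \<open>3 * B\<close>, the denominators are at most
  \<open>9/2 * B\<close> and \<open>7/2 * B\<close>, and \<open>C \<ge> B / 2\<close>; this gives
  \<open>B^3 / 1008\<close>.\<close>

lemma ray_density_gap:
  assumes B: "0 < B" "B \<le> 2 * b ^ k" "b ^ k \<le> B" "B \<le> x" "x \<le> 2 * B"
  shows "B^3 / 1100 \<le> ray_density b (1/2) x - ray_density b (- (1/2)) x"
proof -
  define C where "C = b ^ k"
  have C: "B \<le> 2 * C" "C \<le> B" "0 < C" using B by (auto simp: C_def)
  have d: "0 < C * (5/2) + x" "0 < C * (3/2) + x" using C B by auto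
  have q1: "1 \<le> q b" by (simp add: q_def)
  have "(C * (5/2) + x) * (C * (3/2) + x) \<le> (B * (9/2)) * (B * (7/2))"
    using C B d by (intro mult_mono) auto
  moreover have "3 * B \<le> 4 * x - C" using C B by linarith
  ultimately have "3 * B / ((B * (9/2)) * (B * (7/2))) \<le> (4 * x - C) / ((C * (5/2) + x) * (C * (3/2) + x))"
    using d B by (intro frac_le mult_pos_pos) auto
  moreover have "3 * B / ((B * (9/2)) * (B * (7/2))) = 4 / (21 * B)"
    using B by (simp add: field_simps)
  moreover have "(B / 2)^4 \<le> C^4" using C B by (intro power_mono) auto
  ultimately have "(B / 2)^4 / 12 * (4 / (21 * B)) \<le> C^4 / 12 * ((4 * x - C) / ((C * (5/2) + x) * (C * (3/2) + x)))"
    using B by (intro mult_mono) auto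
  moreover have "(B / 2)^4 / 12 * (4 / (21 * B)) = B^3 / 1008"
    using B by (simp add: field_simps power4_eq_xxxx power3_eq_cube)
  moreover have "C^4 / 12 * ((4 * x - C) / ((C * (5/2) + x) * (C * (3/2) + x)))
      = C^4 * 11 / (12 * (C * (5/2) + x)) - C^4 * 7 / (12 * (C * (3/2) + x))"
    using d by (simp add: divide_simps) (simp add: algebra_simps)
  ultimately have g: "B^3 / 1008 \<le> C^4 * 11 / (12 * (C * (5/2) + x)) - C^4 * 7 / (12 * (C * (3/2) + x))"
    by simp
  have B3: "0 \<le> B^3" using B by simp
  have "B^3 / 1100 \<le> 1 * (B^3 / 1008)" using B3 by simp
  also have "\<dots> \<le> q b * (C^4 * 11 / (12 * (C * (5/2) + x)) - C^4 * 7 / (12 * (C * (3/2) + x)))"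
    using q1 g B3 by (intro mult_mono) auto
  also have "\<dots> = ray_density b (1/2) x - ray_density b (- (1/2)) x"
    by (simp add: ray_density_def C_def right_diff_distrib)
  finally show ?thesis .
qed

section \<open>Phase windows and cells\<close>

definition ray_at :: "real \<Rightarrow> real" where "ray_at \<tau> = root m (1 / \<tau>)"

lemma ray_at:
  assumes "1 < \<tau>"
  shows "0 < ray_at \<tau>" "ray_at \<tau> < 1" "ray_at \<tau> ^ m = 1 / \<tau>"
  using assms m_pos by (auto simp: ray_at_def)

lemma ray_at_less: "1 < \<tau> \<Longrightarrow> \<tau> < \<tau>' \<Longrightarrow> ray_at \<tau>' < ray_at \<tau>"
  using m_pos by (simp add: ray_at_def frac_less2)

lemma phase_between:
  assumes "1 < \<tau>" "\<tau> < \<tau>'" "r \<in> {ray_at \<tau>'..ray_at \<tau>}"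
  shows "0 < r" "\<tau> \<le> 1 / r ^ m" "1 / r ^ m \<le> \<tau>'"
proof -
  have r: "0 < ray_at \<tau>'" "ray_at \<tau>' \<le> r" "r \<le> ray_at \<tau>"
    using assms ray_at(1)[of \<tau>'] by auto
  then show "0 < r" by linarith
  then have p: "0 < r ^ m" by simp
  have "ray_at \<tau>' ^ m \<le> r ^ m" "r ^ m \<le> ray_at \<tau> ^ m"
    using r by (auto intro: power_mono)
  then have "1 / \<tau>' \<le> r ^ m" "r ^ m \<le> 1 / \<tau>"
    using ray_at(3)[of \<tau>] ray_at(3)[of \<tau>'] assms by auto
  then show "\<tau> \<le> 1 / r ^ m" "1 / r ^ m \<le> \<tau>'"
    using p assms by (auto simp: field_simps)
qed

lemma sin_le_neg_half: "sin t \<le> - (1/2)" if "2 * pi * real n + 7 * pi / 6 \<le> t" "t \<le> 2 * pi * real n + 11 * pi / 6"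
proof -
  define u where "u = t - 2 * pi * real n - 3 * pi / 2"
  have u: "\<bar>u\<bar> \<le> pi / 3" using that unfolding u_def abs_le_iff by linarith
  have "cos (pi / 3) \<le> cos \<bar>u\<bar>"
    using u pi_gt_zero by (intro cos_monotone_0_pi_le) auto
  then have "1 / 2 \<le> cos u" by (simp add: cos_60)
  moreover have "t = (u + 3 / 2 * pi) + of_nat n * (2 * pi)" by (simp add: u_def)
  then have "sin t = sin (u + 3 / 2 * pi)" using sin.plus_of_nat[of "u + 3 / 2 * pi" n] by simp
  moreover have "sin (u + 3 / 2 * pi) = - cos u"
    unfolding sin_add sin_3over2_pi cos_3over2_pi by simp
  ultimately show ?thesis by simp
qed

lemma sin_ge_half: "1/2 \<le> sin t" if "2 * pi * real n + pi / 6 \<le> t" "t \<le> 2 * pi * real n + 5 * pi / 6"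
proof -
  define u where "u = t - 2 * pi * real n - pi / 2"
  have u: "\<bar>u\<bar> \<le> pi / 3" using that unfolding u_def abs_le_iff by linarith
  have "cos (pi / 3) \<le> cos \<bar>u\<bar>"
    using u pi_gt_zero by (intro cos_monotone_0_pi_le) auto
  then have "1 / 2 \<le> cos u" by (simp add: cos_60)
  moreover have "t = (u + pi / 2) + of_nat n * (2 * pi)" by (simp add: u_def)
  then have "sin t = sin (u + pi / 2)" using sin.plus_of_nat[of "u + pi / 2" n] by simp
  moreover have "sin (u + pi / 2) = cos u"
    by (simp add: sin_add)
  ultimately show ?thesis by simp
qed

text \<open>The phases \<open>1 / s ^ m\<close> delimiting, within the \<open>n\<close>-th period, a stretch with \<open>sin \<le> - 1/2\<close>
  and a stretch with \<open>sin \<ge> 1/2\<close>; the shift by 4 makes all quantities small enough.\<close>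

definition phase :: "nat \<Rightarrow> real \<Rightarrow> real" where "phase n j = 2 * pi * real (n + 4) + j * pi / 6"

abbreviation "bound n j \<equiv> ray_at (phase n j)"

lemma phase_less: "i < j \<Longrightarrow> phase n i < phase n j"
  by (simp add: phase_def)

lemma phase_ge: "0 \<le> j \<Longrightarrow> 16 \<le> phase n j"
proof -
  assume "0 \<le> j"
  have "2 * 2 * 4 \<le> 2 * pi * real (n + 4)"
    using pi_ge_two by (intro mult_mono) auto
  then show ?thesis using \<open>0 \<le> j\<close> by (simp add: phase_def add_increasing2)
qed

text \<open>The phase decreases in \<open>s\<close>, so phase 11 bounds the cell on the left and
  phase 1 on the right. Between the abscissas \<open>B\<close> and \<open>2 * B\<close>, with
  \<open>B = bound n 1 ^ k\<close>, every ray of the cell has left its source, and it has not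
  reached its target because \<open>B \<le> 1/2\<close>.\<close>

definition ncell :: "nat \<Rightarrow> point set"
  where "ncell n = cell (bound n 11) (bound n 1) (bound n 1 ^ k) (2 * bound n 1 ^ k)"

lemma bound_props:
  "0 < bound n 11" "bound n 11 < bound n 7" "bound n 7 < bound n 5" "bound n 5 < bound n 1" "bound n 1 < 1"
  "bound n 1 ^ k \<le> 1 / 2" "bound n 1 ^ k \<le> 2 * bound n 7 ^ k" "bound n 1 - bound n 11 \<le> 7 * (bound n 1 ^ k)^4"
proof -
  note ph = phase_ge[of 1 n] phase_ge[of 5 n] phase_ge[of 7 n] phase_ge[of 11 n]
  show pos: "0 < bound n 11" using ray_at(1)[of "phase n 11"] ph by simp
  show l1: "bound n 11 < bound n 7" using ph by (intro ray_at_less phase_less) auto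
  show l2: "bound n 7 < bound n 5" using ph by (intro ray_at_less phase_less) auto
  show l3: "bound n 5 < bound n 1" using ph by (intro ray_at_less phase_less) auto
  show lt1: "bound n 1 < 1" using ray_at(2)[of "phase n 1"] ph by simp
  have B4: "(bound n 1 ^ k)^4 = bound n 1 ^ m * bound n 1"
    by (simp only: power_mult[symmetric] mult.commute[of k 4] Suc_m[symmetric] power_Suc2)
  have p1: "0 < bound n 1" using pos l1 l2 l3 by linarith
  show "bound n 1 ^ k \<le> 1 / 2"
  proof (rule ccontr)
    assume "\<not> bound n 1 ^ k \<le> 1 / 2"
    \<comment> \<open>The shift by 4 in the phase enters here: the phase is at least 16, the fourth
      power of 2.\<close>
    then have "(1/2)^4 < (bound n 1 ^ k)^4" by (intro power_strict_mono) auto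
    also have "\<dots> \<le> bound n 1 ^ m * 1"
      unfolding B4 using p1 lt1 by (intro mult_left_mono) auto
    also have "\<dots> = 1 / phase n 1" using ray_at(3)[of "phase n 1"] ph by simp
    also have "\<dots> \<le> 1 / 16" using ph by (intro divide_left_mono) auto
    finally show False by (simp add: power4_eq_xxxx)
  qed
  have p7: "0 < bound n 7" using pos l1 by linarith
  show "bound n 1 ^ k \<le> 2 * bound n 7 ^ k"
  proof -
    have r: "1 \<le> bound n 1 / bound n 7" using p7 l2 l3 by simp
    \<comment> \<open>Since \<open>k \<le> m\<close>, the ratio of \<open>k\<close>-th powers is
      controlled by that of \<open>m\<close>-th powers, which is a ratio of phases.\<close>
    have "(bound n 1 / bound n 7) ^ k \<le> (bound n 1 / bound n 7) ^ m"
      by (rule power_increasing[OF k_le_m r])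
    also have "\<dots> = phase n 7 / phase n 1"
      using ray_at(3)[of "phase n 1"] ray_at(3)[of "phase n 7"] ph by (simp add: power_divide)
    also have "\<dots> \<le> 2"
    proof -
      have "phase n 7 \<le> 2 * phase n 1"
        using pi_gt_zero by (simp add: phase_def algebra_simps)
      then show ?thesis using ph by (simp add: pos_divide_le_eq)
    qed
    finally show ?thesis using p7 by (simp add: power_divide pos_divide_le_eq)
  qed
  obtain l where l: "m = Suc l" using m_pos gr0_implies_Suc by blast
  \<comment> \<open>The increment of \<open>s ^ m\<close> over the cell is at least its length times
    \<open>bound n 1 ^ l\<close>. It is also a difference of reciprocal phases, at most
    \<open>7 * bound n 1 ^ (2 * m)\<close> as \<open>10 * pi / 6 < 7\<close>; dividing leaves the
    power \<open>m + 1 = 4 * k\<close>.\<close>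
  have "(bound n 1 - bound n 11) * bound n 1 ^ l \<le> bound n 1 ^ m - bound n 11 ^ m"
  proof -
    have "bound n 11 ^ l * bound n 11 \<le> bound n 1 ^ l * bound n 11"
      using pos l1 l2 l3 by (intro mult_right_mono power_mono) auto
    then show ?thesis by (simp add: l algebra_simps)
  qed
  also have "\<dots> = (phase n 11 - phase n 1) * (bound n 11 ^ m * bound n 1 ^ m)"
    using ray_at(3)[of "phase n 1"] ray_at(3)[of "phase n 11"] ph by (simp add: field_simps)
  also have "\<dots> \<le> 7 * (bound n 1 ^ m * bound n 1 ^ m)"
  proof (intro mult_mono)
    show "phase n 11 - phase n 1 \<le> 7" using pi_less_4 by (simp add: phase_def)
    show "bound n 11 ^ m \<le> bound n 1 ^ m" using pos l1 l2 l3 by (intro power_mono) auto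
  qed (use pos p1 in auto)
  also have "\<dots> = (7 * (bound n 1 ^ k)^4) * bound n 1 ^ l"
    unfolding B4 by (simp add: l mult_ac)
  finally show "bound n 1 - bound n 11 \<le> 7 * (bound n 1 ^ k)^4"
    using p1 by (simp add: mult_le_cancel_right)
qed

text \<open>A jump of at least \<open>B^3 / 1100\<close> across a cell of area at most
  \<open>35 * B^6\<close> is fed into the general lower bound. In the resulting
  \<open>B^4 = b / phase\<close> the factor \<open>b\<close> is compensated by
  \<open>t powr (p - 1)\<close>, of order \<open>b powr (- 2 * k * (p - 1))\<close>.\<close>

lemma ncell_lower_bound:
  assumes td: "transport_density 2 \<Omega> fp fm \<sigma>" and weak: "weak_partial 2 U 1 \<sigma> g" and g: "g \<in> Lp 2 U p"
    and p: "1 < p" "1 \<le> 2 * real k * (p - 1)"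
  shows "231000 powr (1 - p) / 6600 / phase n 1 \<le> (LINT P:ncell n|leb 2. \<bar>g P\<bar> powr p)"
proof -
  define b B E where "b = bound n 1" and "B = b ^ k" and "E = (LINT P:ncell n|leb 2. \<bar>g P\<bar> powr p)"
  note bp = bound_props[of n, folded b_def, folded B_def]
  define w where "w = B * min (bound n 7 - bound n 11) (b - bound n 5)"
  \<comment> \<open>Chosen so that the area term \<open>35 * B^6 * t\<close> is half of the left
    side \<open>B^4 / 3300\<close>; \<open>231000 = 35 * 6600\<close>.\<close>
  define t where "t = 1 / (231000 * B\<^sup>2)"
  have ph: "16 \<le> phase n 1" "16 \<le> phase n 5" "16 \<le> phase n 7" "16 \<le> phase n 11"
    by (auto intro: phase_ge)
  have b0: "0 < b" "b < 1" using bp by linarith+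
  have B0: "0 < B" using b0 by (simp add: B_def)
  have kpow: "r ^ k \<le> B" if "r \<in> {bound n 11..b}" for r
    using that bp(1) unfolding B_def by (intro power_mono) auto
  have "B^3 / 1100 * ((2 * B - B) / 3) \<le> t * (5 * B * ((b - bound n 11) * (2 * B - B)))
    + t powr (1 - p) * (LINT P:cell (bound n 11) b B (2 * B)|leb 2. \<bar>g P\<bar> powr p)"
  \<comment> \<open>Both comparison densities are taken at the same ray \<open>bound n 7\<close>,
    the right end of the low stretch, so that their gap comes from the oscillation alone.\<close>
  proof (rule weak_derivative_lower_bound[OF _ _ _ _ _ _ _ _ _ _ _ td weak g p(1),
      where ?s2.0 = "bound n 7" and ?s3.0 = "bound n 5" and w = w
        and rL = "ray_density (bound n 7) (- (1/2))" and rR = "ray_density (bound n 7) (1/2)"])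
    show "0 < w" using B0 bp by (simp add: w_def)
    show "w \<le> B * (bound n 7 - bound n 11)" "w \<le> B * (b - bound n 5)"
      using B0 by (auto simp: w_def)
    show "0 < t" using B0 by (simp add: t_def)
    show "flux (r, y) * q r \<le> ray_density (bound n 7) (- (1/2)) y * dil (r, y)"
      if r: "r \<in> {bound n 11..bound n 7}" and y: "y \<in> {B..2 * B}" for r y
    proof -
      have "phase n 7 \<le> 1 / r ^ m" "1 / r ^ m \<le> phase n 11" "0 < r"
        using phase_between[OF _ _ r] ph phase_less[of 7 11 n] by auto
      then have o: "osc r \<le> - (1/2)"
        unfolding osc_def by (intro sin_le_neg_half[of "n + 4"]) (auto simp: phase_def)
      have "bound n 7 ^ k \<le> B" using bp by (intro kpow) auto
      moreover have "r ^ k \<le> B" using r bp by (intro kpow) auto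
      ultimately show ?thesis
        using transport_le_ray_density[OF \<open>0 < r\<close> _ o, of "bound n 7" y] flux_middle[of r y] r y bp by simp
    qed
    show "ray_density (bound n 7) (1/2) y * dil (r, y) \<le> flux (r, y) * q r"
      if r: "r \<in> {bound n 5..b}" and y: "y \<in> {B..2 * B}" for r y
    proof -
      have "phase n 1 \<le> 1 / r ^ m" "1 / r ^ m \<le> phase n 5" "0 < r"
        using phase_between[OF _ _ r[unfolded b_def]] ph phase_less[of 1 5 n] by auto
      then have o: "1/2 \<le> osc r"
        unfolding osc_def by (intro sin_ge_half[of "n + 4"]) (auto simp: phase_def)
      have "r ^ k \<le> B" using r bp by (intro kpow) auto
      then show ?thesis
        using ray_density_le_transport[OF _ _ o, of "bound n 7" y] flux_middle[of r y] r y bp by simp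
    qed
    show "B^3 / 1100 \<le> ray_density (bound n 7) (1/2) y - ray_density (bound n 7) (- (1/2)) y" if "y \<in> {B..2 * B}" for y
      using that B0 bp kpow[of "bound n 7"] by (intro ray_density_gap) auto
    show "0 \<le> B^3 / 1100" using B0 by simp
    \<comment> \<open>\<open>width r \<le> 3 * B\<close> and \<open>y \<le> 2 * B\<close>.\<close>
    show "dil (r, y) \<le> 5 * B" if "r \<in> {bound n 11..b}" "y \<in> {B..2 * B}" for r y
      using that kpow[of r] width_le(2)[of r] bp by (simp add: dil_def)
  qed (use bp B0 in auto)
  then have "B^4 / 3300 \<le> t * (5 * B * ((b - bound n 11) * B)) + t powr (1 - p) * E"
    by (simp add: E_def ncell_def b_def[symmetric] B_def[symmetric] power4_eq_xxxx power3_eq_cube)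
  moreover have "t * (5 * B * ((b - bound n 11) * B)) \<le> t * (5 * B * ((7 * B^4) * B))"
    using bp B0 by (intro mult_left_mono mult_right_mono) (auto simp: t_def)
  moreover have "t * (5 * B * ((7 * B^4) * B)) = B^4 / 6600"
    using B0 by (simp add: t_def power2_eq_square)
  ultimately have "B^4 / 6600 \<le> t powr (1 - p) * E" by linarith
  then have "t powr (p - 1) * (B^4 / 6600) \<le> t powr (p - 1) * (t powr (1 - p) * E)"
    by (rule mult_left_mono) simp
  moreover have "t powr (p - 1) * (t powr (1 - p) * E) = E"
  proof -
    have "t powr (p - 1) * t powr (1 - p) = t powr 0"
      by (simp flip: powr_add)
    moreover have "t powr 0 = 1" using B0 by (simp add: t_def)
    ultimately show ?thesis by (simp only: mult.assoc[symmetric] mult_1_left)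
  qed
  ultimately have upper: "t powr (p - 1) * (B^4 / 6600) \<le> E"
    by (simp only:)
  \<comment> \<open>The choice of \<open>k\<close> is used here: since \<open>b < 1\<close> and
    \<open>2 * k * (p - 1) \<ge> 1\<close>, the power of \<open>b\<close> is at least
    \<open>1 / b\<close>.\<close>
  have lower: "231000 powr (1 - p) * (1 / b) \<le> t powr (p - 1)"
  proof -
    have "B\<^sup>2 = b ^ (2 * k)"
      by (simp only: B_def power_mult[symmetric] mult.commute)
    then have "B\<^sup>2 = b powr (2 * real k)"
      using powr_realpow[OF b0(1), of "2 * k"] by simp
    then have e: "t = (1 / 231000) * b powr (- (2 * real k))"
      by (simp add: t_def powr_minus_divide)
    have "t powr (p - 1) = (1 / 231000) powr (p - 1) * b powr (- (2 * real k) * (p - 1))"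
      unfolding e by (simp only: powr_mult powr_powr)
    moreover have "(1 / 231000) powr (p - 1) = (231000 :: real) powr (1 - p)"
      by (simp add: powr_divide powr_minus_divide[symmetric])
    moreover have "b powr (- 1) \<le> b powr (- (2 * real k) * (p - 1))"
      using p b0 by (intro powr_mono') auto
    then have "(231000 :: real) powr (1 - p) * b powr (- 1) \<le> 231000 powr (1 - p) * b powr (- (2 * real k) * (p - 1))"
      by (rule mult_left_mono) simp
    moreover have "b powr (- 1) = 1 / b" using b0 by (simp add: powr_minus_divide)
    ultimately show ?thesis by (simp only:)
  qed
  have "231000 powr (1 - p) * (1 / b) * (B^4 / 6600) \<le> t powr (p - 1) * (B^4 / 6600)"
    by (rule mult_right_mono[OF lower]) (use B0 in simp)
  then have "231000 powr (1 - p) * (1 / b) * (B^4 / 6600) \<le> E"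
    using upper by (rule order_trans)
  moreover have "B^4 = 1 / phase n 1 * b"
  proof -
    have "B^4 = b ^ m * b"
      unfolding B_def by (simp only: power_mult[symmetric] mult.commute[of k 4] Suc_m[symmetric] power_Suc2)
    then show ?thesis using ray_at(3)[of "phase n 1"] ph by (simp add: b_def)
  qed
  ultimately show ?thesis using b0 by (simp add: E_def)
qed

lemma ncell_in: "ncell n \<subseteq> U" "ncell n \<in> sets (leb 2)"
proof -
  note bp = bound_props[of n]
  have p: "0 < bound n 1 ^ k" using bp by (intro zero_less_power) linarith
  show "ncell n \<subseteq> U" "ncell n \<in> sets (leb 2)"
    unfolding ncell_def
    by (rule cell_subset_U[where ?s2.0 = "bound n 7" and ?s3.0 = "bound n 5" and w = "bound n 1 ^ k * min (bound n 7 - bound n 11) (bound n 1 - bound n 5)"],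
        use bp p in auto)
       (rule cell_sets[where ?s2.0 = "bound n 7" and ?s3.0 = "bound n 5" and w = "bound n 1 ^ k * min (bound n 7 - bound n 11) (bound n 1 - bound n 5)"],
        use bp p in auto)
qed

text \<open>A common point would lie on a common ray by injectivity of \<open>\<Phi>\<close>, but
  the phase windows of different periods do not meet.\<close>

lemma ncell_disjoint: "disjoint_family ncell"
proof -
  have "ncell i \<inter> ncell j = {}" if ij: "i < j" for i j
  proof (rule ccontr)
    assume "ncell i \<inter> ncell j \<noteq> {}"
    then obtain z z' where "z \<in> {bound i 11..bound i 1} \<times> {bound i 1 ^ k..2 * bound i 1 ^ k}"
      "z' \<in> {bound j 11..bound j 1} \<times> {bound j 1 ^ k..2 * bound j 1 ^ k}" "\<Phi> z = \<Phi> z'"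
      unfolding ncell_def cell_def by blast
    then obtain r y r' y' where *: "r \<in> {bound i 11..bound i 1}" "r' \<in> {bound j 11..bound j 1}"
      "y \<in> {bound i 1 ^ k..2 * bound i 1 ^ k}" "y' \<in> {bound j 1 ^ k..2 * bound j 1 ^ k}" "\<Phi> (r, y) = \<Phi> (r', y')"
      by (cases z; cases z') auto
    have "(r, y) \<in> K" "(r', y') \<in> K"
      using * bound_props[of i] bound_props[of j]
      by (auto simp: K_def intro: order_trans[OF zero_le_power])
    then have "r = r'" using *(5) inj_on_Phi by (auto simp: inj_on_def)
    then have "phase j 1 \<le> phase i 11"
      using phase_between(2)[OF _ _ *(2)] phase_between(3)[OF _ _ *(1)] phase_ge[of 1 i] phase_ge[of 1 j]
        phase_less[of 1 11 i] phase_less[of 1 11 j] by force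
    moreover have "phase i 11 < phase j 1"
    proof -
      have "2 * pi * (real (i + 4) + 1) \<le> 2 * pi * real (j + 4)"
        using ij pi_gt_zero by (intro mult_left_mono) auto
      then have "2 * pi * real (i + 4) + 2 * pi \<le> 2 * pi * real (j + 4)" by (simp add: algebra_simps)
      then show ?thesis unfolding phase_def using pi_gt_zero by linarith
    qed
    ultimately show False by simp
  qed
  then show ?thesis
    unfolding disjoint_family_on_def by (metis Int_commute linorder_neqE_nat)
qed

text \<open>Already the vertical weak derivative cannot be in \<open>Lp\<close>: on the disjoint
  cells its contributions dominate a multiple of the harmonic series, while together they are
  bounded by the integral over \<open>U\<close>.\<close>

lemma transport_density_not_W1p:
  assumes td: "transport_density 2 \<Omega> fp fm \<sigma>" and p: "1 < p" "1 \<le> 2 * real k * (p - 1)"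
  shows "\<sigma> \<notin> W1p 2 U p"
proof
  assume "\<sigma> \<in> W1p 2 U p"
  then have "\<forall>i<2. \<exists>g\<in>Lp 2 U p. weak_partial 2 U i \<sigma> g" by (simp add: W1p_def)
  from this[rule_format, of 1] obtain g where g: "g \<in> Lp 2 U p" and weak: "weak_partial 2 U 1 \<sigma> g"
    by auto
  let ?f = "\<lambda>P. \<bar>g P\<bar> powr p"
  let ?c = "231000 powr (1 - p) / 6600"
  have iU: "set_integrable (leb 2) U ?f" using g by (simp add: Lp_def)
  have iC: "set_integrable (leb 2) (ncell n) ?f" for n
    by (rule set_integrable_subset[OF iU ncell_in(2,1)])
  have c0: "0 < ?c" by simp
  define T where "T = (LINT P:U|leb 2. ?f P)"
  have bound: "harm N \<le> 40 * T / ?c" for N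
  proof -
    have "(\<Sum>n<N. ?c * inverse (real (Suc n)) / 40) \<le> (\<Sum>n<N. (LINT P:ncell n|leb 2. ?f P))"
    proof (rule sum_mono)
      fix n
      \<comment> \<open>With \<open>pi < 4\<close> the phase is at most \<open>8 * n + 36\<close>,
        hence at most \<open>40 * (n + 1)\<close>.\<close>
      have "phase n 1 \<le> 2 * 4 * real (n + 4) + 4"
        unfolding phase_def using pi_less_4 by (intro add_mono mult_right_mono) auto
      then have "phase n 1 \<le> 40 * real (Suc n)" by simp
      then have "?c / (40 * real (Suc n)) \<le> ?c / phase n 1"
        using phase_ge[of 1 n] c0 by (intro divide_left_mono) auto
      also have "\<dots> \<le> (LINT P:ncell n|leb 2. ?f P)"
        by (rule ncell_lower_bound[OF td weak g p])
      finally show "?c * inverse (real (Suc n)) / 40 \<le> (LINT P:ncell n|leb 2. ?f P)"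
        by (simp add: field_simps)
    qed
    also have "\<dots> = (LINT P|leb 2. (\<Sum>n<N. indicator (ncell n) P *\<^sub>R ?f P))"
      using iC unfolding set_lebesgue_integral_def set_integrable_def
      by (intro Bochner_Integration.integral_sum[symmetric]) auto
    also have "\<dots> \<le> T"
      unfolding T_def set_lebesgue_integral_def
    proof (rule integral_mono)
      show "integrable (leb 2) (\<lambda>P. \<Sum>n<N. indicator (ncell n) P *\<^sub>R ?f P)"
        using iC by (intro Bochner_Integration.integrable_sum) (auto simp: set_integrable_def)
      show "integrable (leb 2) (\<lambda>P. indicator U P *\<^sub>R ?f P)"
        using iU by (simp add: set_integrable_def)
      fix P
      have "(\<Sum>n<N. indicator (ncell n) P) = (indicator (\<Union>(ncell ` {..<N})) P :: real)"
        by (rule indicator_UN_disjoint[symmetric]) (use disjoint_family_on_mono[OF _ ncell_disjoint] in auto)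
      also have "\<dots> \<le> indicator U P"
        using ncell_in(1) by (auto split: split_indicator)
      finally show "(\<Sum>n<N. indicator (ncell n) P *\<^sub>R ?f P) \<le> indicator U P *\<^sub>R ?f P"
        by (simp add: mult_right_mono flip: sum_distrib_right)
    qed
    finally have "(\<Sum>n<N. ?c * inverse (real (Suc n)) / 40) \<le> T" .
    moreover have "(\<Sum>n<N. ?c * inverse (real (Suc n)) / 40) = ?c * harm N / 40"
      by (simp only: harm_altdef sum_distrib_left sum_divide_distrib)
    ultimately show ?thesis using c0 by (simp only: pos_le_divide_eq) (simp add: mult.commute)
  qed
  have "eventually (\<lambda>N. 40 * T / ?c + 1 \<le> harm N) sequentially"
    using harm_at_top unfolding filterlim_at_top by blast
  then obtain N where "40 * T / ?c + 1 \<le> harm N"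
    by (auto simp: eventually_sequentially)
  with bound[of N] show False by linarith
qed

end

theorem mainTheorem1:
  fixes p :: real
  assumes "1 < p"
  shows "\<exists>(d::nat) (\<Omega>::point set) (fp::point \<Rightarrow> real) (fm::point \<Rightarrow> real).
    1 \<le> d \<and>
    compactin (Euclidean_space d) \<Omega> \<and> convex_set \<Omega> \<and> Euclidean_space d interior_of \<Omega> \<noteq> {} \<and>
    (\<forall>x\<in>\<Omega>. 0 \<le> fp x) \<and> (\<forall>x\<in>\<Omega>. 0 \<le> fm x) \<and>
    set_integrable (leb d) \<Omega> fp \<and> set_integrable (leb d) \<Omega> fm \<and>
    fp \<in> W1p d (Euclidean_space d interior_of \<Omega>) p \<and>
    fm \<in> W1p d (Euclidean_space d interior_of \<Omega>) p \<and>
    (LINT x:\<Omega>|leb d. fp x) = (LINT x:\<Omega>|leb d. fm x) \<and>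
    (\<exists>\<sigma>. transport_density d \<Omega> fp fm \<sigma>) \<and>
    (\<forall>\<sigma>. transport_density d \<Omega> fp fm \<sigma> \<longrightarrow> \<sigma> \<notin> W1p d (Euclidean_space d interior_of \<Omega>) p)"
proof -
  \<comment> \<open>Large enough for \<open>2 * k * (p - 1) \<ge> 1\<close>, the threshold for
    divergence; the successor also makes \<open>k\<close> positive.\<close>
  define k where "k = Suc (nat \<lceil>1 / (2 * (p - 1))\<rceil>)"
  have "1 / (2 * (p - 1)) \<le> real k"
    unfolding k_def by linarith
  then have k2: "1 \<le> 2 * real k * (p - 1)"
    using assms by (simp add: pos_divide_le_eq mult_ac)
  interpret oscillation k
    by standard (simp add: k_def)
  have "compactin (Euclidean_space 2) \<Omega>"
    using compact_Omega Omega_subset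
    by (simp add: Euclidean_space_eq_top_of_set topspace_Euclidean_space compactin_subtopology)
  moreover have "set_integrable (leb 2) \<Omega> fp" "set_integrable (leb 2) \<Omega> fm"
    unfolding set_integrable_leb_Omega fp_def[abs_def] fm_def[abs_def]
    by (intro integrable_comp_Psi cont_Fp cont_Fm)+
  moreover have "(LINT x:\<Omega>|leb 2. fp x) = (LINT x:\<Omega>|leb 2. fm x)"
    by (simp add: set_integral_leb_Omega mass_balance)
  ultimately show ?thesis
    using convex_Omega U_nonempty fp_nonneg fm_nonneg src_W1p[of p] tgt_W1p[of p] assms
      transport_density_sigma0 transport_density_not_W1p[OF _ assms k2]
    unfolding U_def
    by (intro exI[of _ "2::nat"] exI[of _ \<Omega>] exI[of _ fp] exI[of _ fm]) auto
qed

end
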